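(* Let $r\ge1$, $\lambda\in H(m,n;r)$, and let $\mu=(\mu_1,\ldots,\mu_{m+n})$ be a weak $(m+n)$-composition of $r$ (nonnegative integers with sum $r$). Let $I=(1^{\mu_1},2^{\mu_2},\ldots,(m+n)^{\mu_{m+n}})=(i_1\le\cdots\le i_r)$ be the corresponding non-decreasing multiset. Let $\mathcal{T}$ be a standard Young tableau of shape $\lambda$ and $L=\mathcal{E}^\lambda_{\mathcal{T}}\cdot(\mathbb{C}^{m|n})^{\otimes r}$ (a $U(\mathfrak{gl}_{m|n})$-submodule isomorphic to the irreducible covariant module $L(\boldsymbol\lambda)$ attached to $\lambda$), and let $L_\mu=L\cap W_\mu$ be its $\mu$-weight space. Then $$\frac{\mathrm{Imm}_{\chi^{\lambda}}(X_I)}{\alpha(I)}=\mathrm{str}\Big((1\otimes\mathcal{P}_\mu)\circ\Delta\big|_{L_\mu}\Big).$$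
   Context: Notation. $\mathbb{C}^{m|n}$ has homogeneous basis $e_1,\ldots,e_{m+n}$ with parity $\bar i=0$ for $i\le m$, $\bar i=1$ for $i>m$; $e_{ij}$ are matrix units of parity $\bar i+\bar j$. $\mathcal{A}=A(\mathrm{Mat}_{m|n})$ is the free supercommutative $\mathbb{C}$-algebra on generators $x_{ij}$ of parity $\bar i+\bar j$. $X_a=\sum_{i,j}x_{ij}\otimes1^{\otimes(a-1)}\otimes e_{ij}\otimes1^{\otimes(r-a)}\in\mathcal{A}\otimes\mathrm{End}(\mathbb{C}^{m|n})^{\otimes r}$ (graded tensor products, sign rule $(a\otimes b)(c\otimes d)=(-1)^{|b||c|}ac\otimes bd$). $\mathfrak{S}_r$ acts on $(\mathbb{C}^{m|n})^{\otimes r}$ by $\sigma\cdot(e_{i_1}\otimes\cdots\otimes e_{i_r})=(-1)^{\bar I_\sigma}e_{i_{\sigma^{-1}(1)}}\otimes\cdots\otimes e_{i_{\sigma^{-1}(r)}}$, $\bar I_\sigma=\sum_{k<l,\sigma(k)>\sigma(l)}\bar i_k\bar i_l$, extended linearly to $\mathbb{C}[\mathfrak{S}_r]$ (viewed as even elements $1\otimes(\cdot)$). An even $T=\sum_{I,J}T^I_J\otimes e_{i_1j_1}\otimes\cdots\otimes e_{i_rj_r}$ has coefficients $\langle i_1,\ldots,i_r\mid T\mid j_1,\ldots,j_r\rangle=(-1)^{\gamma(I,J)}T^I_J$, $\gamma(I,J)=\sum_a\bar i_a(\bar j_a+1)+\sum_{a<b}\bar j_b(\bar i_a+\bar j_a)$.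 A class function $\chi$ is identified with $\sum_\sigma\chi(\sigma)\sigma$, and the super-immanant is $\mathrm{Imm}_\chi(X_I)=(-1)^{\sum_k\bar i_k}\langle I\mid\chi X_1\cdots X_r\mid I\rangle$; $\chi^\lambda$ is the irreducible character indexed by $\lambda$. $\mathcal{E}^\lambda_{\mathcal{T}}$ is the primitive Young seminormal idempotent of $\mathbb{C}[\mathfrak{S}_r]$ for $\mathcal{T}$ (characterized by $y_k\mathcal{E}^\lambda_{\mathcal{T}}=c_k(\mathcal{T})\mathcal{E}^\lambda_{\mathcal{T}}$, $y_k=\sum_{i<k}(i\,k)$ Jucys–Murphy elements, $c_k(\mathcal{T})$ the content of the box containing $k$). $H(m,n;r)$ is the set of $\lambda\vdash r$ with $\lambda_{m+1}\le n$. For the multiset $I$, $\alpha(I)=\mu_1!\mu_2!\cdots\mu_{m+n}!$ and $\bar I=\bar i_1+\cdots+\bar i_r$. The group $\mathfrak S_r$ and $\mathfrak{gl}_{m|n}$ (basis $E_{ij}$, acting on tensors with the usual Koszul signs) act commutingly on $(\mathbb{C}^{m|n})^{\otimes r}$. Weight spaces and comodule. $W_\mu\subseteq(\mathbb{C}^{m|n})^{\otimes r}$ is the span of all $e_{j_1}\otimes\cdots\otimes e_{j_r}$ with $(j_1,\ldots,j_r)$ a rearrangement of $I$ (the $\mu$-weight space); all these vectors have parity $\bar I$. $\mathcal{P}_\mu$ is the projection of $(\mathbb{C}^{m|n})^{\otimes r}$ onto $W_\mu$ that kills all other basis tensors. The $\mathcal{A}$-comodule structure is $\Delta(e_{j_1}\otimes\cdots\otimes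 e_{j_r})=\sum_{(i_1,\ldots,i_r)}(-1)^{\sum_{a<b}\bar i_a(\bar i_b+\bar j_b)}x_{i_1j_1}\cdots x_{i_rj_r}\otimes e_{i_1}\otimes\cdots\otimes e_{i_r}$ (sum over all $r$-tuples in $[m+n]$). The map $(1\otimes\mathcal{P}_\mu)\circ\Delta$ sends $L_\mu$ into $\mathcal{A}\otimes L_\mu$, and with respect to a basis of $L_\mu$ it is given by a square matrix with entries in the commutative even part $\mathcal{A}_0$; its supertrace $\mathrm{str}$ is defined as $(-1)^{\bar I}$ times the trace of this matrix. *)

theory Defs
  imports Complex_Main "HOL-Library.Multiset" "HOL-Library.Product_Lexorder"
          "HOL-Combinatorics.Combinatorics"
begin

(* Conventions.  Basis indices of C^{m|n} are 1..m+n; index i is odd iff  *)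
(* m < i.  Tensor positions a are 1..r, stored in lists at list index     *)
(* a-1.  Permutations are functions permuting {1..r}; (sigma tau) means  *)
(* sigma o tau.                                                           *)

definition sg :: "nat \<Rightarrow> complex" where
  "sg k = (-1) ^ k"

definition ipar :: "nat \<Rightarrow> nat \<Rightarrow> nat" where
  "ipar m i = (if m < i then 1 else 0)"

(* A generator x_ij is the pair (i,j).  A monomial is a finite multiset of
   generators in which each odd generator occurs at most once; it stands for
   the product of its generators with the odd ones in increasing
   (lexicographic) order.  An element of A is its coefficient function.    *)

type_synonym gen = "nat \<times> nat"
type_synonym mono = "gen multiset"
type_synonym salg = "mono \<Rightarrow> complex"

definition gpar :: "nat \<Rightarrow> gen \<Rightarrow> nat" where
  "gpar m g = (ipar m (fst g) + ipar m (snd g)) mod 2"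

definition mpar :: "nat \<Rightarrow> mono \<Rightarrow> nat" where
  "mpar m M = (\<Sum>g\<in>#M. gpar m g) mod 2"

definition valid_mono :: "nat \<Rightarrow> mono \<Rightarrow> bool" where
  "valid_mono m M = (\<forall>g. gpar m g = 1 \<longrightarrow> count M g \<le> 1)"

(* sign of reordering (odd part of N)(odd part of R) into increasing order *)
definition reorder_sign :: "nat \<Rightarrow> mono \<Rightarrow> mono \<Rightarrow> complex" where
  "reorder_sign m N R = sg (card {(a, b). (a, b) \<in> set_mset N \<times> set_mset R \<and>
      gpar m a = 1 \<and> gpar m b = 1 \<and> b < a})"

definition smul :: "nat \<Rightarrow> salg \<Rightarrow> salg \<Rightarrow> salg" where
  "smul m f g = (\<lambda>M. if valid_mono m M
      then (\<Sum>N\<in>{N. N \<subseteq># M}. reorder_sign m N (M - N) * f N * g (M - N))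
      else 0)"

definition sone :: salg where
  "sone = (\<lambda>M. if M = {#} then 1 else 0)"

definition sgen :: "nat \<Rightarrow> nat \<Rightarrow> salg" where
  "sgen i j = (\<lambda>M. if M = {#(i, j)#} then 1 else 0)"

definition sscale :: "complex \<Rightarrow> salg \<Rightarrow> salg" where
  "sscale c f = (\<lambda>M. c * f M)"

definition spart :: "nat \<Rightarrow> nat \<Rightarrow> salg \<Rightarrow> salg" where
  "spart m p f = (\<lambda>M. if mpar m M = p then f M else 0)"

definition sprod :: "nat \<Rightarrow> salg list \<Rightarrow> salg" where
  "sprod m fs = foldr (smul m) fs sone"

definition idx :: "nat \<Rightarrow> nat \<Rightarrow> nat list set" where
  "idx N r = {J. length J = r \<and> set J \<subseteq> {1..N}}"

(* T I J is the coefficient T^I_J of e_{i1 j1} \<otimes> ... \<otimes> e_{ir jr}. *)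
type_synonym tens = "nat list \<Rightarrow> nat list \<Rightarrow> salg"

definition epar :: "nat \<Rightarrow> nat \<Rightarrow> nat list \<Rightarrow> nat list \<Rightarrow> nat" where
  "epar m r I J = (\<Sum>a<r. ipar m (I ! a) + ipar m (J ! a))"

(* sign from the graded tensor product of the End-factors:
   (x_1\<otimes>..\<otimes>x_r)(y_1\<otimes>..\<otimes>y_r) = (-1)^{sum_{a<b}|x_b||y_a|} x_1y_1\<otimes>..\<otimes>x_ry_r *)
definition esign :: "nat \<Rightarrow> nat \<Rightarrow> nat list \<Rightarrow> nat list \<Rightarrow> nat list \<Rightarrow> nat" where
  "esign m r I J L = (\<Sum>a<r. \<Sum>b<r. if a < b
      then (ipar m (I ! b) + ipar m (J ! b)) * (ipar m (J ! a) + ipar m (L ! a)) else 0)"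

(* product with the sign rule (a \<otimes> e)(b \<otimes> e') = (-1)^{|e||b|} ab \<otimes> ee' *)
definition tmul :: "nat \<Rightarrow> nat \<Rightarrow> nat \<Rightarrow> tens \<Rightarrow> tens \<Rightarrow> tens" where
  "tmul m n r T U = (\<lambda>I L M. \<Sum>J\<in>idx (m + n) r. \<Sum>p\<in>{0, 1::nat}.
      sg (p * epar m r I J + esign m r I J L) * smul m (T I J) (spart m p (U J L)) M)"

definition tone :: "nat \<Rightarrow> nat \<Rightarrow> nat \<Rightarrow> tens" where
  "tone m n r = (\<lambda>I J. if I = J \<and> I \<in> idx (m + n) r then sone else (\<lambda>_. 0))"

definition Xop :: "nat \<Rightarrow> nat \<Rightarrow> nat \<Rightarrow> nat \<Rightarrow> tens" where
  "Xop m n r a = (\<lambda>I J. if I \<in> idx (m + n) r \<and> J \<in> idx (m + n) r \<and>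
      (\<forall>b<r. b \<noteq> a - 1 \<longrightarrow> I ! b = J ! b)
      then sgen (I ! (a - 1)) (J ! (a - 1)) else (\<lambda>_. 0))"

definition Xprod :: "nat \<Rightarrow> nat \<Rightarrow> nat \<Rightarrow> tens" where
  "Xprod m n r = foldr (tmul m n r) (map (Xop m n r) [1..<r + 1]) (tone m n r)"

type_synonym tvec = "nat list \<Rightarrow> complex"

definition tspace :: "nat \<Rightarrow> nat \<Rightarrow> nat \<Rightarrow> tvec set" where
  "tspace m n r = {v. \<forall>K. K \<notin> idx (m + n) r \<longrightarrow> v K = 0}"

definition tbasis :: "nat list \<Rightarrow> tvec" where
  "tbasis J = (\<lambda>K. if K = J then 1 else 0)"

definition perms :: "nat \<Rightarrow> (nat \<Rightarrow> nat) set" where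
  "perms r = {\<sigma>. \<sigma> permutes {1..r}}"

definition peps :: "nat \<Rightarrow> nat \<Rightarrow> (nat \<Rightarrow> nat) \<Rightarrow> nat list \<Rightarrow> complex" where
  "peps m r \<sigma> J = sg (card {(k, l). k \<in> {1..r} \<and> l \<in> {1..r} \<and> k < l \<and> \<sigma> l < \<sigma> k \<and>
      ipar m (J ! (k - 1)) = 1 \<and> ipar m (J ! (l - 1)) = 1})"

(* sigma . e_J = peps sigma J * e_{J'} with J'_k = J_{sigma^-1 k};
   so the K-coordinate of sigma.v is peps sigma J * v J with J_l = K_{sigma l} *)
definition pact :: "nat \<Rightarrow> nat \<Rightarrow> nat \<Rightarrow> (nat \<Rightarrow> nat) \<Rightarrow> tvec \<Rightarrow> tvec" where
  "pact m n r \<sigma> v = (\<lambda>K. if K \<in> idx (m + n) r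
      then (let J = map (\<lambda>l. K ! (\<sigma> l - 1)) [1..<r + 1] in peps m r \<sigma> J * v J)
      else 0)"

type_synonym galg = "(nat \<Rightarrow> nat) \<Rightarrow> complex"

definition galg :: "nat \<Rightarrow> galg set" where
  "galg r = {x. \<forall>\<pi>. \<pi> \<notin> perms r \<longrightarrow> x \<pi> = 0}"

definition gbasis :: "(nat \<Rightarrow> nat) \<Rightarrow> galg" where
  "gbasis \<sigma> = (\<lambda>\<pi>. if \<pi> = \<sigma> then 1 else 0)"

definition gmul :: "nat \<Rightarrow> galg \<Rightarrow> galg \<Rightarrow> galg" where
  "gmul r x y = (\<lambda>\<pi>. if \<pi> \<in> perms r
      then (\<Sum>\<sigma>\<in>perms r. x \<sigma> * y (inv \<sigma> \<circ> \<pi>)) else 0)"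

definition gscale :: "complex \<Rightarrow> galg \<Rightarrow> galg" where
  "gscale c x = (\<lambda>\<pi>. c * x \<pi>)"

definition gact :: "nat \<Rightarrow> nat \<Rightarrow> nat \<Rightarrow> galg \<Rightarrow> tvec \<Rightarrow> tvec" where
  "gact m n r x v = (\<lambda>K. \<Sum>\<sigma>\<in>perms r. x \<sigma> * pact m n r \<sigma> v K)"

definition jm :: "nat \<Rightarrow> galg" where
  "jm k = (\<lambda>\<pi>. \<Sum>i\<in>{1..<k}. if \<pi> = transpose i k then 1 else 0)"

definition is_partition :: "nat \<Rightarrow> nat list \<Rightarrow> bool" where
  "is_partition r lam = (sorted_wrt (\<ge>) lam \<and> (\<forall>x\<in>set lam. 0 < x) \<and> sum_list lam = r)"

(* lambda_{m+1} <= n, with lambda_k = 0 beyond the length *)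
definition hook_set :: "nat \<Rightarrow> nat \<Rightarrow> nat \<Rightarrow> nat list set" where
  "hook_set m n r = {lam. is_partition r lam \<and> (m < length lam \<longrightarrow> lam ! m \<le> n)}"

definition boxes :: "nat list \<Rightarrow> (nat \<times> nat) set" where
  "boxes lam = {(i, j). i < length lam \<and> j < lam ! i}"

definition is_syt :: "nat list \<Rightarrow> (nat \<times> nat \<Rightarrow> nat) \<Rightarrow> bool" where
  "is_syt lam T = (bij_betw T (boxes lam) {1..sum_list lam} \<and>
      (\<forall>i j. (i, Suc j) \<in> boxes lam \<longrightarrow> T (i, j) < T (i, Suc j)) \<and>
      (\<forall>i j. (Suc i, j) \<in> boxes lam \<longrightarrow> T (i, j) < T (Suc i, j)))"

definition content :: "nat list \<Rightarrow> (nat \<times> nat \<Rightarrow> nat) \<Rightarrow> nat \<Rightarrow> int" where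
  "content lam T k = (let b = (THE b. b \<in> boxes lam \<and> T b = k) in int (snd b) - int (fst b))"

definition seminormal :: "nat list \<Rightarrow> (nat \<times> nat \<Rightarrow> nat) \<Rightarrow> galg" where
  "seminormal lam T = (let r = sum_list lam in
     THE e. e \<in> galg r \<and> e \<noteq> (\<lambda>_. 0) \<and> gmul r e e = e \<and>
       (\<forall>k\<in>{1..r}. gmul r (jm k) e = gscale (of_int (content lam T k)) e \<and>
                    gmul r e (jm k) = gscale (of_int (content lam T k)) e))"

definition lcomb :: "('a \<Rightarrow> complex) list \<Rightarrow> (nat \<Rightarrow> complex) \<Rightarrow> 'a \<Rightarrow> complex" where
  "lcomb bs c = (\<lambda>z. \<Sum>k<length bs. c k * (bs ! k) z)"

definition is_basis :: "('a \<Rightarrow> complex) set \<Rightarrow> ('a \<Rightarrow> complex) list \<Rightarrow> bool" where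
  "is_basis U bs = (set bs \<subseteq> U \<and>
      (\<forall>c. lcomb bs c = (\<lambda>_. 0) \<longrightarrow> (\<forall>k<length bs. c k = 0)) \<and>
      (\<forall>u\<in>U. \<exists>c. u = lcomb bs c))"

definition coords :: "('a \<Rightarrow> complex) list \<Rightarrow> ('a \<Rightarrow> complex) \<Rightarrow> nat \<Rightarrow> complex" where
  "coords bs u = (THE c. u = lcomb bs c \<and> (\<forall>k\<ge>length bs. c k = 0))"

definition trace_on :: "('a \<Rightarrow> complex) set \<Rightarrow> (('a \<Rightarrow> complex) \<Rightarrow> ('a \<Rightarrow> complex)) \<Rightarrow> complex" where
  "trace_on U f = (let bs = (SOME bs. is_basis U bs) in
      \<Sum>k<length bs. coords bs (f (bs ! k)) k)"

(* the character of the left ideal C[S_r] E^lam_T (a Specht module, i.e. the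
   irreducible S_r-module indexed by lam), for a standard tableau T of shape lam *)
definition irr_char :: "nat list \<Rightarrow> galg" where
  "irr_char lam = (let r = sum_list lam; T = (SOME T. is_syt lam T);
      e = seminormal lam T; U = {gmul r x e | x. x \<in> galg r} in
      (\<lambda>\<sigma>. if \<sigma> \<in> perms r then trace_on U (\<lambda>x. gmul r (gbasis \<sigma>) x) else 0))"

(* identification End(V^{\<otimes> r}) = End(V)^{\<otimes> r}: the tensor e_{i1j1}\<otimes>..\<otimes>e_{irjr}
   acts on e_J by (-1)^{sgam I J} e_I (Koszul signs); hence an operator with
   matrix entries a_{IJ} has tensor coefficients (-1)^{sgam I J} a_{IJ}. *)
definition sgam :: "nat \<Rightarrow> nat \<Rightarrow> nat list \<Rightarrow> nat list \<Rightarrow> nat" where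
  "sgam m r I J = (\<Sum>a<r. \<Sum>b<r. if b < a then (ipar m (I ! a) + ipar m (J ! a)) * ipar m (J ! b) else 0)"

definition gal_tens :: "nat \<Rightarrow> nat \<Rightarrow> nat \<Rightarrow> galg \<Rightarrow> tens" where
  "gal_tens m n r x = (\<lambda>I J. if I \<in> idx (m + n) r \<and> J \<in> idx (m + n) r
      then sscale (sg (sgam m r I J) * gact m n r x (tbasis J) I) sone else (\<lambda>_. 0))"

definition gammaIJ :: "nat \<Rightarrow> nat \<Rightarrow> nat list \<Rightarrow> nat list \<Rightarrow> nat" where
  "gammaIJ m r I J = (\<Sum>a<r. ipar m (I ! a) * (ipar m (J ! a) + 1)) +
      (\<Sum>a<r. \<Sum>b<r. if a < b then ipar m (J ! b) * (ipar m (I ! a) + ipar m (J ! a)) else 0)"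

definition bracket :: "nat \<Rightarrow> nat \<Rightarrow> nat list \<Rightarrow> tens \<Rightarrow> nat list \<Rightarrow> salg" where
  "bracket m r I T J = sscale (sg (gammaIJ m r I J)) (T I J)"

definition Ibar :: "nat \<Rightarrow> nat list \<Rightarrow> nat" where
  "Ibar m I = (\<Sum>k<length I. ipar m (I ! k))"

definition imm :: "nat \<Rightarrow> nat \<Rightarrow> nat \<Rightarrow> galg \<Rightarrow> nat list \<Rightarrow> salg" where
  "imm m n r chi I = sscale (sg (Ibar m I))
      (bracket m r I (tmul m n r (gal_tens m n r chi) (Xprod m n r)) I)"

definition Imu :: "nat list \<Rightarrow> nat list" where
  "Imu mu = concat (map (\<lambda>i. replicate (mu ! (i - 1)) i) [1..<length mu + 1])"

definition alpha :: "nat list \<Rightarrow> nat" where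
  "alpha mu = prod_list (map fact mu)"

definition Wmu :: "nat \<Rightarrow> nat \<Rightarrow> nat \<Rightarrow> nat list \<Rightarrow> tvec set" where
  "Wmu m n r mu = {v. \<forall>K. v K \<noteq> 0 \<longrightarrow> K \<in> idx (m + n) r \<and> mset K = mset (Imu mu)}"

definition Lmod :: "nat \<Rightarrow> nat \<Rightarrow> nat list \<Rightarrow> (nat \<times> nat \<Rightarrow> nat) \<Rightarrow> tvec set" where
  "Lmod m n lam T = (let r = sum_list lam in
      {gact m n r (seminormal lam T) v | v. v \<in> tspace m n r})"

definition dsign :: "nat \<Rightarrow> nat \<Rightarrow> nat list \<Rightarrow> nat list \<Rightarrow> nat" where
  "dsign m r I J = (\<Sum>a<r. \<Sum>b<r. if a < b then ipar m (I ! a) * (ipar m (I ! b) + ipar m (J ! b)) else 0)"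

(* (1 \<otimes> P_mu) \<circ> Delta, extended linearly; an element of A \<otimes> V^{\<otimes> r} is
   given by its coefficient (in A) of each basis tensor e_I *)
definition deltaP :: "nat \<Rightarrow> nat \<Rightarrow> nat \<Rightarrow> nat list \<Rightarrow> tvec \<Rightarrow> nat list \<Rightarrow> salg" where
  "deltaP m n r mu v = (\<lambda>I. if I \<in> idx (m + n) r \<and> mset I = mset (Imu mu)
      then (\<lambda>M. \<Sum>J\<in>idx (m + n) r. v J * (sg (dsign m r I J) *
               sprod m (map (\<lambda>a. sgen (I ! a) (J ! a)) [0..<r]) M))
      else (\<lambda>_. 0))"

definition represents :: "nat \<Rightarrow> nat \<Rightarrow> nat \<Rightarrow> nat list \<Rightarrow> tvec list \<Rightarrow> (nat \<Rightarrow> nat \<Rightarrow> salg) \<Rightarrow> bool" where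
  "represents m n r mu bs a = (\<forall>k<length bs.
      deltaP m n r mu (bs ! k) = (\<lambda>I M. \<Sum>l<length bs. (bs ! l) I * a l k M))"

end

theory Submission
  imports Defs "HOL-Library.Function_Algebras"
begin

text \<open>
  Let \<open>e\<close> be the seminormal idempotent of \<open>T\<close>. The character of the left ideal generated by \<open>e\<close>
  satisfies \<open>\<Sum>\<sigma>. \<chi> \<sigma> \<cdot> \<sigma> = \<Sum>h. h e h\<inverse>\<close>, because \<open>e\<close> is fixed by \<open>\<sigma> \<mapsto> \<sigma>\<inverse>\<close>. The matrix \<open>D\<close> of
  the coaction commutes with the signed place permutations, so the super-immanant is, up to its
  sign, \<open>\<Sum>h. (h e D h\<inverse>)_(I,I) = \<Sum>h. (e D)_(I h, I h)\<close>. Every rearrangement \<open>J\<close> of \<open>I\<close> equals \<open>I h\<close>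
  for exactly \<open>\<alpha>(I)\<close> permutations \<open>h\<close>, and \<open>\<Sum>J. (e D)_(J,J)\<close> is the trace of \<open>D\<close> on the image of
  the projection \<open>e\<close> in the weight space.

  That the seminormal idempotent exists, is unique, and yields the same sum \<open>\<Sum>h. h e h\<inverse>\<close> for all
  tableaux of one shape follows from Young's orthogonal form, realised at once on all content words
  of length \<open>r\<close>: its image contains all matrix units between words with the same contents, and there
  are \<open>r!\<close> such pairs, so the group algebra is isomorphic to this algebra of block matrices. The
  idempotents are the preimages of the diagonal matrix units.
\<close>

subsection \<open>Permutations and the Coxeter presentation\<close>

text \<open>\<open>seminormal\<close> and \<open>irr_char\<close> are defined by THE and SOME, so
  existence, uniqueness and independence of the tableau come before any computation. Once the
  dimension count has made the matrix entries \<open>matel\<close> faithful, idempotency and the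
  Jucys-Murphy eigenvalue equations in the group algebra are checked on matrix entries. Words of
  contents replace tableaux because their letters are the Jucys-Murphy eigenvalues themselves: the
  shape survives as the multiset of letters, and a simple transposition mixes a word only with the
  word in which two neighbouring letters are exchanged. On the super side the coaction has entries
  in the supercommutative algebra, but only linear algebra over \<complex> is applied to it. Taking
  the coefficient of one monomial \<open>M\<close> at a time turns it into a complex matrix, so
  traces and commutation are handled monomial by monomial. Its commutation with permutations is
  checked for adjacent transpositions, where only two tensor positions contribute signs.\<close>

lemma id_perms [simp]: "id \<in> perms r"
  by (simp add: perms_def permutes_id)

lemma comp_perms [simp]: "\<sigma> \<in> perms r \<Longrightarrow> \<tau> \<in> perms r \<Longrightarrow> \<sigma> \<circ> \<tau> \<in> perms r"
  by (simp add: perms_def permutes_compose)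

lemma inv_perms [simp]: "\<sigma> \<in> perms r \<Longrightarrow> inv \<sigma> \<in> perms r"
  by (simp add: perms_def permutes_inv)

lemma finite_perms [simp]: "finite (perms r)"
  by (simp add: perms_def finite_permutations)

lemma card_perms: "card (perms r) = fact r"
  unfolding perms_def by (rule card_permutations) auto

lemma perms_inv_o: "\<sigma> \<in> perms r \<Longrightarrow> inv \<sigma> \<circ> \<sigma> = id" "\<sigma> \<in> perms r \<Longrightarrow> \<sigma> \<circ> inv \<sigma> = id"
  by (simp_all add: perms_def permutes_inv_o)

lemma perms_inv_cancel:
  assumes "\<sigma> \<in> perms r"
  shows "inv \<sigma> \<circ> (\<sigma> \<circ> g) = g" "\<sigma> \<circ> (inv \<sigma> \<circ> g) = g"
    "g \<circ> \<sigma> \<circ> inv \<sigma> = g" "g \<circ> inv \<sigma> \<circ> \<sigma> = g"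
  using perms_inv_o[OF assms] by (simp_all add: comp_assoc flip: comp_assoc[of "inv \<sigma>" \<sigma> g] comp_assoc[of \<sigma> "inv \<sigma>" g])

lemma perms_inv_comp: "\<sigma> \<in> perms r \<Longrightarrow> \<tau> \<in> perms r \<Longrightarrow> inv (\<sigma> \<circ> \<tau>) = inv \<tau> \<circ> inv \<sigma>"
  unfolding perms_def using o_inv_distrib permutes_bij by blast

lemma perms_inv_inv: "\<sigma> \<in> perms r \<Longrightarrow> inv (inv \<sigma>) = \<sigma>"
  by (simp add: perms_def permutes_inv_inv)

lemma sum_perms_left:
  assumes "\<sigma> \<in> perms r"
  shows "(\<Sum>\<tau>\<in>perms r. g (\<sigma> \<circ> \<tau>)) = (\<Sum>\<tau>\<in>perms r. g \<tau>)"
  by (rule sum.reindex_bij_witness[of _ "\<lambda>\<tau>. inv \<sigma> \<circ> \<tau>" "\<lambda>\<tau>. \<sigma> \<circ> \<tau>"])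
    (use assms in \<open>auto simp: perms_inv_cancel[OF assms]\<close>)

lemma sum_perms_right:
  assumes "\<sigma> \<in> perms r"
  shows "(\<Sum>\<tau>\<in>perms r. g (\<tau> \<circ> \<sigma>)) = (\<Sum>\<tau>\<in>perms r. g \<tau>)"
  by (rule sum.reindex_bij_witness[of _ "\<lambda>\<tau>. \<tau> \<circ> inv \<sigma>" "\<lambda>\<tau>. \<tau> \<circ> \<sigma>"])
    (use assms in \<open>auto simp: perms_inv_cancel[OF assms]\<close>)

definition adj :: "nat \<Rightarrow> nat \<Rightarrow> nat" where
  "adj i = transpose i (Suc i)"

lemma adj_perms: "1 \<le> i \<Longrightarrow> i < r \<Longrightarrow> adj i \<in> perms r"
  unfolding perms_def adj_def by (simp add: permutes_swap_id)

text \<open>The product f (k+n-1) ... f (k+1) f k. For \<open>f = adj\<close> it carries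
  \<open>k\<close> to \<open>k + n\<close>, and the chains with \<open>k + n = Suc m\<close>
  represent the right cosets of \<open>perms m\<close> in \<open>perms (Suc m)\<close>.\<close>

primrec chain :: "(nat \<Rightarrow> 'a \<Rightarrow> 'a) \<Rightarrow> nat \<Rightarrow> nat \<Rightarrow> 'a \<Rightarrow> 'a" where
  "chain f k 0 v = v"
| "chain f k (Suc n) v = f (k + n) (chain f k n v)"

lemma chain_front: "chain f k (Suc n) v = chain f (Suc k) n (f k v)"
  by (induction n) auto

text \<open>The transpositions themselves and the orthogonal form are both instances, so each
  rewriting rule for chains is available on both sides when permutations are translated into
  operators.\<close>

locale coxeter =
  fixes r :: nat and f :: "nat \<Rightarrow> 'a \<Rightarrow> 'a"
  assumes sq: "1 \<le> i \<Longrightarrow> i < r \<Longrightarrow> f i (f i v) = v"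
    and comm: "1 \<le> i \<Longrightarrow> Suc i < j \<Longrightarrow> j < r \<Longrightarrow> f i (f j v) = f j (f i v)"
    and braid: "1 \<le> i \<Longrightarrow> Suc i < r \<Longrightarrow> f i (f (Suc i) (f i v)) = f (Suc i) (f i (f (Suc i) v))"
begin

lemma chain_sq:
  assumes "1 \<le> k" "k + n < r"
  shows "chain f k (Suc n) (f k v) = chain f (Suc k) n v"
  using assms by (simp only: chain_front) (simp add: sq)

lemma chain_below:
  assumes "1 \<le> j" "Suc j < k" "k + n \<le> r"
  shows "chain f k n (f j v) = f j (chain f k n v)"
  using assms by (induction n) (simp_all add: comm[of j])

lemma chain_above:
  assumes "1 \<le> k" "k + n < j" "j < r"
  shows "chain f k n (f j v) = f j (chain f k n v)"
  using assms by (induction n) (auto simp: comm)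

text \<open>Conjugation by a cycle lowers the index by one. All factors commute past, except the two
  with indices \<open>Suc j\<close> and \<open>j\<close>, where the braid law acts.\<close>

lemma chain_shift:
  assumes "1 \<le> k" "k \<le> j" "Suc j < k + n" "k + n \<le> r"
  shows "chain f k n (f (Suc j) v) = f j (chain f k n v)"
  using assms
proof (induction n)
  case (Suc n)
  show ?case
  proof (cases "Suc j < k + n")
    case True
    then show ?thesis using Suc by (simp add: comm[of j])
  next
    case False
    define n' where "n' = j - k"
    with False Suc.prems have n': "n = Suc n'" "j = k + n'" by auto
    have "chain f k n' (f (Suc j) v) = f (Suc j) (chain f k n' v)"
      using Suc.prems n' by (intro chain_above) auto
    then show ?thesis using Suc.prems n' by (simp add: braid)
  qed
qed simp

end

interpretation adj: coxeter r adj for r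
  by unfold_locales (auto simp: adj_def transpose_def)

lemma chain_adj_perms: "1 \<le> k \<Longrightarrow> k + n \<le> r \<Longrightarrow> chain adj k n \<in> perms r"
proof (induction n)
  case 0
  have "chain adj k 0 = id" by (auto simp: fun_eq_iff)
  then show ?case using id_perms by metis
next
  case (Suc n)
  have "chain adj k (Suc n) = adj (k + n) \<circ> chain adj k n" by (auto simp: fun_eq_iff)
  moreover have "chain adj k n \<in> perms r" "adj (k + n) \<in> perms r"
    using Suc by (auto intro!: adj_perms)
  ultimately show ?case using comp_perms by metis
qed

lemma chain_adj_apply: "chain adj k n k = k + n"
  by (induction n) (auto simp: adj_def)

lemma perms_mono: "r \<le> s \<Longrightarrow> \<sigma> \<in> perms r \<Longrightarrow> \<sigma> \<in> perms s"
  unfolding perms_def by (auto elim: permutes_subset)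

lemma perms_fix: "\<sigma> \<in> perms r \<Longrightarrow> r < k \<Longrightarrow> \<sigma> k = k"
  unfolding perms_def using permutes_not_in by fastforce

text \<open>The chain starting at the preimage \<open>k\<close> of \<open>Suc m\<close> also sends
  \<open>k\<close> to \<open>Suc m\<close>, so cancelling it leaves a permutation that fixes
  \<open>Suc m\<close>.\<close>

lemma perms_coset:
  assumes "\<sigma> \<in> perms (Suc m)"
  obtains \<tau> k where "\<tau> \<in> perms m" "1 \<le> k" "k \<le> Suc m" "\<sigma> = \<tau> \<circ> chain adj k (Suc m - k)"
proof -
  let ?k = "inv \<sigma> (Suc m)"
  let ?c = "chain adj ?k (Suc m - ?k)"
  have p: "\<sigma> permutes {1..Suc m}" using assms by (simp add: perms_def)
  have k: "?k \<in> {1..Suc m}"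
    using permutes_in_image[OF permutes_inv[OF p], of "Suc m"] by simp
  have c: "?c \<in> perms (Suc m)" using k by (intro chain_adj_perms) auto
  then have pc: "?c permutes {1..Suc m}" by (simp add: perms_def)
  have ck: "?c ?k = Suc m" using k chain_adj_apply[of ?k "Suc m - ?k"] by auto
  have "inv ?c (Suc m) = ?k" using permutes_inverses(2)[OF pc, of ?k] ck by simp
  then have "(\<sigma> \<circ> inv ?c) (Suc m) = Suc m"
    using permutes_inverses(1)[OF p] by simp
  moreover have "\<sigma> \<circ> inv ?c permutes {1..Suc m}"
    using assms c by (metis (no_types, lifting) comp_perms inv_perms mem_Collect_eq perms_def)
  ultimately have "\<sigma> \<circ> inv ?c permutes {1..m}"
    by (elim permutes_superset) (auto simp: le_Suc_eq)
  then have "\<sigma> \<circ> inv ?c \<in> perms m" by (simp add: perms_def)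
  moreover have "\<sigma> = (\<sigma> \<circ> inv ?c) \<circ> ?c" using perms_inv_cancel[OF c] by simp
  ultimately show thesis using that k by auto
qed

lemma perms_zero: "perms 0 = {id}"
  by (auto simp: perms_def)

lemma perms_induct_adj [consumes 1, case_names id adj]:
  assumes "\<sigma> \<in> perms r" and "P id"
    and "\<And>\<sigma> i. \<sigma> \<in> perms r \<Longrightarrow> 1 \<le> i \<Longrightarrow> i < r \<Longrightarrow> P \<sigma> \<Longrightarrow> P (\<sigma> \<circ> adj i)"
  shows "P \<sigma>"
  using assms
proof (induction r arbitrary: \<sigma>)
  case 0
  then show ?case by (simp add: perms_zero)
next
  case (Suc m)
  obtain \<tau> k where \<tau>: "\<tau> \<in> perms m" "1 \<le> k" "k \<le> Suc m" "\<sigma> = \<tau> \<circ> chain adj k (Suc m - k)"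
    using perms_coset[OF Suc.prems(1)] by blast
  note P_adj = Suc.prems(3)
  have "P \<tau>" by (rule Suc.IH[OF \<tau>(1) Suc.prems(2)]) (rule P_adj, auto intro: perms_mono[of m "Suc m"])
  have "P (\<tau> \<circ> chain adj k n)" if "k + n = Suc m" "1 \<le> k" for k n
    using that
  proof (induction n arbitrary: k)
    case 0
    have "\<tau> \<circ> chain adj k 0 = \<tau>" by (auto simp: fun_eq_iff)
    then show ?case using \<open>P \<tau>\<close> by simp
  next
    case (Suc n)
    have "\<tau> \<circ> chain adj k (Suc n) = (\<tau> \<circ> chain adj (Suc k) n) \<circ> adj k"
      by (auto simp: fun_eq_iff chain_front simp del: chain.simps)
    moreover have "\<tau> \<circ> chain adj (Suc k) n \<in> perms (Suc m)"
      using \<tau>(1) Suc.prems by (auto intro!: comp_perms chain_adj_perms intro: perms_mono[of m])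
    moreover have "P (\<tau> \<circ> chain adj (Suc k) n)"
      by (rule Suc.IH) (use Suc.prems in auto)
    moreover have "k < Suc m" "1 \<le> k" using Suc.prems by auto
    ultimately show ?case using P_adj by metis
  qed
  from this[OF le_add_diff_inverse[OF \<tau>(3)] \<tau>(2)] show ?case
    by (subst \<tau>(4))
qed

context coxeter
begin

text \<open>The value on \<tau> times a chain is forced to be \<open>\<Phi> \<tau>\<close> times the
  chain of operators. Right multiplication by \<open>adj i\<close> then either passes through the
  chain, as \<open>adj i\<close> if \<open>Suc i < k\<close> and as \<open>adj (i - 1)\<close> if
  \<open>k < i\<close>, and is absorbed by \<Phi>, or it lengthens the chain
  (\<open>k = Suc i\<close>) or shortens it (\<open>i = k\<close>). The Coxeter laws move
  \<open>f i\<close> in the same way in all four cases.\<close>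

lemma extension_step:
  assumes m: "Suc m \<le> r" and \<Phi>0: "\<Phi> id = id"
    and \<Phi>: "\<And>\<sigma> i. \<sigma> \<in> perms m \<Longrightarrow> 1 \<le> i \<Longrightarrow> i < m \<Longrightarrow> \<Phi> (\<sigma> \<circ> adj i) = \<Phi> \<sigma> \<circ> f i"
  shows "\<exists>\<Psi>. \<Psi> id = id \<and>
    (\<forall>\<sigma>\<in>perms (Suc m). \<forall>i. 1 \<le> i \<and> i < Suc m \<longrightarrow> \<Psi> (\<sigma> \<circ> adj i) = \<Psi> \<sigma> \<circ> f i)"
proof -
  define \<Psi> where "\<Psi> \<sigma> = (let k = inv \<sigma> (Suc m) in
      \<Phi> (\<sigma> \<circ> inv (chain adj k (Suc m - k))) \<circ> chain f k (Suc m - k))" for \<sigma>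
  have \<Psi>: "\<Psi> (\<tau> \<circ> chain adj k n) = \<Phi> \<tau> \<circ> chain f k n"
    if \<tau>: "\<tau> \<in> perms m" and k: "1 \<le> k" "k + n = Suc m" for \<tau> k n
  proof -
    have c: "chain adj k n \<in> perms (Suc m)" using k by (simp add: chain_adj_perms)
    have "\<tau> \<circ> chain adj k n \<in> perms (Suc m)"
      using c \<tau> by (intro comp_perms) (auto intro: perms_mono[of m])
    then have p: "\<tau> \<circ> chain adj k n permutes {1..Suc m}" by (simp add: perms_def)
    have "(\<tau> \<circ> chain adj k n) k = Suc m"
      using chain_adj_apply[of k n] k perms_fix[OF \<tau>, of "Suc m"] by simp
    then have "inv (\<tau> \<circ> chain adj k n) (Suc m) = k"
      using permutes_inverses(2)[OF p, of k] by simp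
    moreover have "Suc m - k = n" using k by simp
    ultimately show ?thesis
      unfolding \<Psi>_def Let_def using perms_inv_cancel[OF c] by simp
  qed
  have "\<Psi> id = id"
    using \<Psi>[OF id_perms, of "Suc m" 0] \<Phi>0 by (simp add: comp_def id_def)
  moreover have "\<Psi> (\<sigma> \<circ> adj i) = \<Psi> \<sigma> \<circ> f i"
    if \<sigma>: "\<sigma> \<in> perms (Suc m)" and i: "1 \<le> i" "i < Suc m" for \<sigma> i
  proof -
    obtain \<tau> k n where \<tau>: "\<tau> \<in> perms m" and k: "1 \<le> k" "k + n = Suc m"
      and \<sigma>_eq: "\<sigma> = \<tau> \<circ> chain adj k n"
      using perms_coset[OF \<sigma>] by (metis le_add_diff_inverse)
    consider (low) "Suc i < k" | (below) "k = Suc i" | (eq) "i = k" | (shift) "k < i" by linarith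
    then show ?thesis
    proof cases
      case low
      have "chain adj k n \<circ> adj i = adj i \<circ> chain adj k n"
        using adj.chain_below[of i k n "Suc m"] low i k by (auto simp: fun_eq_iff)
      then have "\<sigma> \<circ> adj i = (\<tau> \<circ> adj i) \<circ> chain adj k n"
        by (simp add: \<sigma>_eq comp_assoc)
      moreover have "\<tau> \<circ> adj i \<in> perms m"
        using \<tau> low i k by (intro comp_perms adj_perms) auto
      ultimately have "\<Psi> (\<sigma> \<circ> adj i) = \<Phi> \<tau> \<circ> f i \<circ> chain f k n"
        using \<Psi>[of "\<tau> \<circ> adj i" k n] \<Phi>[of \<tau> i] \<tau> low i k by auto
      also have "\<dots> = \<Psi> \<sigma> \<circ> f i"
        unfolding \<sigma>_eq \<Psi>[OF \<tau> k] using low i k m by (auto simp: fun_eq_iff chain_below)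
      finally show ?thesis .
    next
      case below
      have "\<sigma> \<circ> adj i = \<tau> \<circ> chain adj i (Suc n)"
        unfolding \<sigma>_eq below by (auto simp: fun_eq_iff chain_front simp del: chain.simps)
      then have "\<Psi> (\<sigma> \<circ> adj i) = \<Phi> \<tau> \<circ> chain f i (Suc n)"
        using \<Psi>[of \<tau> i "Suc n"] \<tau> below i k by auto
      also have "\<dots> = \<Psi> \<sigma> \<circ> f i"
        unfolding \<sigma>_eq \<Psi>[OF \<tau> k] using below
        by (auto simp: fun_eq_iff chain_front simp del: chain.simps)
      finally show ?thesis .
    next
      case eq
      with i k obtain n' where n: "n = Suc n'" by (cases n) auto
      have "\<sigma> \<circ> adj i = \<tau> \<circ> chain adj (Suc k) n'"
        unfolding \<sigma>_eq eq n using adj.chain_sq[of k n' r] k n m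
        by (auto simp: fun_eq_iff simp del: chain.simps)
      then have "\<Psi> (\<sigma> \<circ> adj i) = \<Phi> \<tau> \<circ> chain f (Suc k) n'"
        using \<Psi>[of \<tau> "Suc k" n'] \<tau> k n by auto
      also have "\<dots> = \<Psi> \<sigma> \<circ> f i"
        unfolding \<sigma>_eq \<Psi>[OF \<tau> k] using eq n k m
        by (auto simp: fun_eq_iff chain_sq simp del: chain.simps)
      finally show ?thesis .
    next
      case shift
      with i obtain j where j: "i = Suc j" "k \<le> j" by (cases i) auto
      have "chain adj k n \<circ> adj i = adj j \<circ> chain adj k n"
        using adj.chain_shift[of k j n "Suc m"] j i k by (auto simp: fun_eq_iff)
      then have "\<sigma> \<circ> adj i = (\<tau> \<circ> adj j) \<circ> chain adj k n"
        by (simp add: \<sigma>_eq comp_assoc)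
      moreover have "\<tau> \<circ> adj j \<in> perms m"
        using \<tau> j i k by (intro comp_perms adj_perms) auto
      ultimately have "\<Psi> (\<sigma> \<circ> adj i) = \<Phi> \<tau> \<circ> f j \<circ> chain f k n"
        using \<Psi>[of "\<tau> \<circ> adj j" k n] \<Phi>[of \<tau> j] \<tau> j i k by auto
      also have "\<dots> = \<Psi> \<sigma> \<circ> f i"
        unfolding \<sigma>_eq \<Psi>[OF \<tau> k] using j i k m by (auto simp: fun_eq_iff chain_shift)
      finally show ?thesis .
    qed
  qed
  ultimately show ?thesis by blast
qed

lemma extension_upto:
  assumes "m \<le> r"
  shows "\<exists>\<Phi>. \<Phi> id = id \<and>
    (\<forall>\<sigma>\<in>perms m. \<forall>i. 1 \<le> i \<and> i < m \<longrightarrow> \<Phi> (\<sigma> \<circ> adj i) = \<Phi> \<sigma> \<circ> f i)"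
  using assms
proof (induction m)
  case 0
  show ?case by (rule exI[of _ "\<lambda>_. id"]) auto
next
  case (Suc m)
  then obtain \<Phi> where "\<Phi> id = id"
    "\<forall>\<sigma>\<in>perms m. \<forall>i. 1 \<le> i \<and> i < m \<longrightarrow> \<Phi> (\<sigma> \<circ> adj i) = \<Phi> \<sigma> \<circ> f i"
    using Suc_leD by blast
  then show ?case using extension_step[OF Suc.prems, of \<Phi>] by blast
qed

definition ext :: "(nat \<Rightarrow> nat) \<Rightarrow> 'a \<Rightarrow> 'a" where
  "ext = (SOME \<Phi>. \<Phi> id = id \<and>
    (\<forall>\<sigma>\<in>perms r. \<forall>i. 1 \<le> i \<and> i < r \<longrightarrow> \<Phi> (\<sigma> \<circ> adj i) = \<Phi> \<sigma> \<circ> f i))"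

lemma ext_id: "ext id v = v"
  and ext_comp_adj: "\<sigma> \<in> perms r \<Longrightarrow> 1 \<le> i \<Longrightarrow> i < r \<Longrightarrow> ext (\<sigma> \<circ> adj i) v = ext \<sigma> (f i v)"
proof -
  have "ext id = id \<and>
    (\<forall>\<sigma>\<in>perms r. \<forall>i. 1 \<le> i \<and> i < r \<longrightarrow> ext (\<sigma> \<circ> adj i) = ext \<sigma> \<circ> f i)"
    unfolding ext_def by (rule someI_ex[OF extension_upto[OF order_refl]])
  then show "ext id v = v" "\<sigma> \<in> perms r \<Longrightarrow> 1 \<le> i \<Longrightarrow> i < r \<Longrightarrow> ext (\<sigma> \<circ> adj i) v = ext \<sigma> (f i v)"
    by (metis id_apply, metis comp_apply)
qed

lemma ext_comp:
  assumes "\<tau> \<in> perms r" "\<sigma> \<in> perms r"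
  shows "ext (\<sigma> \<circ> \<tau>) v = ext \<sigma> (ext \<tau> v)"
  using assms
proof (induction \<tau> arbitrary: v rule: perms_induct_adj)
  case id
  show ?case unfolding ext_id comp_id ..
next
  case (adj \<tau> i)
  have "ext (\<sigma> \<circ> (\<tau> \<circ> adj i)) v = ext (\<sigma> \<circ> \<tau> \<circ> adj i) v" by (simp only: comp_assoc)
  also have "\<dots> = ext (\<sigma> \<circ> \<tau>) (f i v)"
    using adj by (intro ext_comp_adj comp_perms)
  also have "\<dots> = ext \<sigma> (ext \<tau> (f i v))" using adj by blast
  also have "ext \<tau> (f i v) = ext (\<tau> \<circ> adj i) v" using adj by (intro ext_comp_adj[symmetric])
  finally show ?case .
qed

lemma ext_adj: "1 \<le> i \<Longrightarrow> i < r \<Longrightarrow> ext (adj i) v = f i v"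
  using ext_comp_adj[OF id_perms, of i v] unfolding id_comp ext_id .

end

subsection \<open>The group algebra and traces on images of projections\<close>

lemmas perms_group_simps =
  perms_inv_comp perms_inv_inv perms_inv_o perms_inv_cancel(1,2)

definition gext :: "nat \<Rightarrow> ((nat \<Rightarrow> nat) \<Rightarrow> ('a \<Rightarrow> complex) \<Rightarrow> 'a \<Rightarrow> complex) \<Rightarrow> galg \<Rightarrow>
    ('a \<Rightarrow> complex) \<Rightarrow> 'a \<Rightarrow> complex" where
  "gext r act x v = (\<lambda>z. \<Sum>\<sigma>\<in>perms r. x \<sigma> * act \<sigma> v z)"

lemma gact_eq_gext: "gact m n r = gext r (pact m n r)"
  by (simp add: fun_eq_iff gact_def gext_def)

locale perm_rep =
  fixes r :: nat and act :: "(nat \<Rightarrow> nat) \<Rightarrow> ('a \<Rightarrow> complex) \<Rightarrow> 'a \<Rightarrow> complex"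
  assumes act_add: "\<sigma> \<in> perms r \<Longrightarrow> act \<sigma> (\<lambda>z. v z + w z) = (\<lambda>z. act \<sigma> v z + act \<sigma> w z)"
    and act_scale: "\<sigma> \<in> perms r \<Longrightarrow> act \<sigma> (\<lambda>z. c * v z) = (\<lambda>z. c * act \<sigma> v z)"
    and act_comp: "\<sigma> \<in> perms r \<Longrightarrow> \<tau> \<in> perms r \<Longrightarrow> act (\<sigma> \<circ> \<tau>) v = act \<sigma> (act \<tau> v)"
begin

lemma act_zero: "\<sigma> \<in> perms r \<Longrightarrow> act \<sigma> (\<lambda>_. 0) = (\<lambda>_. 0)"
  using act_scale[of \<sigma> 0 "\<lambda>_. 0"] by simp

lemma act_sum:
  assumes "\<sigma> \<in> perms r"
  shows "act \<sigma> (\<lambda>z. \<Sum>i\<in>A. c i * v i z) = (\<lambda>z. \<Sum>i\<in>A. c i * act \<sigma> (v i) z)"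
proof (induction A rule: infinite_finite_induct)
  case (insert i A)
  then show ?case by (simp add: act_add[OF assms] act_scale[OF assms])
qed (simp_all add: act_zero[OF assms])

lemma gext_sum:
  "gext r act x (\<lambda>z. \<Sum>i\<in>A. c i * v i z) = (\<lambda>z. \<Sum>i\<in>A. c i * gext r act x (v i) z)"
  unfolding gext_def
  by (simp add: act_sum sum_distrib_left mult.left_commute sum.swap[of _ A])

lemma gext_scale: "gext r act x (\<lambda>z. c * v z) = (\<lambda>z. c * gext r act x v z)"
  unfolding gext_def by (simp add: act_scale sum_distrib_left mult.left_commute)

lemma gext_gmul: "gext r act (gmul r x y) v = gext r act x (gext r act y v)"
proof
  fix z
  have "gext r act (gmul r x y) v z = (\<Sum>\<pi>\<in>perms r. \<Sum>\<sigma>\<in>perms r. x \<sigma> * y (inv \<sigma> \<circ> \<pi>) * act \<pi> v z)"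
    unfolding gext_def gmul_def by (simp add: sum_distrib_right)
  also have "\<dots> = (\<Sum>\<sigma>\<in>perms r. \<Sum>\<pi>\<in>perms r. x \<sigma> * y (inv \<sigma> \<circ> \<pi>) * act \<pi> v z)"
    by (rule sum.swap)
  also have "\<dots> = (\<Sum>\<sigma>\<in>perms r. \<Sum>\<tau>\<in>perms r. x \<sigma> * (y \<tau> * act \<sigma> (act \<tau> v) z))"
  proof (rule sum.cong[OF refl])
    fix \<sigma> assume \<sigma>: "\<sigma> \<in> perms r"
    show "(\<Sum>\<pi>\<in>perms r. x \<sigma> * y (inv \<sigma> \<circ> \<pi>) * act \<pi> v z) =
        (\<Sum>\<tau>\<in>perms r. x \<sigma> * (y \<tau> * act \<sigma> (act \<tau> v) z))"
      using \<sigma> by (subst sum_perms_left[OF \<sigma>, symmetric])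
        (simp add: perms_inv_cancel[OF \<sigma>] act_comp mult.assoc)
  qed
  also have "\<dots> = gext r act x (gext r act y v) z"
    unfolding gext_def by (simp add: act_sum sum_distrib_left)
  finally show "gext r act (gmul r x y) v z = gext r act x (gext r act y v) z" .
qed

lemma gext_gbasis: "\<sigma> \<in> perms r \<Longrightarrow> gext r act (gbasis \<sigma>) v = act \<sigma> v"
  by (auto simp: gext_def gbasis_def if_distrib[of "\<lambda>c. c * _"] cong: if_cong)

end

lemma gext_sum_galg: "gext r act (\<lambda>\<pi>. \<Sum>i\<in>A. c i * x i \<pi>) v = (\<lambda>z. \<Sum>i\<in>A. c i * gext r act (x i) v z)"
  unfolding gext_def by (simp add: sum_distrib_left sum_distrib_right mult.assoc sum.swap[of _ A])

lemma gext_gscale: "gext r act (gscale c x) v = (\<lambda>z. c * gext r act x v z)"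
  unfolding gext_def gscale_def by (simp add: sum_distrib_left mult.assoc)

lemma gext_add_galg: "gext r act (\<lambda>\<pi>. x \<pi> + y \<pi>) v = (\<lambda>z. gext r act x v z + gext r act y v z)"
  unfolding gext_def by (simp add: distrib_right sum.distrib)

text \<open>The left regular representation; associativity of \<open>gmul\<close> becomes an
  instance of \<open>gext_gmul\<close>.\<close>

definition reg :: "nat \<Rightarrow> (nat \<Rightarrow> nat) \<Rightarrow> galg \<Rightarrow> galg" where
  "reg r \<sigma> x = (\<lambda>\<pi>. if \<pi> \<in> perms r then x (inv \<sigma> \<circ> \<pi>) else 0)"

lemma gmul_eq_gext: "gmul r = gext r (reg r)"
  by (auto simp: fun_eq_iff gmul_def gext_def reg_def)

interpretation reg: perm_rep r "reg r" for r
proof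
  fix \<sigma> \<tau> :: "nat \<Rightarrow> nat" and v :: galg
  assume "\<sigma> \<in> perms r" "\<tau> \<in> perms r"
  then show "reg r (\<sigma> \<circ> \<tau>) v = reg r \<sigma> (reg r \<tau> v)"
    by (auto simp: reg_def fun_eq_iff perms_inv_comp comp_assoc)
qed (auto simp: reg_def fun_eq_iff)

lemma gmul_assoc: "gmul r (gmul r x y) z = gmul r x (gmul r y z)"
  using reg.gext_gmul[of r x y z] by (simp add: gmul_eq_gext)

lemma gmul_galg [simp]: "gmul r x y \<in> galg r"
  by (simp add: galg_def gmul_def)

lemma gscale_galg [simp]: "x \<in> galg r \<Longrightarrow> gscale c x \<in> galg r"
  by (simp add: galg_def gscale_def)

lemma gbasis_galg [simp]: "\<sigma> \<in> perms r \<Longrightarrow> gbasis \<sigma> \<in> galg r"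
  by (auto simp: galg_def gbasis_def)

lemma galg_sum: "(\<And>i. i \<in> A \<Longrightarrow> x i \<in> galg r) \<Longrightarrow> (\<lambda>\<pi>. \<Sum>i\<in>A. c i * x i \<pi>) \<in> galg r"
  by (simp add: galg_def)

lemma galg_expand:
  assumes "x \<in> galg r"
  shows "x = (\<lambda>\<pi>. \<Sum>\<sigma>\<in>perms r. x \<sigma> * gbasis \<sigma> \<pi>)"
proof
  fix \<pi>
  have "(\<Sum>\<sigma>\<in>perms r. x \<sigma> * gbasis \<sigma> \<pi>) = (\<Sum>\<sigma>\<in>perms r. if \<sigma> = \<pi> then x \<sigma> else 0)"
    by (intro sum.cong) (auto simp: gbasis_def)
  then show "x \<pi> = (\<Sum>\<sigma>\<in>perms r. x \<sigma> * gbasis \<sigma> \<pi>)"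
    using assms by (auto simp: galg_def)
qed

lemma gmul_sum_left: "gmul r (\<lambda>\<pi>. \<Sum>i\<in>A. c i * x i \<pi>) y = (\<lambda>\<pi>. \<Sum>i\<in>A. c i * gmul r (x i) y \<pi>)"
  by (simp add: gmul_eq_gext gext_sum_galg)

text \<open>The linear anti-automorphism of the group algebra that extends inversion.\<close>

definition gstar :: "nat \<Rightarrow> galg \<Rightarrow> galg" where
  "gstar r x = (\<lambda>\<pi>. if \<pi> \<in> perms r then x (inv \<pi>) else 0)"

lemma gstar_gmul: "gstar r (gmul r x y) = gmul r (gstar r y) (gstar r x)"
proof
  fix \<pi>
  show "gstar r (gmul r x y) \<pi> = gmul r (gstar r y) (gstar r x) \<pi>"
  proof (cases "\<pi> \<in> perms r")
    case True
    have "gstar r (gmul r x y) \<pi> = (\<Sum>\<sigma>\<in>perms r. x \<sigma> * y (inv \<sigma> \<circ> inv \<pi>))"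
      using True by (simp add: gstar_def gmul_def)
    also have "\<dots> = (\<Sum>\<sigma>\<in>perms r. x (inv \<pi> \<circ> \<sigma>) * y (inv (inv \<pi> \<circ> \<sigma>) \<circ> inv \<pi>))"
      using sum_perms_left[of "inv \<pi>" r "\<lambda>\<sigma>. x \<sigma> * y (inv \<sigma> \<circ> inv \<pi>)"] True by simp
    also have "\<dots> = (\<Sum>\<sigma>\<in>perms r. gstar r y \<sigma> * gstar r x (inv \<sigma> \<circ> \<pi>))"
    proof (rule sum.cong[OF refl])
      fix \<sigma> assume \<sigma>: "\<sigma> \<in> perms r"
      have "inv (inv \<pi> \<circ> \<sigma>) \<circ> inv \<pi> = inv \<sigma>"
        using True \<sigma> by (simp add: perms_group_simps[where r = r] comp_assoc)
      moreover have "inv (inv \<sigma> \<circ> \<pi>) = inv \<pi> \<circ> \<sigma>"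
        using True \<sigma> by (simp add: perms_group_simps[where r = r] comp_assoc)
      ultimately show "x (inv \<pi> \<circ> \<sigma>) * y (inv (inv \<pi> \<circ> \<sigma>) \<circ> inv \<pi>) =
          gstar r y \<sigma> * gstar r x (inv \<sigma> \<circ> \<pi>)"
        using True \<sigma> by (simp add: gstar_def)
    qed
    finally show ?thesis using True by (simp add: gmul_def)
  qed (simp add: gstar_def gmul_def)
qed

lemma gstar_galg [simp]: "gstar r x \<in> galg r"
  by (simp add: galg_def gstar_def)

lemma gstar_gscale: "gstar r (gscale c x) = gscale c (gstar r x)"
  by (auto simp: gstar_def gscale_def)

lemma gstar_gstar: "x \<in> galg r \<Longrightarrow> gstar r (gstar r x) = x"
  by (auto simp: gstar_def galg_def perms_inv_inv)

text \<open>The coefficients of the sum of all conjugates of \<open>x\<close>, which is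
  \<open>r!\<close> times the projection of \<open>x\<close> to the centre.\<close>

definition gconj :: "nat \<Rightarrow> galg \<Rightarrow> galg" where
  "gconj r x = (\<lambda>\<pi>. if \<pi> \<in> perms r then \<Sum>h\<in>perms r. x (inv h \<circ> \<pi> \<circ> h) else 0)"

text \<open>For fixed \<sigma> the sum over \<open>h\<close> may be shifted by the inverse of
  \<sigma>, which moves that factor from the left of the argument of \<open>y\<close> to its right.
  This trace property later identifies idempotents of the forms x y and y x.\<close>

lemma gconj_gmul_commute: "gconj r (gmul r x y) = gconj r (gmul r y x)"
proof
  fix \<pi>
  show "gconj r (gmul r x y) \<pi> = gconj r (gmul r y x) \<pi>"
  proof (cases "\<pi> \<in> perms r")
    case True
    note [simp] = True
    have "gconj r (gmul r x y) \<pi> =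
        (\<Sum>h\<in>perms r. \<Sum>\<sigma>\<in>perms r. x \<sigma> * y (inv \<sigma> \<circ> (inv h \<circ> \<pi> \<circ> h)))"
      by (simp add: gconj_def gmul_def)
    also have "\<dots> = (\<Sum>\<sigma>\<in>perms r. \<Sum>h\<in>perms r. x \<sigma> * y (inv \<sigma> \<circ> (inv h \<circ> \<pi> \<circ> h)))"
      by (rule sum.swap)
    also have "\<dots> = (\<Sum>\<sigma>\<in>perms r. \<Sum>h\<in>perms r. x \<sigma> * y (inv h \<circ> \<pi> \<circ> h \<circ> inv \<sigma>))"
    proof (rule sum.cong[OF refl])
      fix \<sigma> assume \<sigma>: "\<sigma> \<in> perms r"
      show "(\<Sum>h\<in>perms r. x \<sigma> * y (inv \<sigma> \<circ> (inv h \<circ> \<pi> \<circ> h))) =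
          (\<Sum>h\<in>perms r. x \<sigma> * y (inv h \<circ> \<pi> \<circ> h \<circ> inv \<sigma>))"
        using \<sigma> by (subst sum_perms_right[of "inv \<sigma>", symmetric])
          (simp_all add: perms_inv_comp[where r = r] perms_inv_inv[where r = r] comp_assoc
            perms_inv_cancel(1)[OF \<sigma>])
    qed
    also have "\<dots> = (\<Sum>h\<in>perms r. \<Sum>\<sigma>\<in>perms r. x \<sigma> * y (inv h \<circ> \<pi> \<circ> h \<circ> inv \<sigma>))"
      by (rule sum.swap)
    also have "\<dots> = (\<Sum>h\<in>perms r. \<Sum>\<tau>\<in>perms r. y \<tau> * x (inv \<tau> \<circ> (inv h \<circ> \<pi> \<circ> h)))"
    proof (rule sum.cong[OF refl])
      fix h assume h: "h \<in> perms r"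
      let ?g = "inv h \<circ> \<pi> \<circ> h"
      have "?g \<in> perms r" using h by simp
      have "(\<Sum>\<sigma>\<in>perms r. x \<sigma> * y (g \<circ> inv \<sigma>)) = (\<Sum>\<tau>\<in>perms r. y \<tau> * x (inv \<tau> \<circ> g))"
        if "g \<in> perms r" for g
        by (rule sum.reindex_bij_witness[of _ "\<lambda>\<tau>. inv \<tau> \<circ> g" "\<lambda>\<sigma>. g \<circ> inv \<sigma>"])
          (use that in \<open>simp_all add: perms_group_simps[where r = r] comp_assoc\<close>)
      then show "(\<Sum>\<sigma>\<in>perms r. x \<sigma> * y (?g \<circ> inv \<sigma>)) = (\<Sum>\<tau>\<in>perms r. y \<tau> * x (inv \<tau> \<circ> ?g))"
        using \<open>?g \<in> perms r\<close> by blast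
    qed
    also have "\<dots> = gconj r (gmul r y x) \<pi>"
      by (simp add: gconj_def gmul_def)
    finally show ?thesis .
  qed (simp add: gconj_def)
qed



section \<open>Bases, coordinates and traces in spaces of functions\<close>

lemma is_basis_nth: "is_basis U bs \<Longrightarrow> k < length bs \<Longrightarrow> bs ! k \<in> U"
  unfolding is_basis_def by (meson nth_mem subsetD)

lemma lcomb_unique:
  assumes "is_basis U bs" "lcomb bs c = lcomb bs d" "k < length bs"
  shows "c k = d k"
proof -
  have "lcomb bs (\<lambda>k. c k - d k) = (\<lambda>_. 0)"
    using assms(2) by (auto simp: lcomb_def fun_eq_iff left_diff_distrib sum_subtractf)
  then show ?thesis using assms(1,3) unfolding is_basis_def by fastforce
qed

lemma coords_lcomb:
  assumes "is_basis U bs" "k < length bs"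
  shows "coords bs (lcomb bs c) k = c k"
proof -
  \<comment> \<open>\<open>coords\<close> is a THE over sequences that vanish beyond the length of
    the list, so \<open>c\<close> is cut off there.\<close>
  define c' where "c' k = (if k < length bs then c k else 0)" for k
  have eq: "lcomb bs c = lcomb bs c'" by (simp add: lcomb_def c'_def)
  have "coords bs (lcomb bs c) = c'"
    unfolding coords_def eq
  proof (rule the_equality)
    show "lcomb bs c' = lcomb bs c' \<and> (\<forall>k\<ge>length bs. c' k = 0)" by (simp add: c'_def)
    fix d assume d: "lcomb bs c' = lcomb bs d \<and> (\<forall>k\<ge>length bs. d k = 0)"
    show "d = c'"
    proof
      fix k
      show "d k = c' k"
        using d lcomb_unique[OF assms(1), of c' d k] by (cases "k < length bs") (auto simp: c'_def)
    qed
  qed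
  then show ?thesis using assms(2) by (simp add: c'_def)
qed

text \<open>\<open>trace_on\<close> picks its basis by SOME, so a basis must exist. The spanning
  list is read from left to right, and a vector depending on those kept so far is dropped.\<close>

lemma ex_basis_of_span:
  assumes "\<And>c. lcomb bs c \<in> U" "\<And>u. u \<in> U \<Longrightarrow> \<exists>c. u = lcomb bs c"
  shows "\<exists>bs. is_basis U bs"
proof -
  have lcomb_snoc: "lcomb (bs @ [b]) c = (\<lambda>z. lcomb bs c z + c (length bs) * b z)"
    for bs :: "('a \<Rightarrow> complex) list" and b c
    by (auto simp: lcomb_def nth_append)
  \<comment> \<open>Equality of spans is expressed by \<open>lcomb\<close> alone: the assumptions
    relate \<open>U\<close> to the whole list only, not to its initial segments.\<close>
  have "\<exists>bs'. (\<forall>c. \<exists>d. lcomb bs' c = lcomb bs d) \<and> (\<forall>c. \<exists>d. lcomb bs c = lcomb bs' d) \<and>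
      (\<forall>c. lcomb bs' c = (\<lambda>_. 0) \<longrightarrow> (\<forall>k<length bs'. c k = 0))"
  proof (induction bs rule: rev_induct)
    case Nil
    show ?case by (rule exI[of _ "[]"]) auto
  next
    case (snoc b bs)
    then obtain bs' where IH: "\<And>c. \<exists>d. lcomb bs' c = lcomb bs d"
      "\<And>c. \<exists>d. lcomb bs c = lcomb bs' d"
      "\<And>c k. lcomb bs' c = (\<lambda>_. 0) \<Longrightarrow> k < length bs' \<Longrightarrow> c k = 0" by blast
    have le: "\<exists>d. lcomb bs' c = lcomb (bs @ [b]) d" for c
    proof -
      obtain d where "lcomb bs' c = lcomb bs d" using IH(1) by blast
      then have "lcomb bs' c = lcomb (bs @ [b]) (d(length bs := 0))"
        unfolding lcomb_snoc by (auto simp: lcomb_def)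
      then show ?thesis by blast
    qed
    show ?case
    proof (cases "\<exists>d. b = lcomb bs' d")
      case True
      then obtain d where d: "b = lcomb bs' d" by blast
      have "\<exists>e. lcomb (bs @ [b]) c = lcomb bs' e" for c
      proof -
        obtain e where "lcomb bs c = lcomb bs' e" using IH(2) by blast
        then have "lcomb (bs @ [b]) c = lcomb bs' (\<lambda>k. e k + c (length bs) * d k)"
          unfolding lcomb_snoc d
          by (auto simp: lcomb_def sum.distrib sum_distrib_left algebra_simps)
        then show ?thesis by blast
      qed
      then show ?thesis using le IH(3) by blast
    next
      case False
      let ?bs = "bs' @ [b]"
      have "\<exists>d. lcomb ?bs c = lcomb (bs @ [b]) d" for c
      proof -
        obtain d where "lcomb bs' c = lcomb bs d" using IH(1) by blast
        then have "lcomb ?bs c = lcomb (bs @ [b]) (d(length bs := c (length bs')))"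
          unfolding lcomb_snoc by (auto simp: lcomb_def)
        then show ?thesis by blast
      qed
      moreover have "\<exists>d. lcomb (bs @ [b]) c = lcomb ?bs d" for c
      proof -
        obtain d where "lcomb bs c = lcomb bs' d" using IH(2) by blast
        then have "lcomb (bs @ [b]) c = lcomb ?bs (d(length bs' := c (length bs)))"
          unfolding lcomb_snoc by (auto simp: lcomb_def)
        then show ?thesis by blast
      qed
      moreover have "c k = 0" if c: "lcomb ?bs c = (\<lambda>_. 0)" and k: "k < length ?bs" for c k
      proof -
        let ?l = "c (length bs')"
        have "?l = 0"
        proof (rule ccontr)
          assume l: "?l \<noteq> 0"
          have "b z = lcomb bs' (\<lambda>k. - c k / ?l) z" for z
          proof -
            have "lcomb bs' c z + ?l * b z = 0"
              using fun_cong[OF c, of z] unfolding lcomb_snoc .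
            then have "b z = - lcomb bs' c z / ?l"
              using l by (simp add: field_simps eq_neg_iff_add_eq_0 add.commute)
            also have "\<dots> = lcomb bs' (\<lambda>k. - c k / ?l) z"
              by (simp add: lcomb_def sum_divide_distrib sum_negf)
            finally show ?thesis .
          qed
          then show False using False by blast
        qed
        moreover from this have "lcomb bs' c = (\<lambda>_. 0)" using c unfolding lcomb_snoc by simp
        ultimately show ?thesis using IH(3) k by (auto simp: less_Suc_eq)
      qed
      ultimately show ?thesis by blast
    qed
  qed
  then obtain bs' where bs': "\<And>c. \<exists>d. lcomb bs' c = lcomb bs d"
      "\<And>c. \<exists>d. lcomb bs c = lcomb bs' d"
      "\<And>c k. lcomb bs' c = (\<lambda>_. 0) \<Longrightarrow> k < length bs' \<Longrightarrow> c k = 0" by blast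
  have "set bs' \<subseteq> U"
  proof
    fix b assume "b \<in> set bs'"
    then obtain k where k: "k < length bs'" "b = bs' ! k" by (auto simp: in_set_conv_nth)
    have "b = lcomb bs' (\<lambda>l. if l = k then 1 else 0)"
      using k by (auto simp: lcomb_def if_distrib[of "\<lambda>c. c * _"] cong: if_cong)
    then show "b \<in> U" using bs'(1) assms(1) by metis
  qed
  then have "is_basis U bs'"
    unfolding is_basis_def using bs' assms(2) by metis
  then show ?thesis by blast
qed

text \<open>\<open>P\<close> is the matrix of a projection of \<open>\<complex>\<^sup>Z\<close> onto \<open>U\<close>: the trace of \<open>D\<close> on \<open>U\<close> is
  then the trace of \<open>D P\<close>, whatever the basis.\<close>

locale projection =
  fixes Z :: "'a set" and U :: "('a \<Rightarrow> complex) set" and P :: "'a \<Rightarrow> 'a \<Rightarrow> complex"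
  assumes fin: "finite Z"
    and col: "\<And>z. z \<in> Z \<Longrightarrow> (\<lambda>y. P y z) \<in> U"
    and fixes_U: "\<And>u y. u \<in> U \<Longrightarrow> u y = (\<Sum>z\<in>Z. P y z * u z)"
begin

definition pcoord :: "('a \<Rightarrow> complex) list \<Rightarrow> 'a \<Rightarrow> nat \<Rightarrow> complex" where
  "pcoord bs z = (SOME c. (\<lambda>y. P y z) = lcomb bs c)"

lemma pcoord:
  assumes "is_basis U bs" "z \<in> Z"
  shows "P y z = (\<Sum>k<length bs. pcoord bs z k * (bs ! k) y)"
proof -
  have "\<exists>c. (\<lambda>y. P y z) = lcomb bs c" using assms col unfolding is_basis_def by blast
  from someI_ex[OF this] show ?thesis
    unfolding pcoord_def[symmetric] by (simp add: lcomb_def fun_eq_iff)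
qed

text \<open>If \<open>f (bs ! k)\<close> lies in \<open>U\<close>, it is fixed by \<open>P\<close>;
  expanding the columns of \<open>P\<close> in the basis then gives these coordinates as an explicit
  sum, in place of the THE of \<open>coords\<close>.\<close>

definition mat_coeff :: "('a \<Rightarrow> complex) list \<Rightarrow> (('a \<Rightarrow> complex) \<Rightarrow> ('a \<Rightarrow> complex)) \<Rightarrow> nat \<Rightarrow> nat \<Rightarrow> complex" where
  "mat_coeff bs f l k = (\<Sum>z\<in>Z. pcoord bs z l * f (bs ! k) z)"

lemma mat_coeff:
  assumes bs: "is_basis U bs" and "k < length bs" and "f (bs ! k) \<in> U"
  shows "f (bs ! k) = lcomb bs (\<lambda>l. mat_coeff bs f l k)"
proof
  fix y
  have "f (bs ! k) y = (\<Sum>z\<in>Z. P y z * f (bs ! k) z)" using assms by (intro fixes_U)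
  also have "\<dots> = (\<Sum>z\<in>Z. \<Sum>l<length bs. pcoord bs z l * (bs ! l) y * f (bs ! k) z)"
    using pcoord[OF bs] by (simp add: sum_distrib_right)
  also have "\<dots> = (\<Sum>l<length bs. \<Sum>z\<in>Z. pcoord bs z l * (bs ! l) y * f (bs ! k) z)"
    by (rule sum.swap)
  also have "\<dots> = lcomb bs (\<lambda>l. mat_coeff bs f l k) y"
    unfolding lcomb_def mat_coeff_def sum_distrib_right by (simp add: mult_ac)
  finally show "f (bs ! k) y = lcomb bs (\<lambda>l. mat_coeff bs f l k) y" .
qed

lemma trace_mat_coeff:
  assumes bs: "is_basis U bs"
    and f: "\<And>v z. f v z = (\<Sum>y\<in>Z. D z y * v y)"
  shows "(\<Sum>k<length bs. mat_coeff bs f k k) = (\<Sum>z\<in>Z. \<Sum>y\<in>Z. D z y * P y z)"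
proof -
  have "(\<Sum>z\<in>Z. \<Sum>y\<in>Z. D z y * P y z) =
      (\<Sum>z\<in>Z. \<Sum>y\<in>Z. \<Sum>k<length bs. D z y * (pcoord bs z k * (bs ! k) y))"
    using pcoord[OF bs] by (simp add: sum_distrib_left)
  also have "\<dots> = (\<Sum>z\<in>Z. \<Sum>k<length bs. \<Sum>y\<in>Z. D z y * (pcoord bs z k * (bs ! k) y))"
    by (intro sum.cong refl sum.swap)
  also have "\<dots> = (\<Sum>k<length bs. \<Sum>z\<in>Z. \<Sum>y\<in>Z. D z y * (pcoord bs z k * (bs ! k) y))"
    by (rule sum.swap)
  also have "\<dots> = (\<Sum>k<length bs. mat_coeff bs f k k)"
    unfolding mat_coeff_def f sum_distrib_left
    by (intro sum.cong refl) (simp add: mult.left_commute)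
  finally show ?thesis by simp
qed

lemma trace_on_eq:
  assumes ex: "\<exists>bs. is_basis U bs"
    and f: "\<And>v z. f v z = (\<Sum>y\<in>Z. D z y * v y)"
    and f_U: "\<And>u. u \<in> U \<Longrightarrow> f u \<in> U"
  shows "trace_on U f = (\<Sum>z\<in>Z. \<Sum>y\<in>Z. D z y * P y z)"
proof -
  define bs where "bs = (SOME bs. is_basis U bs)"
  have bs: "is_basis U bs" unfolding bs_def by (rule someI_ex[OF ex])
  have "coords bs (f (bs ! k)) k = mat_coeff bs f k k" if k: "k < length bs" for k
  proof -
    have "bs ! k \<in> U" using is_basis_nth[OF bs] k by blast
    then have "f (bs ! k) = lcomb bs (\<lambda>l. mat_coeff bs f l k)"
      by (intro mat_coeff[OF bs k] f_U)
    from arg_cong[OF this, of "\<lambda>u. coords bs u k"] show ?thesis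
      by (rule trans) (rule coords_lcomb[OF bs k])
  qed
  then show ?thesis
    unfolding trace_on_def bs_def[symmetric] Let_def
    trace_mat_coeff[OF bs, of f, OF f, symmetric] by (intro sum.cong) auto
qed

end

subsection \<open>Content words\<close>

text \<open>A Young diagram is encoded by the multiset \<open>M\<close> of its contents; \<open>prof M\<close> is the boundary
  profile of the diagram in Russian orientation, whose local minima and maxima are the addable
  and removable contents. Standard tableaux become the words accepted by \<open>grows {#}\<close>.\<close>

definition prof :: "int multiset \<Rightarrow> int \<Rightarrow> int" where
  "prof M a = \<bar>a\<bar> + 2 * int (count M a)"

definition addable :: "int multiset \<Rightarrow> int \<Rightarrow> bool" where
  "addable M a \<longleftrightarrow> prof M (a - 1) = prof M a + 1 \<and> prof M (a + 1) = prof M a + 1"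

definition removable :: "int multiset \<Rightarrow> int \<Rightarrow> bool" where
  "removable M a \<longleftrightarrow> prof M (a - 1) = prof M a - 1 \<and> prof M (a + 1) = prof M a - 1"

fun grows :: "int multiset \<Rightarrow> int list \<Rightarrow> bool" where
  "grows M [] = True"
| "grows M (a # w) = (addable M a \<and> grows (add_mset a M) w)"

lemma grows_append: "grows M (u @ w) \<longleftrightarrow> grows M u \<and> grows (M + mset u) w"
  by (induction u arbitrary: M) auto

lemma prof_add: "prof (add_mset a M) b = prof M b + (if a = b then 2 else 0)"
  by (auto simp: prof_def)

lemma addable_add_far: "\<bar>a - b\<bar> \<ge> 2 \<Longrightarrow> addable (add_mset a M) b \<longleftrightarrow> addable M b"
  by (auto simp: addable_def prof_add)

lemma removable_add_far: "\<bar>a - b\<bar> \<ge> 2 \<Longrightarrow> removable (add_mset a M) b \<longleftrightarrow> removable M b"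
  by (auto simp: removable_def prof_add)

lemma removable_add_self: "removable (add_mset a M) a \<longleftrightarrow> addable M a"
  by (auto simp: removable_def addable_def prof_add)

lemma not_addable_add_self: "addable M a \<Longrightarrow> \<not> addable (add_mset a M) a"
  by (auto simp: addable_def prof_add)

lemma not_addable_neighbour:
  assumes "addable M a" "\<bar>a - b\<bar> = 1"
  shows "\<not> addable M b"
proof
  assume b: "addable M b"
  consider "b + 1 = a" "a - 1 = b" | "b - 1 = a" "a + 1 = b" using assms(2) by linarith
  then show False
    using assms(1) b unfolding addable_def by cases (simp_all only:, linarith+)
qed

lemma removable_in: "removable M a \<Longrightarrow> a \<in># M"
proof (rule ccontr)
  assume "removable M a" "a \<notin># M"
  then have "count M a = 0" by (simp add: not_in_iff)
  then show False using \<open>removable M a\<close> unfolding removable_def prof_def by auto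
qed

text \<open>Two letters at distance one cannot be exchanged, because neighbours of a local minimum
  of the profile are no local minima; letters at distance at least two do not influence each
  other.\<close>

lemma swap_pair:
  assumes "addable M x" "addable (add_mset x M) y"
  shows "x \<noteq> y" and "\<bar>y - x\<bar> \<noteq> 1 \<Longrightarrow> addable M y \<and> addable (add_mset y M) x"
    and "\<bar>y - x\<bar> = 1 \<Longrightarrow> \<not> addable M y"
proof -
  show xy: "x \<noteq> y" using assms not_addable_add_self by blast
  show "addable M y \<and> addable (add_mset y M) x" if "\<bar>y - x\<bar> \<noteq> 1"
  proof -
    have "\<bar>x - y\<bar> \<ge> 2" "\<bar>y - x\<bar> \<ge> 2" using xy that by auto
    then show ?thesis using assms addable_add_far by blast
  qed
  show "\<not> addable M y" if "\<bar>y - x\<bar> = 1"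
    using assms(1) not_addable_neighbour[of M x y] that by (simp add: abs_minus_commute)
qed

text \<open>This keeps the denominators of the braid relation nonzero. For \<open>x = z\<close> both
  neighbours of \<open>x\<close> would have to be raised between the two occurrences, but the single
  letter \<open>y\<close> raises at most one of them.\<close>

lemma triple_distinct:
  assumes "addable M x" "addable (add_mset x M) y" "addable (add_mset y (add_mset x M)) z"
  shows "x \<noteq> y" "y \<noteq> z" "x \<noteq> z"
proof -
  show xy: "x \<noteq> y" and "y \<noteq> z" using assms not_addable_add_self by blast+
  show "x \<noteq> z"
  proof
    assume z: "x = z"
    have "prof M (z - 1) + (if y = z - 1 then 2 else 0) = prof M z + 3"
      "prof M (z + 1) + (if y = z + 1 then 2 else 0) = prof M z + 3"
      using assms(3) xy unfolding addable_def prof_add z by auto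
    moreover have "prof M (z - 1) = prof M z + 1" "prof M (z + 1) = prof M z + 1"
      using assms(1) unfolding addable_def z by auto
    ultimately show False by (simp split: if_splits)
  qed
qed

definition cwords :: "nat \<Rightarrow> int list set" where
  "cwords r = {c. length c = r \<and> grows {#} c}"

lemma cwords_length: "c \<in> cwords r \<Longrightarrow> length c = r"
  by (simp add: cwords_def)

lemma cwords_snoc: "c @ [a] \<in> cwords (Suc r) \<longleftrightarrow> c \<in> cwords r \<and> addable (mset c) a"
  by (auto simp: cwords_def grows_append)

lemma cwords_Suc: "cwords (Suc r) = (\<Union>c\<in>cwords r. (\<lambda>a. c @ [a]) ` {a. addable (mset c) a})" (is "_ = ?R")
proof
  show "cwords (Suc r) \<subseteq> ?R"
  proof
    fix c assume c: "c \<in> cwords (Suc r)"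
    then obtain d a where "c = d @ [a]"
      by (metis cwords_length append_butlast_last_id length_0_conv nat.distinct(1))
    then show "c \<in> ?R" using c cwords_snoc by blast
  qed
qed (auto simp: cwords_snoc)

text \<open>Where neither \<open>a\<close> nor a neighbour occurs in \<open>M\<close>, the profile
  is the absolute value, whose only local minimum is 0.\<close>

lemma finite_addable [simp]: "finite {a. addable M a}"
proof (rule finite_subset)
  let ?S = "set_mset M"
  show "{a. addable M a} \<subseteq> {0} \<union> ?S \<union> (\<lambda>a. a - 1) ` ?S \<union> (\<lambda>a. a + 1) ` ?S"
  proof (rule subsetI, rule ccontr)
    fix a assume a: "a \<in> {a. addable M a}"
      and "a \<notin> {0} \<union> ?S \<union> (\<lambda>a. a - 1) ` ?S \<union> (\<lambda>a. a + 1) ` ?S"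
    moreover have "a + 1 \<in># M \<Longrightarrow> a \<in> (\<lambda>a. a - 1) ` ?S" "a - 1 \<in># M \<Longrightarrow> a \<in> (\<lambda>a. a + 1) ` ?S"
      by (rule image_eqI; simp)+
    ultimately have "a \<noteq> 0" "a \<notin># M" "a + 1 \<notin># M" "a - 1 \<notin># M" by blast+
    then have "a \<noteq> 0" "\<bar>a - 1\<bar> = \<bar>a\<bar> + 1" "\<bar>a + 1\<bar> = \<bar>a\<bar> + 1"
      using a by (simp_all add: addable_def prof_def not_in_iff)
    then show False by arith
  qed
qed auto

lemma finite_removable [simp]: "finite {a. removable M a}"
  by (rule finite_subset[of _ "set_mset M"]) (auto simp: removable_in)

lemma cwords_zero: "cwords 0 = {[]}"
  by (auto simp: cwords_def)

lemma finite_V [simp]: "finite (cwords r)"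
  by (induction r) (auto simp: cwords_zero cwords_Suc)

text \<open>\<open>adj i\<close> exchanges the places \<open>i\<close> and \<open>i + 1\<close>
  counted from 1, that is, the list indices \<open>i - 1\<close> and \<open>i\<close>.\<close>

definition swap_at :: "nat \<Rightarrow> 'a list \<Rightarrow> 'a list" where
  "swap_at i c = c[i - 1 := c ! i, i := c ! (i - 1)]"

lemma length_swap_at [simp]: "length (swap_at i c) = length c"
  by (simp add: swap_at_def)

lemma swap_at_append2: "length u = i - 1 \<Longrightarrow> 1 \<le> i \<Longrightarrow> swap_at i (u @ x # y # w) = u @ y # x # w"
  by (cases i) (auto simp: swap_at_def list_update_append nth_append)

lemma split2:
  assumes "1 \<le> i" "i < length c"
  obtains u x y w where "c = u @ x # y # w" "length u = i - 1" "c ! i = y" "c ! (i - 1) = x"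
proof -
  have "c = take (i - 1) c @ c ! (i - 1) # c ! i # drop (Suc i) c"
    using assms by (metis Cons_nth_drop_Suc Suc_diff_1 append_take_drop_id less_imp_diff_less not_less_zero zero_less_iff_neq_zero not_one_le_zero)
  then show thesis using that[of "take (i - 1) c" "c ! (i - 1)" "c ! i" "drop (Suc i) c"] assms by simp
qed

lemma split3:
  assumes "1 \<le> i" "Suc i < length c"
  obtains u x y z w where "c = u @ x # y # z # w" "length u = i - 1"
proof -
  have "i < length c" using assms by simp
  then obtain u x y w where c: "c = u @ x # y # w" "length u = i - 1"
    by (rule split2[OF assms(1)])
  have "w \<noteq> []" using assms unfolding c(1) by (simp add: c(2))
  then obtain z w' where "w = z # w'" by (meson neq_Nil_conv)
  then have "c = u @ x # y # z # w'" using c(1) by simp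
  then show thesis by (rule that) (rule c(2))
qed

lemma mset_swap_at: "1 \<le> i \<Longrightarrow> i < length c \<Longrightarrow> mset (swap_at i c) = mset c"
proof -
  assume i: "1 \<le> i" "i < length c"
  obtain u x y w where c: "c = u @ x # y # w" "length u = i - 1" by (rule split2[OF i])
  show ?thesis unfolding c(1) swap_at_append2[OF c(2) i(1)] by simp
qed

lemma cwords_swap_at:
  assumes "c \<in> cwords r" "1 \<le> i" "i < r"
  shows "c ! i \<noteq> c ! (i - 1)" and "swap_at i c \<in> cwords r \<longleftrightarrow> \<bar>c ! i - c ! (i - 1)\<bar> \<noteq> 1"
proof -
  obtain u x y w where c: "c = u @ x # y # w" "length u = i - 1" "c ! i = y" "c ! (i - 1) = x"
    using split2[of i c] assms cwords_length by blast
  have a: "addable (mset u) x" "addable (add_mset x (mset u)) y"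
    using assms(1) unfolding c(1) cwords_def by (simp_all add: grows_append)
  show "c ! i \<noteq> c ! (i - 1)" using swap_pair(1)[OF a] by (simp only: c(3,4) not_sym)
  have "swap_at i c \<in> cwords r \<longleftrightarrow> addable (mset u) y \<and> addable (add_mset y (mset u)) x"
    using assms(1) unfolding c(1) cwords_def swap_at_append2[OF c(2) assms(2)]
    by (simp add: grows_append add_mset_commute[of x y])
  then show "swap_at i c \<in> cwords r \<longleftrightarrow> \<bar>c ! i - c ! (i - 1)\<bar> \<noteq> 1"
    using swap_pair(2,3)[OF a] unfolding c(3,4) by blast
qed

text \<open>The last occurrence of a removable content can be carried to the end of a word by
  admissible transpositions.\<close>

lemma bubble:
  assumes "grows M (a # w)" "a \<notin> set w" "removable (add_mset a M + mset w) a"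
    and P: "\<And>u x y v. P (u @ x # y # v) \<Longrightarrow> grows M (u @ y # x # v) \<Longrightarrow> P (u @ y # x # v)"
    and "P (a # w)"
  shows "grows M (w @ [a]) \<and> P (w @ [a])"
proof -
  have a: "addable M a" using assms(1) by simp
  have aw: "count (mset w) a = 0" using assms(2) by (simp add: count_eq_zero_iff)
  \<comment> \<open>The content \<open>a\<close> is a local minimum for \<open>M\<close> and a local
    maximum at the end, while its own height grows by 2 only. So the heights at both neighbours are
    the same before and after, and neither occurs in \<open>w\<close>.\<close>
  have nb: "\<bar>a - b\<bar> \<noteq> 1" if "b \<in> set w" for b
  proof
    assume "\<bar>a - b\<bar> = 1"
    then consider "b = a + 1" | "b = a - 1" by linarith
    then have "count (mset w) b = 0"
    proof cases
      case 1
      have "count (mset w) (a + 1) = 0"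
        using a assms(3) aw unfolding removable_def addable_def prof_def by (auto simp del: count_mset_0_iff)
      then show ?thesis using 1 by simp
    next
      case 2
      have "count (mset w) (a - 1) = 0"
        using a assms(3) aw unfolding removable_def addable_def prof_def by (auto simp del: count_mset_0_iff)
      then show ?thesis using 2 by simp
    qed
    then show False using that by (simp add: count_eq_zero_iff)
  qed
  have far: "\<bar>a - b\<bar> \<ge> 2" if "b \<in> set w" for b
  proof -
    have "a \<noteq> b" using assms(2) that by auto
    then show ?thesis using nb[OF that] by arith
  qed
  \<comment> \<open>\<open>w1\<close> is the part that the letter \<open>a\<close> has already
    passed.\<close>
  have "w = w1 @ w2 \<Longrightarrow> grows M (w1 @ a # w2) \<and> P (w1 @ a # w2)" for w1 w2
  proof (induction w1 arbitrary: w2 rule: rev_induct)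
    case Nil
    then show ?case using assms by simp
  next
    case (snoc b w1)
    have IH: "grows M (w1 @ a # b # w2)" "P (w1 @ a # b # w2)" using snoc.IH[of "b # w2"] snoc.prems by auto
    have ab: "\<bar>a - b\<bar> \<ge> 2" "\<bar>b - a\<bar> \<ge> 2" using far[of b] snoc.prems by auto
    have "grows M (w1 @ b # a # w2)"
      using IH(1) ab by (auto simp: grows_append addable_add_far add_mset_commute)
    then show ?case using P[OF IH(2)] by auto
  qed
  from this[of w "[]"] show ?thesis by simp
qed

lemma last_occurrence:
  assumes "a \<in> set c"
  obtains u w where "c = u @ a # w" "a \<notin> set w"
  using assms by (meson split_list_last)

text \<open>Tableaux of one shape are connected by admissible transpositions. The last letter of
  \<open>d\<close> is removable for the common shape, so \<open>bubble\<close> carries it to the end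
  of \<open>c\<close>; the prefixes are then connected by induction.\<close>

lemma conn_induct:
  assumes "c \<in> cwords r" "d \<in> cwords r" "mset c = mset d" "P c"
    and "\<And>b i. b \<in> cwords r \<Longrightarrow> 1 \<le> i \<Longrightarrow> i < r \<Longrightarrow> swap_at i b \<in> cwords r \<Longrightarrow> P b \<Longrightarrow> P (swap_at i b)"
  shows "P d"
  using assms
proof (induction r arbitrary: c d P)
  case 0
  then show ?case by (auto simp: cwords_zero)
next
  case (Suc r)
  note swap = Suc.prems(5)
  obtain d' a where d: "d = d' @ [a]" "d' \<in> cwords r" "addable (mset d') a"
    using Suc.prems(2) unfolding cwords_Suc by auto
  have rem: "removable (mset c) a"
    using d Suc.prems(3) by (simp add: removable_add_self)
  have "a \<in> set c" using removable_in[OF rem] by simp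
  then obtain u w where c: "c = u @ a # w" "a \<notin> set w" by (rule last_occurrence)
  have vu: "grows {#} u" and va: "grows (mset u) (a # w)"
    using Suc.prems(1) unfolding c cwords_def by (auto simp: grows_append)
  \<comment> \<open>The property carried through \<open>bubble\<close> also records the length and
    admissibility of the suffix, which makes the whole list a content word to which
    \<open>swap\<close> applies.\<close>
  have step: "P (u @ u' @ y # x # v)"
    if "P (u @ u' @ x # y # v) \<and> length (u' @ x # y # v) = Suc (length w) \<and> grows (mset u) (u' @ x # y # v)"
      "grows (mset u) (u' @ y # x # v)" for u' x y v
  proof -
    let ?b = "(u @ u') @ x # y # v"
    have b: "?b \<in> cwords (Suc r)" and b': "(u @ u') @ y # x # v \<in> cwords (Suc r)"
      using that vu Suc.prems(1) unfolding c cwords_def by (auto simp: grows_append)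
    have "swap_at (Suc (length (u @ u'))) ?b = (u @ u') @ y # x # v"
      by (rule swap_at_append2) auto
    then show ?thesis
      using swap[OF b, of "Suc (length (u @ u'))"] b b' that(1) cwords_length[OF b] by auto
  qed
  have "grows (mset u) (w @ [a]) \<and> (P (u @ w @ [a]) \<and> length (w @ [a]) = Suc (length w) \<and> grows (mset u) (w @ [a]))"
    by (rule bubble[OF va c(2)]) (use rem c step va Suc.prems(4) in \<open>auto simp: ac_simps\<close>)
  then have c': "(u @ w) @ [a] \<in> cwords (Suc r)" and Pc': "P ((u @ w) @ [a])"
    using vu Suc.prems(1) unfolding c cwords_def by (auto simp: grows_append)
  have uw: "u @ w \<in> cwords r" using c' cwords_snoc by blast
  have m: "mset (u @ w) = mset d'" using Suc.prems(3) unfolding c d by simp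
  \<comment> \<open>The multiset is kept in the induction predicate because it ensures that
    \<open>a\<close> can be appended to every intermediate prefix.\<close>
  have "P (d' @ [a]) \<and> mset d' = mset d'"
  proof (rule Suc.IH[OF uw d(2) m, of "\<lambda>b. P (b @ [a]) \<and> mset b = mset d'"])
    show "P ((u @ w) @ [a]) \<and> mset (u @ w) = mset d'" using Pc' m by simp
  next
    fix b i assume b: "b \<in> cwords r" "1 \<le> i" "i < r" "swap_at i b \<in> cwords r" "P (b @ [a]) \<and> mset b = mset d'"
    have sb: "swap_at i (b @ [a]) = swap_at i b @ [a]"
      using b cwords_length by (auto simp: swap_at_def nth_append list_update_append)
    have ms: "mset (swap_at i b) = mset d'" using b mset_swap_at[of i b] cwords_length by auto
    have "b @ [a] \<in> cwords (Suc r)" "swap_at i b @ [a] \<in> cwords (Suc r)" using b ms d(3) by (simp_all add: cwords_snoc)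
    then show "P (swap_at i b @ [a]) \<and> mset (swap_at i b) = mset d'"
      using swap[of "b @ [a]" i] b ms by (simp add: sb)
  qed
  then show ?case unfolding d by blast
qed

subsection \<open>Young's orthogonal form\<close>

definition cdiff :: "nat \<Rightarrow> int list \<Rightarrow> int" where
  "cdiff i c = c ! i - c ! (i - 1)"

text \<open>It vanishes for \<open>\<bar>d\<bar> = 1\<close>, exactly the distances at which the
  swapped word is no content word, and together with the diagonal entry 1/d it satisfies the
  equation that makes the operator an involution.\<close>

definition offdiag :: "int \<Rightarrow> complex" where
  "offdiag d = of_real (sqrt (1 - 1 / (of_int d)\<^sup>2))"

lemma offdiag_sq:
  assumes "d \<noteq> 0"
  shows "offdiag d * offdiag d = 1 - 1 / of_int d * (1 / of_int d)"
proof -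
  have "(1::int) \<le> d\<^sup>2" using assms by (metis int_one_le_iff_zero_less zero_less_power2)
  then have "(1::real) \<le> (of_int d)\<^sup>2" by (metis of_int_1 of_int_le_iff of_int_power)
  then have "(0::real) \<le> 1 - 1 / (of_int d)\<^sup>2" using le_imp_inverse_le[of 1 "(of_int d :: real)\<^sup>2"] by (simp add: inverse_eq_divide)
  then have "sqrt (1 - 1 / (of_int d)\<^sup>2) * sqrt (1 - 1 / (of_int d)\<^sup>2) = 1 - 1 / (of_int d)\<^sup>2"
    by (rule real_sqrt_mult_self[THEN trans, OF abs_of_nonneg])
  then have "offdiag d * offdiag d = of_real (1 - 1 / (of_int d)\<^sup>2)"
    unfolding offdiag_def of_real_mult[symmetric] by (rule arg_cong)
  then show ?thesis by (simp add: power2_eq_square)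
qed

lemma offdiag_minus: "offdiag (- d) = offdiag d"
  by (simp add: offdiag_def)

lemma offdiag_one: "\<bar>d\<bar> = 1 \<Longrightarrow> offdiag d = 0"
  by (auto simp: offdiag_def abs_if split: if_splits)

lemma offdiag_nonzero:
  assumes "d \<noteq> 0" "\<bar>d\<bar> \<noteq> 1"
  shows "offdiag d \<noteq> 0"
proof
  assume "offdiag d = 0"
  then have "1 / of_int d * (1 / of_int d) = (1::complex)" using offdiag_sq[OF assms(1)] by simp
  then have "of_int (d * d) = (of_int 1 :: complex)" using assms(1) by (simp add: field_simps)
  then have "d * d = 1" unfolding of_int_eq_iff .
  then show False using assms by (simp add: zmult_eq_1_iff) auto
qed

definition orth0 :: "nat \<Rightarrow> (int list \<Rightarrow> complex) \<Rightarrow> int list \<Rightarrow> complex" where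
  "orth0 i v c = 1 / of_int (cdiff i c) * v c + offdiag (cdiff i c) * v (swap_at i c)"

text \<open>The identity outside the content words lets the Coxeter laws hold for all functions, as
  the locale demands.\<close>

definition orth :: "nat \<Rightarrow> nat \<Rightarrow> (int list \<Rightarrow> complex) \<Rightarrow> int list \<Rightarrow> complex" where
  "orth r i v c = (if c \<in> cwords r then orth0 i v c else v c)"

lemma orth0_split:
  assumes "length u = i - 1" "1 \<le> i"
  shows "orth0 i v (u @ x # y # w) = 1 / of_int (y - x) * v (u @ x # y # w) + offdiag (y - x) * v (u @ y # x # w)"
proof -
  have "cdiff i (u @ x # y # w) = y - x"
    using assms by (cases i) (auto simp: cdiff_def nth_append)
  then show ?thesis by (simp add: orth0_def swap_at_append2[OF assms])
qed

lemma orth0_split_Suc: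
  assumes "length u = i - 1" "1 \<le> i"
  shows "orth0 (Suc i) v (u @ x # y # z # w) =
    1 / of_int (z - y) * v (u @ x # y # z # w) + offdiag (z - y) * v (u @ x # z # y # w)"
  using orth0_split[of "u @ [x]" "Suc i" v y z w] assms by simp

text \<open>Either the swapped word is a content word or its coefficient is zero. Hence nested
  \<open>orth\<close> may be replaced by the plain formula \<open>orth0\<close>, and the relations
  can be verified on all rearrangements of the letters without asking which are admissible.\<close>

lemma orth0_cong:
  assumes "c \<in> cwords r" "1 \<le> i" "i < r" and eq: "\<And>b. b \<in> cwords r \<Longrightarrow> v b = v' b"
  shows "orth0 i v c = orth0 i v' c"
proof (cases "swap_at i c \<in> cwords r")
  case False
  then have "offdiag (cdiff i c) = 0"
    using cwords_swap_at(2)[OF assms(1-3)] by (intro offdiag_one) (simp add: cdiff_def)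
  then show ?thesis using eq[OF assms(1)] by (simp add: orth0_def)
qed (use assms in \<open>simp add: orth0_def\<close>)

lemma orth_V: "c \<in> cwords r \<Longrightarrow> orth r i v c = orth0 i v c"
  by (simp add: orth_def)

lemma orth_orth:
  assumes "c \<in> cwords r" "1 \<le> i" "i < r"
  shows "orth r i (orth r j v) c = orth0 i (orth0 j v) c"
  unfolding orth_V[OF assms(1)] using assms by (rule orth0_cong) (rule orth_V)

lemma orth_orth_orth:
  assumes "c \<in> cwords r" "1 \<le> i" "i < r" "1 \<le> j" "j < r"
  shows "orth r i (orth r j (orth r k v)) c = orth0 i (orth0 j (orth0 k v)) c"
  unfolding orth_V[OF assms(1)] using assms(1-3)
  by (rule orth0_cong) (rule orth_orth[OF _ assms(4,5)])

text \<open>\<open>A\<close>, \<open>B\<close>, \<open>C\<close> stand for the inverses of y-x, z-y,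
  z-x, and \<open>p\<close>, \<open>q\<close>, \<open>s\<close> for the values of
  \<open>offdiag\<close> there. The first assumption says that z-x is the sum of the other two
  differences. \<open>v1\<close> to \<open>v6\<close> are the values at xyz, yxz, xzy, zxy, yzx,
  zyx; only the terms in the first three need the assumptions.\<close>

lemma braid_identity:
  fixes A B C p q s :: complex
  assumes "A * B = C * (A + B)" "p * p = 1 - A * A" "q * q = 1 - B * B"
  shows "A * (B * (A * v1 + p * v2) + q * (C * v3 + s * v4)) +
      p * (C * (- A * v2 + p * v1) + s * (B * v5 + q * v6)) =
    B * (A * (B * v1 + q * v3) + p * (C * v2 + s * v5)) +
      q * (C * (- B * v3 + q * v1) + s * (A * v4 + p * v6))"
proof -
  have 1: "A * (B * A) + C * (p * p) = B * (A * B) + C * (q * q)"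
    using assms by algebra
  have 2: "A * (B * p) - p * (C * A) = B * (p * C)" using assms(1) by algebra
  have 3: "A * (q * C) = B * (A * q) - q * (C * B)" using assms(1) by algebra
  have "?thesis \<longleftrightarrow> (A * (B * A) + C * (p * p)) * v1 + (A * (B * p) - p * (C * A)) * v2 + (A * (q * C)) * v3 =
      (B * (A * B) + C * (q * q)) * v1 + (B * (p * C)) * v2 + (B * (A * q) - q * (C * B)) * v3"
    by (simp add: algebra_simps)
  then show ?thesis by (simp only: 1 2 3)
qed

lemma orth_sq:
  assumes i: "1 \<le> i" "i < r"
  shows "orth r i (orth r i v) = v"
proof
  fix c
  show "orth r i (orth r i v) c = v c"
  proof (cases "c \<in> cwords r")
    case True
    have "i < length c" using i cwords_length[OF True] by simp
    then obtain u x y w where c: "c = u @ x # y # w" "length u = i - 1" "c ! i = y" "c ! (i - 1) = x"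
      by (rule split2[OF i(1)])
    have "y \<noteq> x" using cwords_swap_at(1)[OF True i] unfolding c(3,4) .
    then have k: "offdiag (y - x) * offdiag (y - x) = 1 - 1 / of_int (y - x) * (1 / of_int (y - x))"
      by (intro offdiag_sq) simp
    have m: "1 / of_int (x - y) = - (1 / of_int (y - x) :: complex)" "offdiag (x - y) = offdiag (y - x)"
      using offdiag_minus[of "y - x"] by (simp_all add: divide_minus_right[symmetric] del: divide_minus_right)
    then have "orth0 i (orth0 i v) c = v c"
      unfolding c(1) orth0_split[OF c(2) i(1)] m using k by algebra
    then show ?thesis unfolding orth_orth[OF True i] .
  qed (simp add: orth_def)
qed

lemma orth_braid:
  assumes i: "1 \<le> i" "Suc i < r"
  shows "orth r i (orth r (Suc i) (orth r i v)) = orth r (Suc i) (orth r i (orth r (Suc i) v))"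
proof
  fix c
  show "orth r i (orth r (Suc i) (orth r i v)) c = orth r (Suc i) (orth r i (orth r (Suc i) v)) c"
  proof (cases "c \<in> cwords r")
    case True
    have "Suc i < length c" using i cwords_length[OF True] by simp
    then obtain u x y z w where c: "c = u @ x # y # z # w" "length u = i - 1"
      by (rule split3[OF i(1)])
    have "addable (mset u) x" "addable (add_mset x (mset u)) y" "addable (add_mset y (add_mset x (mset u))) z"
      using True unfolding c(1) cwords_def by (simp_all add: grows_append)
    note d = triple_distinct[OF this]
    have k1: "offdiag (y - x) * offdiag (y - x) = 1 - 1 / of_int (y - x) * (1 / of_int (y - x))"
      and k2: "offdiag (z - y) * offdiag (z - y) = 1 - 1 / of_int (z - y) * (1 / of_int (z - y))"
      using d by (simp_all add: offdiag_sq)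
    have r: "1 / of_int (y - x) * (1 / of_int (z - y)) =
        1 / of_int (z - x) * (1 / of_int (y - x) + 1 / of_int (z - y) :: complex)"
      using d by (simp add: field_simps)
    have m: "1 / of_int (x - y) = - (1 / of_int (y - x) :: complex)" "offdiag (x - y) = offdiag (y - x)"
      "1 / of_int (y - z) = - (1 / of_int (z - y) :: complex)" "offdiag (y - z) = offdiag (z - y)"
      using offdiag_minus[of "y - x"] offdiag_minus[of "z - y"]
      by (simp_all add: divide_minus_right[symmetric] del: divide_minus_right)
    have i': "i < r" "1 \<le> Suc i" using i by auto
    show ?thesis
      unfolding orth_orth_orth[OF True i(1) i'(1) i'(2) i(2)] orth_orth_orth[OF True i'(2) i(2) i(1) i'(1)]
      unfolding c(1) orth0_split[OF c(2) i(1)] orth0_split_Suc[OF c(2) i(1)] m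
      by (rule braid_identity[OF r k1 k2])
  qed (simp add: orth_def)
qed

lemma orth_comm:
  assumes i: "1 \<le> i" "Suc i < j" "j < r"
  shows "orth r i (orth r j v) = orth r j (orth r i v)"
proof
  fix c
  show "orth r i (orth r j v) c = orth r j (orth r i v) c"
  proof (cases "c \<in> cwords r")
    case True
    have len: "length c = r" using cwords_length[OF True] .
    have s: "swap_at i (swap_at j c) = swap_at j (swap_at i c)"
      using i len by (intro nth_equalityI) (auto simp: swap_at_def nth_list_update)
    have d: "cdiff i (swap_at j c) = cdiff i c" "cdiff j (swap_at i c) = cdiff j c"
      using i len by (auto simp: cdiff_def swap_at_def nth_list_update)
    have "orth0 i (orth0 j v) c = orth0 j (orth0 i v) c"
      unfolding orth0_def s d by (simp add: algebra_simps)
    moreover have "i < r" "1 \<le> j" using i by auto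
    ultimately show ?thesis using orth_orth[OF True] i by simp
  qed (simp add: orth_def)
qed

interpretation orth: coxeter r "orth r" for r
  by unfold_locales (rule orth_sq orth_comm orth_braid; assumption)+

abbreviation Phi :: "nat \<Rightarrow> (nat \<Rightarrow> nat) \<Rightarrow> (int list \<Rightarrow> complex) \<Rightarrow> int list \<Rightarrow> complex" where
  "Phi r \<equiv> orth.ext r"

lemma orth_add: "orth r i (\<lambda>z. v z + w z) = (\<lambda>z. orth r i v z + orth r i w z)"
  by (rule ext) (simp add: orth_def orth0_def algebra_simps add_divide_distrib)

lemma orth_scale: "orth r i (\<lambda>z. c * v z) = (\<lambda>z. c * orth r i v z)"
  by (rule ext) (simp add: orth_def orth0_def algebra_simps)

interpretation orth: perm_rep r "Phi r" for r
proof
  fix \<sigma> :: "nat \<Rightarrow> nat" and v w :: "int list \<Rightarrow> complex" and c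
  assume "\<sigma> \<in> perms r"
  then have "(\<forall>v w. Phi r \<sigma> (\<lambda>z. v z + w z) = (\<lambda>z. Phi r \<sigma> v z + Phi r \<sigma> w z)) \<and>
      (\<forall>v. Phi r \<sigma> (\<lambda>z. c * v z) = (\<lambda>z. c * Phi r \<sigma> v z))"
  proof (induction rule: perms_induct_adj)
    case id
    show ?case unfolding orth.ext_id by blast
  next
    case (adj \<sigma> i)
    then show ?case
      unfolding orth.ext_comp_adj[OF adj.hyps] orth_add orth_scale by blast
  qed
  then show "Phi r \<sigma> (\<lambda>z. v z + w z) = (\<lambda>z. Phi r \<sigma> v z + Phi r \<sigma> w z)"
    "Phi r \<sigma> (\<lambda>z. c * v z) = (\<lambda>z. c * Phi r \<sigma> v z)" by blast+
qed (simp add: orth.ext_comp)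

lemma Phi_outside:
  assumes "\<sigma> \<in> perms r" "c \<notin> cwords r"
  shows "Phi r \<sigma> v c = v c"
  using assms(1)
proof (induction arbitrary: v rule: perms_induct_adj)
  case id
  show ?case unfolding orth.ext_id ..
next
  case (adj \<sigma> i)
  show ?case
    unfolding orth.ext_comp_adj[OF adj.hyps] adj.IH using assms(2) by (simp add: orth_def)
qed

lemma jm_eq: "jm k = (\<lambda>\<pi>. \<Sum>i\<in>{1..<k}. 1 * gbasis (transpose i k) \<pi>)"
  by (simp add: jm_def gbasis_def)

lemma transpose_perms: "1 \<le> i \<Longrightarrow> i \<le> r \<Longrightarrow> 1 \<le> k \<Longrightarrow> k \<le> r \<Longrightarrow> transpose i k \<in> perms r"
  unfolding perms_def by (simp add: permutes_swap_id)

lemma jm_galg: "1 \<le> k \<Longrightarrow> k \<le> r \<Longrightarrow> jm k \<in> galg r"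
  unfolding jm_eq by (rule galg_sum) (auto intro!: gbasis_galg transpose_perms)

lemma (in perm_rep) gext_jm:
  assumes "1 \<le> k" "k \<le> r"
  shows "gext r act (jm k) v = (\<lambda>z. \<Sum>i\<in>{1..<k}. act (transpose i k) v z)"
proof -
  have "gext r act (jm k) v = (\<lambda>z. \<Sum>i\<in>{1..<k}. 1 * gext r act (gbasis (transpose i k)) v z)"
    unfolding jm_eq by (rule gext_sum_galg)
  also have "\<dots> = (\<lambda>z. \<Sum>i\<in>{1..<k}. act (transpose i k) v z)"
    using assms by (intro ext sum.cong refl) (simp add: gext_gbasis transpose_perms)
  finally show ?thesis .
qed

text \<open>The induction rests on y_{k+1} = s_k y_k s_k + s_k: conjugation by \<open>adj k\<close>
  turns the transposition of \<open>i\<close> and \<open>k\<close> into that of \<open>i\<close> and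
  \<open>k + 1\<close>, and the summand \<open>i = k\<close> is \<open>adj k\<close> itself.\<close>

lemma jm_eigen:
  assumes "1 \<le> k" "k \<le> r" "c \<in> cwords r"
  shows "(\<Sum>i\<in>{1..<k}. Phi r (transpose i k) v c) = of_int (c ! (k - 1)) * v c"
  using assms
proof (induction k arbitrary: v c rule: nat_induct_at_least)
  case base
  then obtain a w where c: "c = a # w" by (metis cwords_length length_0_conv list.exhaust not_one_le_zero)
  \<comment> \<open>A content word starts with 0, the only local minimum of the absolute
    value.\<close>
  have "addable {#} a" using base unfolding c cwords_def by simp
  then have "\<bar>a - 1\<bar> = \<bar>a\<bar> + 1" "\<bar>a + 1\<bar> = \<bar>a\<bar> + 1" by (simp_all add: addable_def prof_def)
  then have "a = 0" by arith
  then show ?case by (simp add: c)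
next
  case (Suc k)
  have k: "1 \<le> k" "k < r" using Suc by auto
  have adj: "adj k \<in> perms r" using k by (rule adj_perms)
  have conj: "transpose i (Suc k) = adj k \<circ> (transpose i k \<circ> adj k)" if "i < k" for i
    using that by (auto simp: adj_def fun_eq_iff transpose_def)
  let ?w = "orth r k v"
  have IH: "(\<lambda>z. \<Sum>i\<in>{1..<k}. 1 * Phi r (transpose i k) ?w z) b = of_int (b ! (k - 1)) * orth0 k v b"
    if "b \<in> cwords r" for b
    using Suc.IH[OF _ that, of ?w] k that by (simp add: orth_V)
  have "(\<Sum>i\<in>{1..<Suc k}. Phi r (transpose i (Suc k)) v c) =
      (\<Sum>i\<in>{1..<k}. 1 * Phi r (adj k) (Phi r (transpose i k) ?w) c) + ?w c"
  proof -
    have "(\<Sum>i\<in>{1..<k}. Phi r (transpose i (Suc k)) v c) =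
        (\<Sum>i\<in>{1..<k}. 1 * Phi r (adj k) (Phi r (transpose i k) ?w) c)"
    proof (rule sum.cong[OF refl])
      fix i assume i: "i \<in> {1..<k}"
      then have "transpose i k \<in> perms r" using k by (intro transpose_perms) auto
      then show "Phi r (transpose i (Suc k)) v c = 1 * Phi r (adj k) (Phi r (transpose i k) ?w) c"
        using i adj k by (simp add: conj orth.act_comp orth.ext_adj)
    qed
    then show ?thesis
      using orth.ext_adj[of k r] k by (simp add: adj_def)
  qed
  also have "(\<Sum>i\<in>{1..<k}. 1 * Phi r (adj k) (Phi r (transpose i k) ?w) c) =
      Phi r (adj k) (\<lambda>z. \<Sum>i\<in>{1..<k}. 1 * Phi r (transpose i k) ?w z) c"
    unfolding orth.act_sum[OF adj] by simp
  also have "\<dots> = orth0 k (\<lambda>z. \<Sum>i\<in>{1..<k}. 1 * Phi r (transpose i k) ?w z) c"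
    using k orth_V[OF Suc.prems(2)] by (simp only: orth.ext_adj)
  also have "\<dots> = orth0 k (\<lambda>b. of_int (b ! (k - 1)) * orth0 k v b) c"
    using Suc.prems(2) k by (rule orth0_cong) (rule IH)
  also have "?w c = orth0 k v c" using Suc.prems(2) by (rule orth_V)
  also have "orth0 k (\<lambda>b. of_int (b ! (k - 1)) * orth0 k v b) c + orth0 k v c = of_int (c ! k) * v c"
  proof -
    have "k < length c" using k cwords_length[OF Suc.prems(2)] by simp
    then obtain u x y w where c: "c = u @ x # y # w" "length u = k - 1" "c ! k = y" "c ! (k - 1) = x"
      by (rule split2[OF k(1)])
    define d where "d = y - x"
    have "y \<noteq> x" using cwords_swap_at(1)[OF Suc.prems(2) k] unfolding c(3,4) .
    then have d0: "of_int d \<noteq> (0::complex)" and kd: "offdiag d * offdiag d = 1 - 1 / of_int d * (1 / of_int d)"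
      by (simp_all add: d_def offdiag_sq)
    have m: "1 / of_int (x - y) = - (1 / of_int d :: complex)" "offdiag (x - y) = offdiag d"
      using offdiag_minus[of "y - x"] by (simp_all add: d_def divide_minus_right[symmetric] del: divide_minus_right)
    define D :: complex where "D = 1 / of_int d"
    have y: "of_int y = of_int x + (of_int d :: complex)" and D: "D * of_int d = 1"
      using d0 by (simp_all add: d_def D_def)
    have nth: "(u @ a # b # w) ! (k - 1) = a" for a b :: int using c(2) by (simp add: nth_append)
    show ?thesis
      unfolding c(3) unfolding c(1) orth0_split[OF c(2) k(1)] m nth d_def[symmetric] y
      using kd D unfolding D_def[symmetric] by algebra
  qed
  finally show ?case by simp
qed

section \<open>Matrix units in the image of the group algebra\<close>

definition delta_word :: "int list \<Rightarrow> int list \<Rightarrow> complex" where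
  "delta_word d c = (if c = d then 1 else 0)"

definition matel :: "nat \<Rightarrow> galg \<Rightarrow> int list \<Rightarrow> int list \<Rightarrow> complex" where
  "matel r x c d = gext r (Phi r) x (delta_word d) c"

lemma matel_gscale: "matel r (gscale k x) c d = k * matel r x c d"
  by (simp add: matel_def gext_gscale)

lemma matel_add: "matel r (\<lambda>\<pi>. x \<pi> + y \<pi>) c d = matel r x c d + matel r y c d"
  by (simp add: matel_def gext_add_galg)

lemma matel_id: "matel r (gbasis id) c d = delta_word d c"
  unfolding matel_def orth.gext_gbasis[OF id_perms] orth.ext_id ..

lemma matel_adj:
  assumes "1 \<le> i" "i < r" "c \<in> cwords r"
  shows "matel r (gbasis (adj i)) c d = 1 / of_int (cdiff i c) * delta_word d c + offdiag (cdiff i c) * delta_word d (swap_at i c)"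
  unfolding matel_def orth.gext_gbasis[OF adj_perms[OF assms(1,2)]] orth.ext_adj[OF assms(1,2)]
    orth_V[OF assms(3)] orth0_def ..

lemma matel_jm:
  assumes "1 \<le> k" "k \<le> r" "c \<in> cwords r"
  shows "matel r (jm k) c d = of_int (c ! (k - 1)) * delta_word d c"
  unfolding matel_def orth.gext_jm[OF assms(1,2)] by (rule jm_eigen[OF assms])

lemma matel_gmul:
  assumes c: "c \<in> cwords r" and d: "d \<in> cwords r"
  shows "matel r (gmul r x y) c d = (\<Sum>b\<in>cwords r. matel r x c b * matel r y b d)"
proof -
  have eq: "gext r (Phi r) y (delta_word d) = (\<lambda>z. \<Sum>b\<in>cwords r. matel r y b d * delta_word b z)"
  proof
    fix z
    show "gext r (Phi r) y (delta_word d) z = (\<Sum>b\<in>cwords r. matel r y b d * delta_word b z)"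
    proof (cases "z \<in> cwords r")
      case True
      have "(\<Sum>b\<in>cwords r. matel r y b d * delta_word b z) = (\<Sum>b\<in>cwords r. if b = z then matel r y b d else 0)"
        by (intro sum.cong) (auto simp: delta_word_def)
      then show ?thesis using True by (simp add: matel_def)
    next
      case False
      have "(\<Sum>b\<in>cwords r. matel r y b d * delta_word b z) = 0"
        by (rule sum.neutral) (use False in \<open>auto simp: delta_word_def\<close>)
      moreover have "gext r (Phi r) y (delta_word d) z = 0"
        unfolding gext_def
        by (rule sum.neutral) (use False d in \<open>auto simp: Phi_outside delta_word_def\<close>)
      ultimately show ?thesis by simp
    qed
  qed
  have "matel r (gmul r x y) c d = gext r (Phi r) x (gext r (Phi r) y (delta_word d)) c"
    unfolding matel_def orth.gext_gmul ..
  also have "\<dots> = (\<Sum>b\<in>cwords r. matel r y b d * gext r (Phi r) x (delta_word b) c)"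
    unfolding eq orth.gext_sum ..
  also have "\<dots> = (\<Sum>b\<in>cwords r. matel r x c b * matel r y b d)"
    unfolding matel_def[of r x] by (intro sum.cong refl mult.commute)
  finally show ?thesis .
qed

definition mat_unit :: "nat \<Rightarrow> galg \<Rightarrow> int list \<Rightarrow> int list \<Rightarrow> bool" where
  "mat_unit r x c d \<longleftrightarrow> x \<in> galg r \<and>
    (\<forall>a\<in>cwords r. \<forall>b\<in>cwords r. matel r x a b = (if a = c \<and> b = d then 1 else 0))"

text \<open>Lagrange interpolation in the Jucys-Murphy elements: each word \<open>d\<close> to be
  killed contributes one linear factor.\<close>

lemma ex_diagonal:
  assumes "c \<in> cwords r" "finite S" "S \<subseteq> cwords r - {c}"
  shows "\<exists>x\<in>galg r. \<exists>h. h c = 1 \<and> (\<forall>d\<in>S. h d = 0) \<and>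
    (\<forall>a\<in>cwords r. \<forall>b\<in>cwords r. matel r x a b = (if a = b then h a else 0))"
  using assms(2,3)
proof (induction S)
  case empty
  show ?case
    by (rule bexI[of _ "gbasis id"], rule exI[of _ "\<lambda>_. 1"])
      (simp_all add: matel_id delta_word_def gbasis_galg[OF id_perms])
next
  case (insert d S)
  then obtain x h where x: "x \<in> galg r" "h c = 1" "\<forall>d\<in>S. h d = 0"
    "\<And>a b. a \<in> cwords r \<Longrightarrow> b \<in> cwords r \<Longrightarrow> matel r x a b = (if a = b then h a else 0)" by blast
  have dV: "d \<in> cwords r" "d \<noteq> c" using insert.prems by auto
  \<comment> \<open>List index \<open>k\<close> belongs to the Jucys-Murphy element with index
    \<open>Suc k\<close>. The factor \<open>y\<close> is scaled to have the eigenvalue 1 at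
    \<open>c\<close>, and it has the eigenvalue 0 at \<open>d\<close>.\<close>
  obtain k where k: "k < r" "c ! k \<noteq> d ! k"
    using dV cwords_length[OF dV(1)] cwords_length[OF assms(1)] nth_equalityI by metis
  define q :: complex where "q = 1 / of_int (c ! k - d ! k)"
  define y where "y = (\<lambda>\<pi>. gscale q (jm (Suc k)) \<pi> + gscale (- q * of_int (d ! k)) (gbasis id) \<pi>)"
  define g where "g a = q * of_int (a ! k - d ! k)" for a :: "int list"
  have y: "matel r y a b = (if a = b then g a else 0)" if "a \<in> cwords r" for a b
    unfolding y_def matel_add matel_gscale matel_id using matel_jm[of "Suc k" r a b] k that
    by (auto simp: delta_word_def g_def algebra_simps)
  have "matel r (gmul r y x) a b = (if a = b then g a * h a else 0)" if "a \<in> cwords r" "b \<in> cwords r" for a b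
  proof -
    have "matel r (gmul r y x) a b = (\<Sum>e\<in>cwords r. if e = a then g a * matel r x a b else 0)"
      unfolding matel_gmul[OF that] by (intro sum.cong refl) (auto simp: y that)
    then show ?thesis using that by (simp add: x(4))
  qed
  moreover have "g c * h c = 1" using k(2) x(2) by (simp add: g_def q_def)
  moreover have "\<forall>e\<in>insert d S. g e * h e = 0" using x(3) by (auto simp: g_def)
  ultimately show ?case
    by (intro bexI[of _ "gmul r y x"] exI[of _ "\<lambda>a. g a * h a"]) simp_all
qed

lemma ex_unit_diagonal:
  assumes "c \<in> cwords r"
  shows "\<exists>x. mat_unit r x c c"
proof -
  obtain x h where x: "x \<in> galg r" "h c = 1" "\<forall>d\<in>cwords r - {c}. h d = 0"
    "\<And>a b. a \<in> cwords r \<Longrightarrow> b \<in> cwords r \<Longrightarrow> matel r x a b = (if a = b then h a else 0)"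
    using ex_diagonal[OF assms, of "cwords r - {c}"] by auto
  then have "mat_unit r x c c" unfolding mat_unit_def by auto
  then show ?thesis by blast
qed

lemma sum_delta2:
  assumes "finite A" "c \<in> A" "\<And>e. e \<in> A \<Longrightarrow> e \<noteq> c \<Longrightarrow> f e = (0::complex)"
  shows "sum f A = f c"
  using assms by (subst sum.remove[of A c]) (auto intro: sum.neutral)

text \<open>Along an admissible swap from \<open>b\<close> to \<open>d\<close>, the product E_cb s_i
  E_dd is E_cd times the entry of s_i between \<open>b\<close> and \<open>d\<close>, which is
  nonzero by \<open>offdiag_nonzero\<close>. Connectivity does the rest.\<close>

lemma ex_unit:
  assumes "c \<in> cwords r" "d \<in> cwords r" "mset c = mset d"
  shows "\<exists>x. mat_unit r x c d"
  using assms
proof (rule conn_induct[where P = "\<lambda>d. \<exists>x. mat_unit r x c d"])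
  show "\<exists>x. mat_unit r x c c" by (rule ex_unit_diagonal[OF assms(1)])
next
  fix b i assume b: "b \<in> cwords r" "1 \<le> i" "i < r" "swap_at i b \<in> cwords r" "\<exists>x. mat_unit r x c b"
  define d where "d = swap_at i b"
  have d: "d \<in> cwords r" using b d_def by simp
  obtain x z where x: "mat_unit r x c b" and z: "mat_unit r z d d" using b(5) ex_unit_diagonal[OF d] by blast
  let ?s = "gbasis (adj i)"
  have cdiff: "cdiff i b \<noteq> 0" "\<bar>cdiff i b\<bar> \<noteq> 1" using cwords_swap_at[OF b(1-3)] b(4) by (simp_all add: cdiff_def)
  define k where "k = offdiag (cdiff i b)"
  have k: "k \<noteq> 0" unfolding k_def using cdiff by (rule offdiag_nonzero)
  have "b \<noteq> d"
  proof
    assume "b = d"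
    then have "b ! i = swap_at i b ! i" by (simp add: d_def)
    then show False using cwords_swap_at(1)[OF b(1-3)] cwords_length[OF b(1)] b(3) by (simp add: swap_at_def)
  qed
  then have s: "matel r ?s b d = k"
    unfolding matel_adj[OF b(2,3,1)] d_def[symmetric] k_def by (simp add: delta_word_def)
  have sz: "matel r (gmul r ?s z) e f = (if f = d then matel r ?s e d else 0)" if "e \<in> cwords r" "f \<in> cwords r" for e f
    unfolding matel_gmul[OF that] using z d that unfolding mat_unit_def
    by (subst sum_delta2[of _ d]) auto
  have "matel r (gmul r x (gmul r ?s z)) e f = (if e = c \<and> f = d then k else 0)"
    if "e \<in> cwords r" "f \<in> cwords r" for e f
    unfolding matel_gmul[OF that] using x b(1) that s unfolding mat_unit_def
    by (subst sum_delta2[of _ b]) (auto simp: sz)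
  then have "mat_unit r (gscale (1 / k) (gmul r x (gmul r ?s z))) c d"
    unfolding mat_unit_def using k by (auto simp: matel_gscale)
  then show "\<exists>x. mat_unit r x c (swap_at i b)" unfolding d_def by blast
qed

subsection \<open>Counting content words\<close>

text \<open>Deleting a removable box leaves a diagram: the last occurrence of \<open>a\<close> moves
  to the end of the word and is dropped.\<close>

lemma bubble_valid:
  assumes "grows {#} c" "removable (mset c) a"
  obtains c' where "grows {#} c'" "mset c' = mset c - {#a#}"
proof -
  have "a \<in> set c" using removable_in[OF assms(2)] by simp
  then obtain u w where c: "c = u @ a # w" "a \<notin> set w" by (rule last_occurrence)
  have u: "grows {#} u" and aw: "grows (mset u) (a # w)" using assms(1) unfolding c(1) by (simp_all add: grows_append)
  have "removable (add_mset a (mset u) + mset w) a" using assms(2) unfolding c(1) by (simp add: ac_simps)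
  then have "grows (mset u) (w @ [a]) \<and> True"
    using aw c(2) by (intro bubble[where P = "\<lambda>_. True"]) auto
  then have "grows {#} (u @ w)" using u by (simp add: grows_append)
  moreover have "mset (u @ w) = mset c - {#a#}" unfolding c(1) by simp
  ultimately show thesis by (rule that)
qed

text \<open>Raising a local minimum by 2 reverses the two slopes next to it.\<close>

lemma prof_step:
  assumes "grows {#} c"
  shows "\<bar>prof (mset c) (a + 1) - prof (mset c) a\<bar> = 1"
  using assms
proof (induction c arbitrary: a rule: rev_induct)
  case Nil
  show ?case by (simp add: prof_def)
next
  case (snoc b c)
  then have b: "addable (mset c) b" and IH: "\<bar>prof (mset c) (a + 1) - prof (mset c) a\<bar> = 1"
    by (simp_all add: grows_append)
  have m: "mset (c @ [b]) = add_mset b (mset c)" by simp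
  consider "b = a" | "b = a + 1" | "b \<noteq> a" "b \<noteq> a + 1" by blast
  then show ?case
    unfolding m prof_add
  proof cases
    case 1
    then show "\<bar>prof (mset c) (a + 1) + (if b = a + 1 then 2 else 0) - (prof (mset c) a + (if b = a then 2 else 0))\<bar> = 1"
      using b by (simp add: addable_def)
  next
    case 2
    have "prof (mset c) a = prof (mset c) (a + 1) + 1"
      using b unfolding 2 addable_def by simp
    with 2 show "\<bar>prof (mset c) (a + 1) + (if b = a + 1 then 2 else 0) - (prof (mset c) a + (if b = a then 2 else 0))\<bar> = 1"
      by simp
  qed (use IH in simp)
qed

text \<open>The slopes of the profile go from \<open>-1\<close> to \<open>1\<close>, so there is one more local minimum than
  there are local maxima.\<close>

lemma card_addable_removable:
  assumes "grows {#} c"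
  shows "card {a. addable (mset c) a} = card {a. removable (mset c) a} + 1"
proof -
  let ?M = "mset c"
  define s where "s a = prof ?M (a + 1) - prof ?M a" for a
  have s1: "\<bar>s a\<bar> = 1" for a using prof_step[OF assms] by (simp add: s_def)
  have add: "addable ?M a \<longleftrightarrow> s (a - 1) = -1 \<and> s a = 1" for a by (auto simp: addable_def s_def)
  have rem: "removable ?M a \<longleftrightarrow> s (a - 1) = 1 \<and> s a = -1" for a by (auto simp: removable_def s_def)
  \<comment> \<open>Twice the indicator of a minimum minus twice that of a maximum is the change of
    slope, so the sum over an interval telescopes.\<close>
  have step: "(if addable ?M a then 2 else 0) - (if removable ?M a then 2 else 0) = s a - s (a - 1)" for a
  proof -
    have "s a = 1 \<or> s a = -1" "s (a - 1) = 1 \<or> s (a - 1) = -1"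
      using s1[of a] s1[of "a - 1"] by linarith+
    then show ?thesis unfolding add rem by auto
  qed
  \<comment> \<open>From \<open>R\<close> outwards the profile is the absolute value, hence the
    slopes at the two ends are -1 and 1, and nothing beyond is addable or removable.\<close>
  obtain R :: nat where R: "\<And>a. a \<in># ?M \<Longrightarrow> \<bar>a\<bar> < int R"
  proof -
    have "finite ((\<lambda>a. nat \<bar>a\<bar>) ` set_mset ?M)" by simp
    then obtain R where "\<And>x. x \<in> (\<lambda>a. nat \<bar>a\<bar>) ` set_mset ?M \<Longrightarrow> x < R"
      using finite_nat_set_iff_bounded by metis
    then have "\<bar>a\<bar> < int R" if "a \<in># ?M" for a using that by fastforce
    then show thesis by (rule that)
  qed
  have p: "prof ?M a = \<bar>a\<bar>" if "\<bar>a\<bar> \<ge> int R" for a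
    using R[of a] that by (fastforce simp: prof_def not_in_iff[symmetric])
  have out: "\<not> addable ?M a \<and> \<not> removable ?M a" if "\<bar>a\<bar> > int R" for a
  proof -
    have "s a = \<bar>a + 1\<bar> - \<bar>a\<bar>" "s (a - 1) = \<bar>a\<bar> - \<bar>a - 1\<bar>"
      unfolding s_def using that p[of a] p[of "a + 1"] p[of "a - 1"] by auto
    moreover have "\<bar>a + 1\<bar> - \<bar>a\<bar> = \<bar>a\<bar> - \<bar>a - 1\<bar>" using that by arith
    ultimately show ?thesis unfolding add rem by auto
  qed
  let ?I = "{- int R..int R}"
  have tel: "(\<Sum>a\<in>{- int R..- int R + int n}. s a - s (a - 1)) = s (- int R + int n) - s (- int R - 1)" for n
  proof (induction n)
    case (Suc n)
    have "{- int R..- int R + int (Suc n)} = insert (- int R + int (Suc n)) {- int R..- int R + int n}" by auto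
    then show ?case using Suc by simp
  qed simp
  have "(\<Sum>a\<in>?I. s a - s (a - 1)) = s (int R) - s (- int R - 1)" using tel[of "2 * R"] by simp
  moreover have "s (int R) = 1" "s (- int R - 1) = -1" unfolding s_def using p by auto
  ultimately have "(\<Sum>a\<in>?I. (if addable ?M a then 2 else 0) - (if removable ?M a then 2 else 0)) = (2::int)"
    unfolding step by simp
  then have "2 * int (card {a \<in> ?I. addable ?M a}) - 2 * int (card {a \<in> ?I. removable ?M a}) = 2"
    by (simp add: sum_subtractf sum.If_cases Int_def mult.commute)
  moreover have "{a \<in> ?I. addable ?M a} = {a. addable ?M a}" "{a \<in> ?I. removable ?M a} = {a. removable ?M a}"
  proof -
    have "a \<in> ?I" if "addable ?M a \<or> removable ?M a" for a
    proof -
      have "\<not> \<bar>a\<bar> > int R" using out[of a] that by blast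
      then show ?thesis by auto
    qed
    then show "{a \<in> ?I. addable ?M a} = {a. addable ?M a}" "{a \<in> ?I. removable ?M a} = {a. removable ?M a}"
      by blast+
  qed
  ultimately show ?thesis by simp
qed

text \<open>The number of standard tableaux of the shape with contents \<open>M\<close>, usually
  written f^\<lambda>.\<close>

definition num_words :: "int multiset \<Rightarrow> nat" where
  "num_words M = card {c. grows {#} c \<and> mset c = M}"

lemma finite_words [simp]: "finite {c. grows {#} c \<and> mset c = M}"
  by (rule finite_subset[OF _ finite_V[of "size M"]]) (auto simp: cwords_def)

text \<open>The branching rule: the last letter of a word is a removable content of its
  shape.\<close>

lemma num_words_rec:
  assumes "M \<noteq> {#}"
  shows "num_words M = (\<Sum>b | removable M b. num_words (M - {#b#}))"
proof -
  have "{c. grows {#} c \<and> mset c = M} =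
      (\<Union>b\<in>{b. removable M b}. (\<lambda>c. c @ [b]) ` {c. grows {#} c \<and> mset c = M - {#b#}})" (is "?L = ?R")
  proof
    show "?L \<subseteq> ?R"
    proof
      fix c assume c: "c \<in> ?L"
      then have "c \<noteq> []" using assms by auto
      then obtain d b where d: "c = d @ [b]" by (cases c rule: rev_exhaust) auto
      have "M = add_mset b (mset d)" "addable (mset d) b" "grows {#} d"
        using c unfolding d by (auto simp: grows_append)
      then show "c \<in> ?R" unfolding d using removable_add_self[of b "mset d"] by auto
    qed
    show "?R \<subseteq> ?L"
    proof
      fix c assume "c \<in> ?R"
      then obtain b d where d: "removable M b" "grows {#} d" "mset d = M - {#b#}" "c = d @ [b]" by auto
      have M: "M = add_mset b (mset d)" using removable_in[OF d(1)] d(3) by simp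
      then have "addable (mset d) b" using d(1) removable_add_self[of b "mset d"] by simp
      then show "c \<in> ?L" unfolding d(4) using d(2) M by (simp add: grows_append)
    qed
  qed
  then have "num_words M = (\<Sum>b | removable M b. card ((\<lambda>c. c @ [b]) ` {c. grows {#} c \<and> mset c = M - {#b#}}))"
    unfolding num_words_def by (simp only:) (subst card_UN_disjoint, auto)
  also have "\<dots> = (\<Sum>b | removable M b. num_words (M - {#b#}))"
    unfolding num_words_def by (intro sum.cong refl card_image) (simp add: inj_on_def)
  finally show ?thesis .
qed

text \<open>Corners at distance at least two do not interact, and a neighbour of \<open>a\<close>
  lies below the new peak at \<open>a\<close>, so it is no peak.\<close>

lemma add_rem_commute:
  assumes "addable M a"
  shows "removable (add_mset a M) b \<and> b \<noteq> a \<longleftrightarrow> removable M b \<and> \<bar>a - b\<bar> \<ge> 2"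
proof (cases "\<bar>a - b\<bar> \<ge> 2")
  case True
  then show ?thesis using removable_add_far by auto
next
  case False
  have "\<not> removable (add_mset a M) b" if "b \<noteq> a"
  proof
    assume r: "removable (add_mset a M) b"
    have "b = a + 1 \<or> b = a - 1" using False that by arith
    then show False
    proof (elim disjE)
      assume 1: "b = a + 1"
      have "prof M a + 2 = prof M (a + 1) - 1" using r unfolding 1 removable_def prof_add by simp
      then show False using assms unfolding addable_def by simp
    next
      assume 2: "b = a - 1"
      have "prof M a + 2 = prof M (a - 1) - 1" using r unfolding 2 removable_def prof_add by simp
      then show False using assms unfolding addable_def by simp
    qed
  qed
  then show ?thesis using False by auto
qed

lemma rem_add_commute:
  assumes "removable M b"
  shows "addable (M - {#b#}) a \<and> a \<noteq> b \<longleftrightarrow> addable M a \<and> \<bar>a - b\<bar> \<ge> 2"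
proof -
  define N where "N = M - {#b#}"
  have M: "M = add_mset b N" using removable_in[OF assms] by (simp add: N_def)
  have b: "addable N b" using assms unfolding M removable_add_self .
  show ?thesis unfolding N_def[symmetric] unfolding M
  proof (cases "\<bar>a - b\<bar> \<ge> 2")
    case True
    then have "\<bar>b - a\<bar> \<ge> 2" by arith
    then have "addable (add_mset b N) a \<longleftrightarrow> addable N a" by (rule addable_add_far)
    then show "addable N a \<and> a \<noteq> b \<longleftrightarrow> addable (add_mset b N) a \<and> \<bar>a - b\<bar> \<ge> 2" using True by auto
  next
    case False
    have "\<not> addable N a" if "a \<noteq> b"
    proof -
      have "\<bar>b - a\<bar> = 1" using False that by arith
      then show ?thesis by (rule not_addable_neighbour[OF b])
    qed
    then show "addable N a \<and> a \<noteq> b \<longleftrightarrow> addable (add_mset b N) a \<and> \<bar>a - b\<bar> \<ge> 2" using False by auto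
  qed
qed

text \<open>The relation DU = UD + 1 of Young's lattice: adding a box and removing a different one
  may be done in either order, and the remaining terms count addable against removable corners, of
  which there is one more addable. The induction descends to the diagrams with one box less.\<close>

lemma sum_nw_up:
  assumes "grows {#} c"
  shows "(\<Sum>a | addable (mset c) a. num_words (add_mset a (mset c))) = (length c + 1) * num_words (mset c)"
  using assms
proof (induction "length c" arbitrary: c rule: less_induct)
  case less
  let ?M = "mset c"
  let ?A = "{a. addable ?M a}" and ?R = "{b. removable ?M b}"
  let ?X = "\<Sum>a\<in>?A. \<Sum>b | removable ?M b \<and> \<bar>a - b\<bar> \<ge> 2. num_words (add_mset a ?M - {#b#})"
  \<comment> \<open>Branching at the shape enlarged by \<open>a\<close>: removing \<open>a\<close>
    again returns \<open>?M\<close>, and the other removable contents are those of \<open>?M\<close>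
    far from \<open>a\<close>.\<close>
  have up: "num_words (add_mset a ?M) = num_words ?M + (\<Sum>b | removable ?M b \<and> \<bar>a - b\<bar> \<ge> 2. num_words (add_mset a ?M - {#b#}))"
    if "a \<in> ?A" for a
  proof -
    have "{b. removable (add_mset a ?M) b} = insert a {b. removable (add_mset a ?M) b \<and> b \<noteq> a}"
      using that by (auto simp: removable_add_self)
    also have "{b. removable (add_mset a ?M) b \<and> b \<noteq> a} = {b. removable ?M b \<and> \<bar>a - b\<bar> \<ge> 2}"
      using add_rem_commute[of ?M a] that by blast
    finally show ?thesis unfolding num_words_rec[of "add_mset a ?M", simplified] by simp
  qed
  \<comment> \<open>The induction hypothesis for \<open>?M - {#b#}\<close>: adding \<open>b\<close>
    back returns \<open>?M\<close>, and the other addable contents are those of \<open>?M\<close>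
    far from \<open>b\<close>.\<close>
  have down: "length c * num_words (?M - {#b#}) = num_words ?M + (\<Sum>a | addable ?M a \<and> \<bar>a - b\<bar> \<ge> 2. num_words (add_mset a ?M - {#b#}))"
    if "b \<in> ?R" for b
  proof -
    have b: "removable ?M b" using that by simp
    obtain d where d: "grows {#} d" "mset d = ?M - {#b#}" by (rule bubble_valid[OF less.prems b])
    have M: "?M = add_mset b (mset d)" using d removable_in[OF b] by simp
    have len: "length c = length d + 1" using arg_cong[OF M, of size] by simp
    have bd: "addable (mset d) b" using b unfolding M removable_add_self .
    have "length c * num_words (?M - {#b#}) = (\<Sum>a | addable (mset d) a. num_words (add_mset a (mset d)))"
      using less.hyps[of d] d len by simp
    also have "{a. addable (mset d) a} = insert b {a. addable (mset d) a \<and> a \<noteq> b}" using bd by auto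
    also have "{a. addable (mset d) a \<and> a \<noteq> b} = {a. addable ?M a \<and> \<bar>a - b\<bar> \<ge> 2}"
      using rem_add_commute[OF b] unfolding d(2) by blast
    also have "(\<Sum>a\<in>insert b {a. addable ?M a \<and> \<bar>a - b\<bar> \<ge> 2}. num_words (add_mset a (mset d))) =
        num_words (add_mset b (mset d)) + (\<Sum>a | addable ?M a \<and> \<bar>a - b\<bar> \<ge> 2. num_words (add_mset a (mset d)))"
      by simp
    also have "add_mset b (mset d) = ?M" using M by simp
    also have "(\<Sum>a | addable ?M a \<and> \<bar>a - b\<bar> \<ge> 2. num_words (add_mset a (mset d))) =
        (\<Sum>a | addable ?M a \<and> \<bar>a - b\<bar> \<ge> 2. num_words (add_mset a ?M - {#b#}))"
      using M by (intro sum.cong refl) simp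
    finally show ?thesis .
  qed
  have "?X = (\<Sum>b\<in>?R. \<Sum>a | addable ?M a \<and> \<bar>a - b\<bar> \<ge> 2. num_words (add_mset a ?M - {#b#}))"
    using sum.swap_restrict[of ?A ?R "\<lambda>a b. num_words (add_mset a ?M - {#b#})" "\<lambda>a b. \<bar>a - b\<bar> \<ge> 2"]
    by simp
  then have "?X + card ?R * num_words ?M = (\<Sum>b\<in>?R. length c * num_words (?M - {#b#}))"
    using down by (simp add: sum.distrib)
  also have "\<dots> = length c * num_words ?M"
  proof (cases "c = []")
    case False
    then show ?thesis using num_words_rec[of ?M] by (simp add: sum_distrib_left)
  qed simp
  finally have X: "?X + card ?R * num_words ?M = length c * num_words ?M" .
  have "(\<Sum>a\<in>?A. num_words (add_mset a ?M)) = card ?A * num_words ?M + ?X"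
    using up by (simp add: sum.distrib)
  also have "\<dots> = (length c + 1) * num_words ?M"
    unfolding card_addable_removable[OF less.prems] using X by (simp add: algebra_simps)
  finally show ?case .
qed

text \<open>Summed over words, f^\<lambda> counts each shape f^\<lambda> times, so this is the
  identity that the squares of the f^\<lambda> add up to \<open>r!\<close>.\<close>

lemma sum_nw: "(\<Sum>c\<in>cwords r. num_words (mset c)) = fact r"
proof (induction r)
  case 0
  have "{c. c = []} = {[] :: int list}" by auto
  then show ?case by (simp add: cwords_zero num_words_def cong: conj_cong)
next
  case (Suc r)
  have "(\<Sum>c\<in>cwords (Suc r). num_words (mset c)) =
      (\<Sum>c\<in>cwords r. \<Sum>d\<in>(\<lambda>a. c @ [a]) ` {a. addable (mset c) a}. num_words (mset d))"
    unfolding cwords_Suc by (rule sum.UNION_disjoint) auto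
  also have "\<dots> = (\<Sum>c\<in>cwords r. \<Sum>a | addable (mset c) a. num_words (add_mset a (mset c)))"
    by (intro sum.cong refl, subst sum.reindex) (auto simp: inj_on_def)
  also have "\<dots> = (\<Sum>c\<in>cwords r. (r + 1) * num_words (mset c))"
    by (intro sum.cong refl) (use sum_nw_up in \<open>simp add: cwords_def\<close>)
  also have "\<dots> = fact (Suc r)"
    unfolding sum_distrib_left[symmetric] Suc by simp
  finally show ?case .
qed

definition word_pairs :: "nat \<Rightarrow> (int list \<times> int list) set" where
  "word_pairs r = {(c, d). c \<in> cwords r \<and> d \<in> cwords r \<and> mset c = mset d}"

lemma finite_word_pairs [simp]: "finite (word_pairs r)"
  by (rule finite_subset[of _ "cwords r \<times> cwords r"]) (auto simp: word_pairs_def)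

lemma card_word_pairs: "card (word_pairs r) = fact r"
proof -
  have "word_pairs r = (SIGMA c:cwords r. {d. grows {#} d \<and> mset d = mset c})"
    unfolding word_pairs_def cwords_def by (auto dest: mset_eq_length)
  then show ?thesis using sum_nw[of r] by (simp add: num_words_def)
qed

section \<open>Faithfulness of the orthogonal form by counting dimensions\<close>

interpretation galg_vs: vector_space gscale
  by unfold_locales (auto simp: gscale_def fun_eq_iff algebra_simps)

lemma sum_fun_apply: "(\<Sum>i\<in>A. f i) x = (\<Sum>i\<in>A. (f i x :: complex))"
  by (induction A rule: infinite_finite_induct) auto

text \<open>Elements with dual functionals are independent. There are as many as the dimension of
  the group algebra, so they form a basis and the functionals are the coordinates.\<close>

lemma dual_basis_expand:
  fixes Q :: "'q set" and X :: "'q \<Rightarrow> galg" and \<phi> :: "'q \<Rightarrow> galg \<Rightarrow> complex"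
  assumes fin: "finite Q" and card: "card Q = card (perms r)"
    and X: "\<And>q. q \<in> Q \<Longrightarrow> X q \<in> galg r"
    and dual: "\<And>p q. p \<in> Q \<Longrightarrow> q \<in> Q \<Longrightarrow> \<phi> p (X q) = (if p = q then 1 else 0)"
    and lin: "\<And>p k l x y. p \<in> Q \<Longrightarrow> \<phi> p (\<lambda>\<pi>. k * x \<pi> + l * y \<pi>) = k * \<phi> p x + l * \<phi> p y"
    and x: "x \<in> galg r"
  shows "x = (\<lambda>\<pi>. \<Sum>q\<in>Q. \<phi> q x * X q \<pi>)"
proof -
  have \<phi>_zero: "\<phi> p (\<lambda>_. 0) = 0" if "p \<in> Q" for p
    using lin[OF that, of 0 "\<lambda>_. 0" 0 "\<lambda>_. 0"] by simp
  have \<phi>_sum: "\<phi> p (\<lambda>\<pi>. \<Sum>i\<in>A. k i * f i \<pi>) = (\<Sum>i\<in>A. k i * \<phi> p (f i))"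
    if p: "p \<in> Q" and "finite A" for p k and f :: "'q \<Rightarrow> galg" and A
    using that(2)
  proof induction
    case empty
    show ?case using \<phi>_zero[OF p] by simp
  next
    case (insert i A)
    then show ?case using lin[OF p, of "k i" "f i" 1 "\<lambda>\<pi>. \<Sum>i\<in>A. k i * f i \<pi>"] by simp
  qed
  have \<phi>_comb: "\<phi> p (\<lambda>\<pi>. \<Sum>q\<in>Q. k q * X q \<pi>) = k p" if p: "p \<in> Q" for p k
  proof -
    have "\<phi> p (\<lambda>\<pi>. \<Sum>q\<in>Q. k q * X q \<pi>) = (\<Sum>q\<in>Q. if q = p then k p else 0)"
      unfolding \<phi>_sum[OF p fin] by (intro sum.cong refl) (auto simp: dual p)
    then show ?thesis using p fin by simp
  qed
  \<comment> \<open>The remainder of the expansion is killed by every functional. If nonzero, it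
    would enlarge the independent family beyond the size of the spanning set \<open>gbasis\<close>
    applied to \<open>perms r\<close>.\<close>
  define y where "y = (\<lambda>\<pi>. 1 * x \<pi> + (-1) * (\<Sum>q\<in>Q. \<phi> q x * X q \<pi>))"
  have \<phi>_y: "\<phi> p y = 0" if "p \<in> Q" for p
    unfolding y_def lin[OF that] \<phi>_comb[OF that] by simp
  have inj: "inj_on X Q"
  proof (rule inj_onI)
    fix p q assume pq: "p \<in> Q" "q \<in> Q" "X p = X q"
    then show "p = q" using dual[OF pq(1,1)] dual[OF pq(1,2)] by (auto split: if_splits)
  qed
  have comb: "\<exists>k. v = (\<lambda>\<pi>. \<Sum>q\<in>Q. k q * X q \<pi>)" if v: "v \<in> galg_vs.span (X ` Q)" for v
  proof -
    obtain u where "v = (\<Sum>w\<in>X ` Q. gscale (u w) w)"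
      using v galg_vs.span_finite[of "X ` Q"] fin by auto
    then have "v = (\<Sum>q\<in>Q. gscale (u (X q)) (X q))" by (simp add: sum.reindex[OF inj])
    then have "v = (\<lambda>\<pi>. \<Sum>q\<in>Q. u (X q) * X q \<pi>)" by (auto simp: fun_eq_iff sum_fun_apply gscale_def)
    then show ?thesis by (rule exI[of _ "\<lambda>q. u (X q)"])
  qed
  have indep: "galg_vs.independent (X ` Q)"
  proof (rule galg_vs.independent_if_scalars_zero)
    show "finite (X ` Q)" using fin by simp
    fix u w assume u: "(\<Sum>w\<in>X ` Q. gscale (u w) w) = 0" and w: "w \<in> X ` Q"
    obtain p where p: "p \<in> Q" "w = X p" using w by blast
    have "(\<Sum>q\<in>Q. gscale (u (X q)) (X q)) = 0" using u by (simp add: sum.reindex[OF inj])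
    then have "(\<lambda>\<pi>. \<Sum>q\<in>Q. u (X q) * X q \<pi>) = (\<lambda>_. 0)"
      by (auto simp: fun_eq_iff sum_fun_apply gscale_def)
    then show "u w = 0" using \<phi>_comb[OF p(1), of "\<lambda>q. u (X q)"] \<phi>_zero[OF p(1)] p(2) by simp
  qed
  have gal_span: "v \<in> galg_vs.span (gbasis ` perms r)" if "v \<in> galg r" for v
  proof -
    have "v = (\<Sum>\<sigma>\<in>perms r. gscale (v \<sigma>) (gbasis \<sigma>))"
      by (subst galg_expand[OF that]) (auto simp: fun_eq_iff sum_fun_apply gscale_def)
    also have "\<dots> \<in> galg_vs.span (gbasis ` perms r)"
      by (intro galg_vs.span_sum galg_vs.span_scale galg_vs.span_base) auto
    finally show ?thesis .
  qed
  have "y = (\<lambda>_. 0)"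
  proof (rule ccontr)
    assume y0: "y \<noteq> (\<lambda>_. 0)"
    have "y \<notin> galg_vs.span (X ` Q)"
    proof
      assume "y \<in> galg_vs.span (X ` Q)"
      then obtain k where k: "y = (\<lambda>\<pi>. \<Sum>q\<in>Q. k q * X q \<pi>)" using comb by blast
      have "k p = 0" if "p \<in> Q" for p using \<phi>_y[OF that] unfolding k \<phi>_comb[OF that] .
      then show False using y0 unfolding k by simp
    qed
    then have "galg_vs.independent (insert y (X ` Q))" and ny: "y \<notin> X ` Q"
      using indep galg_vs.independent_insertI galg_vs.span_base by blast+
    moreover have "insert y (X ` Q) \<subseteq> galg_vs.span (gbasis ` perms r)"
    proof -
      have "y \<in> galg r" using x X by (auto simp: y_def galg_def)
      then show ?thesis using X gal_span by auto
    qed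
    ultimately have "card (insert y (X ` Q)) \<le> card (gbasis ` perms r)"
      using galg_vs.independent_span_bound[of "gbasis ` perms r"] by auto
    also have "\<dots> \<le> card (perms r)" by (rule card_image_le) simp
    finally show False using ny fin card card_image[OF inj] by simp
  qed
  then show ?thesis by (auto simp: y_def fun_eq_iff)
qed

text \<open>By the dimension count, preimages of the matrix units form a basis of the group algebra,
  with the matrix entries as coordinates.\<close>

lemma matel_inj:
  assumes "x \<in> galg r" "y \<in> galg r"
    and eq: "\<And>c d. c \<in> cwords r \<Longrightarrow> d \<in> cwords r \<Longrightarrow> matel r x c d = matel r y c d"
  shows "x = y"
proof -
  define X where "X q = (SOME x. mat_unit r x (fst q) (snd q))" for q
  have X: "mat_unit r (X q) (fst q) (snd q)" if "q \<in> word_pairs r" for q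
  proof -
    have "\<exists>x. mat_unit r x (fst q) (snd q)"
      by (rule ex_unit) (use that in \<open>auto simp: word_pairs_def\<close>)
    then show ?thesis unfolding X_def by (rule someI_ex)
  qed
  have expand: "x = (\<lambda>\<pi>. \<Sum>q\<in>word_pairs r. matel r x (fst q) (snd q) * X q \<pi>)" if "x \<in> galg r" for x
  proof (rule dual_basis_expand)
    show "card (word_pairs r) = card (perms r)" by (simp add: card_word_pairs card_perms)
    fix p k l and x y :: galg
    show "matel r (\<lambda>\<pi>. k * x \<pi> + l * y \<pi>) (fst p) (snd p) = k * matel r x (fst p) (snd p) + l * matel r y (fst p) (snd p)"
      using matel_add[of r "gscale k x" "gscale l y"] by (simp add: matel_gscale) (simp add: gscale_def)
  next
    fix p q assume "p \<in> word_pairs r" "q \<in> word_pairs r"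
    then show "matel r (X q) (fst p) (snd p) = (if p = q then 1 else 0)"
      using X[of q] by (auto simp: mat_unit_def word_pairs_def prod_eq_iff)
  qed (use X that in \<open>auto simp: mat_unit_def\<close>)
  have "(\<lambda>\<pi>. \<Sum>q\<in>word_pairs r. matel r x (fst q) (snd q) * X q \<pi>) = (\<lambda>\<pi>. \<Sum>q\<in>word_pairs r. matel r y (fst q) (snd q) * X q \<pi>)"
    by (intro ext sum.cong refl) (auto simp: word_pairs_def eq)
  then show ?thesis using expand[OF assms(1)] expand[OF assms(2)] by simp
qed

subsection \<open>Seminormal idempotents and irreducible characters\<close>

lemma matel_jm_left:
  assumes "1 \<le> k" "k \<le> r" "a \<in> cwords r" "b \<in> cwords r"
  shows "matel r (gmul r (jm k) x) a b = of_int (a ! (k - 1)) * matel r x a b"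
  unfolding matel_gmul[OF assms(3,4)]
  by (subst sum_delta2[of _ a]) (use assms in \<open>auto simp: matel_jm delta_word_def\<close>)

lemma matel_jm_right:
  assumes "1 \<le> k" "k \<le> r" "a \<in> cwords r" "b \<in> cwords r"
  shows "matel r (gmul r x (jm k)) a b = of_int (b ! (k - 1)) * matel r x a b"
  unfolding matel_gmul[OF assms(3,4)]
  by (subst sum_delta2[of _ b]) (use assms in \<open>auto simp: matel_jm delta_word_def\<close>)

text \<open>The predicate under the THE of \<open>seminormal\<close>, with the contents read off a
  word instead of a tableau.\<close>

definition seminormal_idem :: "nat \<Rightarrow> int list \<Rightarrow> galg \<Rightarrow> bool" where
  "seminormal_idem r c e \<longleftrightarrow> e \<in> galg r \<and> e \<noteq> (\<lambda>_. 0) \<and> gmul r e e = e \<and>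
     (\<forall>k\<in>{1..r}. gmul r (jm k) e = gscale (of_int (c ! (k - 1))) e \<and>
                  gmul r e (jm k) = gscale (of_int (c ! (k - 1))) e)"

lemma matel_zero: "matel r (\<lambda>_. 0) c d = 0"
  by (simp add: matel_def gext_def)

lemma mat_unit_idem:
  assumes c: "c \<in> cwords r" and e: "mat_unit r e c c"
  shows "seminormal_idem r c e"
  unfolding seminormal_idem_def
proof (intro conjI ballI)
  have eg: "e \<in> galg r" and Fe: "\<And>a b. a \<in> cwords r \<Longrightarrow> b \<in> cwords r \<Longrightarrow> matel r e a b = (if a = c \<and> b = c then 1 else 0)"
    using e by (auto simp: mat_unit_def)
  show "e \<in> galg r" by (rule eg)
  show "e \<noteq> (\<lambda>_. 0)"
  proof
    assume "e = (\<lambda>_. 0)"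
    then show False using Fe[OF c c] by (simp add: matel_zero)
  qed
  show "gmul r e e = e"
  proof (rule matel_inj)
    fix a b assume ab: "a \<in> cwords r" "b \<in> cwords r"
    show "matel r (gmul r e e) a b = matel r e a b"
      unfolding matel_gmul[OF ab] by (subst sum_delta2[of _ c]) (use c ab Fe in auto)
  qed (simp_all add: eg)
  fix k assume k: "k \<in> {1..r}"
  show "gmul r (jm k) e = gscale (of_int (c ! (k - 1))) e"
    by (rule matel_inj[where r = r]) (use k eg Fe in \<open>auto simp: matel_jm_left matel_gscale\<close>)
  show "gmul r e (jm k) = gscale (of_int (c ! (k - 1))) e"
    by (rule matel_inj[where r = r]) (use k eg Fe in \<open>auto simp: matel_jm_right matel_gscale\<close>)
qed

text \<open>The left eigenvalue equations kill all rows but that of \<open>c\<close>, the right ones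
  all columns but that of \<open>c\<close>, because a word is determined by its letters. Idempotency
  makes the one remaining entry 0 or 1, and 0 would make \<open>e\<close> zero by
  faithfulness.\<close>

lemma idem_mat_unit:
  assumes c: "c \<in> cwords r" and e: "seminormal_idem r c e"
  shows "mat_unit r e c c"
proof -
  have eg: "e \<in> galg r" and ne: "e \<noteq> (\<lambda>_. 0)" and ee: "gmul r e e = e"
    and jl: "\<And>k. 1 \<le> k \<Longrightarrow> k \<le> r \<Longrightarrow> gmul r (jm k) e = gscale (of_int (c ! (k - 1))) e"
    and jr: "\<And>k. 1 \<le> k \<Longrightarrow> k \<le> r \<Longrightarrow> gmul r e (jm k) = gscale (of_int (c ! (k - 1))) e"
    using e by (auto simp: seminormal_idem_def)
  have eq: "a = c \<and> b = c" if ab: "a \<in> cwords r" "b \<in> cwords r" and matel: "matel r e a b \<noteq> 0" for a b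
  proof -
    have "a ! k = c ! k \<and> b ! k = c ! k" if k: "k < r" for k
    proof -
      have k': "1 \<le> Suc k" "Suc k \<le> r" using k by auto
      have "of_int (a ! k) = (of_int (c ! k) :: complex)"
        using matel_jm_left[OF k' ab, of e] matel unfolding jl[OF k'] matel_gscale by simp
      moreover have "of_int (b ! k) = (of_int (c ! k) :: complex)"
        using matel_jm_right[OF k' ab, of e] matel unfolding jr[OF k'] matel_gscale by simp
      ultimately show ?thesis unfolding of_int_eq_iff by blast
    qed
    then show ?thesis using cwords_length[OF ab(1)] cwords_length[OF ab(2)] cwords_length[OF c]
      by (metis nth_equalityI)
  qed
  have zero: "matel r e a b = 0" if "a \<in> cwords r" "b \<in> cwords r" "a \<noteq> c \<or> b \<noteq> c" for a b
    using eq[OF that(1,2)] that(3) by blast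
  have "matel r e c c \<noteq> 0"
  proof
    assume z: "matel r e c c = 0"
    have "e = (\<lambda>_. 0)"
    proof (rule matel_inj[OF eg])
      fix a b assume "a \<in> cwords r" "b \<in> cwords r"
      then show "matel r e a b = matel r (\<lambda>_. 0) a b"
        using zero[of a b] z unfolding matel_zero by (cases "a = c \<and> b = c") blast+
    qed (simp add: galg_def)
    then show False using ne by blast
  qed
  moreover have "matel r e c c = matel r e c c * matel r e c c"
  proof -
    have "matel r (gmul r e e) c c = (\<Sum>b\<in>cwords r. matel r e c b * matel r e b c)"
      by (rule matel_gmul[OF c c])
    also have "\<dots> = matel r e c c * matel r e c c"
      by (rule sum_delta2[OF finite_V c]) (simp add: zero[OF c])
    finally show ?thesis unfolding ee .
  qed
  ultimately have "matel r e c c = 1" by simp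
  then show ?thesis unfolding mat_unit_def using eg zero by (intro conjI ballI) auto
qed

lemma mat_unit_unique: "mat_unit r x c d \<Longrightarrow> mat_unit r y c d \<Longrightarrow> x = y"
  by (rule matel_inj) (auto simp: mat_unit_def)

lemma gstar_jm:
  assumes "1 \<le> k" "k \<le> r"
  shows "gstar r (jm k) = jm k"
proof
  fix \<pi>
  show "gstar r (jm k) \<pi> = jm k \<pi>"
  proof (cases "\<pi> \<in> perms r")
    case True
    have t: "inv (transpose i k) = transpose i k" for i by simp
    have "inv \<pi> = transpose i k \<longleftrightarrow> \<pi> = transpose i k" for i
    proof
      assume "inv \<pi> = transpose i k"
      then have "inv (inv \<pi>) = inv (transpose i k)" by (rule arg_cong)
      then show "\<pi> = transpose i k" unfolding perms_inv_inv[OF True] t .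
    qed (simp only: t)
    then show ?thesis using True by (simp add: gstar_def jm_def)
  next
    case False
    then show ?thesis using jm_galg[OF assms] by (simp add: gstar_def galg_def)
  qed
qed

text \<open>Transpositions are involutions, so \<open>gstar\<close> fixes the Jucys-Murphy elements
  and merely exchanges the left and right eigenvalue equations. Uniqueness of the idempotent gives
  the claim.\<close>

lemma gstar_mat_unit:
  assumes c: "c \<in> cwords r" and e: "mat_unit r e c c"
  shows "gstar r e = e"
proof -
  have s: "seminormal_idem r c e" by (rule mat_unit_idem[OF c e])
  have eg: "e \<in> galg r" using e by (simp add: mat_unit_def)
  have "seminormal_idem r c (gstar r e)"
    unfolding seminormal_idem_def
  proof (intro conjI ballI)
    show "gstar r e \<in> galg r" by simp
    show "gstar r e \<noteq> (\<lambda>_. 0)"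
    proof
      assume "gstar r e = (\<lambda>_. 0)"
      then have "e = gstar r (\<lambda>_. 0)" using gstar_gstar[OF eg] by simp
      then show False using s by (simp add: seminormal_idem_def gstar_def)
    qed
    show "gmul r (gstar r e) (gstar r e) = gstar r e"
      using s gstar_gmul[of r e e] by (simp add: seminormal_idem_def)
    fix k assume k: "k \<in> {1..r}"
    then have "gmul r e (jm k) = gscale (of_int (c ! (k - 1))) e"
      "gmul r (jm k) e = gscale (of_int (c ! (k - 1))) e"
      using s by (simp_all add: seminormal_idem_def)
    then show "gmul r (jm k) (gstar r e) = gscale (of_int (c ! (k - 1))) (gstar r e)"
      "gmul r (gstar r e) (jm k) = gscale (of_int (c ! (k - 1))) (gstar r e)"
      using gstar_gmul[of r e "jm k"] gstar_gmul[of r "jm k" e] gstar_jm[of k r] k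
      by (simp_all add: gstar_gscale)
  qed
  then show ?thesis using mat_unit_unique[OF idem_mat_unit[OF c] e] by blast
qed

lemma gmul_mat_unit:
  assumes "mat_unit r x c d" "mat_unit r y d c" "c \<in> cwords r" "d \<in> cwords r"
  shows "mat_unit r (gmul r x y) c c"
  unfolding mat_unit_def
proof (intro conjI ballI)
  fix a b assume ab: "a \<in> cwords r" "b \<in> cwords r"
  show "matel r (gmul r x y) a b = (if a = c \<and> b = c then 1 else 0)"
    unfolding matel_gmul[OF ab] by (subst sum_delta2[of _ d]) (use assms ab in \<open>auto simp: mat_unit_def\<close>)
qed simp

text \<open>E_cc = E_cd E_dc and E_dd = E_dc E_cd, so the trace property of \<open>gconj\<close>
  applies.\<close>

lemma gconj_mat_unit:
  assumes "c \<in> cwords r" "d \<in> cwords r" "mset c = mset d" "mat_unit r e c c" "mat_unit r f d d"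
  shows "gconj r e = gconj r f"
proof -
  obtain x where x: "mat_unit r x c d" using ex_unit[OF assms(1-3)] by blast
  obtain y where y: "mat_unit r y d c" using ex_unit[OF assms(2,1) assms(3)[symmetric]] by blast
  have "e = gmul r x y"
    by (rule mat_unit_unique[OF assms(4) gmul_mat_unit[OF x y assms(1,2)]])
  moreover have "f = gmul r y x"
    by (rule mat_unit_unique[OF assms(5) gmul_mat_unit[OF y x assms(2,1)]])
  ultimately show ?thesis by (simp only: gconj_gmul_commute[of r x y])
qed

section \<open>From standard tableaux to content words\<close>

definition content_word :: "nat list \<Rightarrow> (nat \<times> nat \<Rightarrow> nat) \<Rightarrow> int list" where
  "content_word lam T = map (content lam T) [1..<sum_list lam + 1]"

lemma finite_boxes: "finite (boxes lam)"
proof -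
  have "boxes lam = (SIGMA i:{..<length lam}. {..<lam ! i})" by (auto simp: boxes_def)
  then show ?thesis by simp
qed

lemma content_box:
  assumes "is_syt lam T" "b \<in> boxes lam"
  shows "content lam T (T b) = int (snd b) - int (fst b)"
proof -
  have inj: "inj_on T (boxes lam)" using assms(1) by (auto simp: is_syt_def bij_betw_def)
  have "(THE b'. b' \<in> boxes lam \<and> T b' = T b) = b"
    by (rule the_equality) (use assms(2) inj_onD[OF inj] in blast)+
  then show ?thesis by (simp add: content_def Let_def)
qed

lemma mset_content_upto:
  assumes T: "is_syt lam T" and k: "k \<le> sum_list lam"
  shows "mset (map (content lam T) [1..<k + 1]) =
    image_mset (\<lambda>b. int (snd b) - int (fst b)) (mset_set {b \<in> boxes lam. T b \<le> k})"
proof -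
  have bij: "bij_betw T (boxes lam) {1..sum_list lam}" using T by (simp add: is_syt_def)
  let ?B = "{b \<in> boxes lam. T b \<le> k}"
  have inj: "inj_on T ?B" using bij by (auto simp: bij_betw_def inj_on_def)
  have im: "T ` boxes lam = {1..sum_list lam}" using bij by (simp add: bij_betw_def)
  have "T ` ?B = {1..<k + 1}"
  proof
    show "T ` ?B \<subseteq> {1..<k + 1}"
    proof
      fix x assume "x \<in> T ` ?B"
      then obtain b where b: "b \<in> boxes lam" "T b \<le> k" "x = T b" by blast
      then have "T b \<in> {1..sum_list lam}" using im by blast
      then show "x \<in> {1..<k + 1}" using b by simp
    qed
    show "{1..<k + 1} \<subseteq> T ` ?B"
    proof
      fix x assume x: "x \<in> {1..<k + 1}"
      then have "x \<in> T ` boxes lam" unfolding im using k by simp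
      then show "x \<in> T ` ?B" using x by auto
    qed
  qed
  then have m: "mset_set {1..<k + 1} = image_mset T (mset_set ?B)"
    using image_mset_mset_set[OF inj] by simp
  have "mset (map (content lam T) [1..<k + 1]) = image_mset (content lam T) (mset_set {1..<k + 1})"
    unfolding mset_map mset_upt ..
  also have "\<dots> = image_mset (\<lambda>b. content lam T (T b)) (mset_set ?B)"
    unfolding m by (simp add: multiset.map_comp comp_def)
  also have "\<dots> = image_mset (\<lambda>b. int (snd b) - int (fst b)) (mset_set ?B)"
    by (rule image_mset_cong) (use finite_boxes content_box[OF T] in auto)
  finally show ?thesis .
qed

lemma mset_content_word:
  assumes "is_syt lam T" "is_syt lam T'"
  shows "mset (content_word lam T) = mset (content_word lam T')"
proof -
  have B: "{b \<in> boxes lam. T b \<le> sum_list lam} = boxes lam" if "is_syt lam T" for T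
    using that by (auto simp: is_syt_def bij_betw_def)
  show ?thesis
    unfolding content_word_def mset_content_upto[OF assms(1) order_refl] mset_content_upto[OF assms(2) order_refl]
      B[OF assms(1)] B[OF assms(2)] ..
qed

definition down_closed :: "(nat \<times> nat) set \<Rightarrow> bool" where
  "down_closed B \<longleftrightarrow> (\<forall>i j. (Suc i, j) \<in> B \<longrightarrow> (i, j) \<in> B) \<and> (\<forall>i j. (i, Suc j) \<in> B \<longrightarrow> (i, j) \<in> B)"

lemma down_closedD:
  assumes "down_closed B"
  shows "(Suc i, j) \<in> B \<Longrightarrow> (i, j) \<in> B" "(i, Suc j) \<in> B \<Longrightarrow> (i, j) \<in> B"
  using assms unfolding down_closed_def by blast+

lemma down_closed_le:
  assumes B: "down_closed B" and "(i, j) \<in> B" "i' \<le> i" "j' \<le> j"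
  shows "(i', j') \<in> B"
proof -
  have "(i', j) \<in> B"
    using assms(3,2) by (induction rule: inc_induct) (blast intro: down_closedD[OF B])+
  show ?thesis
    using assms(4) \<open>(i', j) \<in> B\<close> by (induction rule: inc_induct) (blast intro: down_closedD[OF B])+
qed

text \<open>The profile at a content \<open>a\<close> is \<open>i + j\<close> for the first box \<open>(i, j)\<close> of the diagonal \<open>a\<close> lying
  outside the diagram.\<close>

lemma prof_diagram:
  assumes B: "down_closed B" "finite B" and out: "(i, j) \<notin> B"
    and ins: "\<And>i' j'. i = Suc i' \<Longrightarrow> j = Suc j' \<Longrightarrow> (i', j') \<in> B"
  shows "prof (image_mset (\<lambda>b. int (snd b) - int (fst b)) (mset_set B)) (int j - int i) = int i + int j"
proof -
  let ?D = "{b \<in> B. int (snd b) - int (fst b) = int j - int i}"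
  \<comment> \<open>The boxes of this diagonal are met by walking back from \<open>(i, j)\<close>
    until an edge is reached. There are \<open>min i j\<close> of them, and
    \<open>\<bar>j - i\<bar> + 2 * min i j\<close> is \<open>i + j\<close>.\<close>
  have "?D = (\<lambda>t. (i - Suc t, j - Suc t)) ` {..<min i j}"
  proof
    show "?D \<subseteq> (\<lambda>t. (i - Suc t, j - Suc t)) ` {..<min i j}"
    proof
      fix b assume b: "b \<in> ?D"
      obtain x y where xy: "b = (x, y)" by (cases b)
      have d: "int y - int x = int j - int i" "(x, y) \<in> B" using b unfolding xy by simp_all
      have "x < i"
      proof (rule ccontr)
        assume "\<not> x < i"
        then have "i \<le> x" "j \<le> y" using d by auto
        then show False using down_closed_le[OF B(1) d(2)] out by blast
      qed
      then have "b = (i - Suc (i - Suc x), j - Suc (i - Suc x))" "i - Suc x < min i j"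
        using d xy by auto
      then show "b \<in> (\<lambda>t. (i - Suc t, j - Suc t)) ` {..<min i j}" by blast
    qed
    show "(\<lambda>t. (i - Suc t, j - Suc t)) ` {..<min i j} \<subseteq> ?D"
    proof
      fix b assume "b \<in> (\<lambda>t. (i - Suc t, j - Suc t)) ` {..<min i j}"
      then obtain t where t: "t < i" "t < j" "b = (i - Suc t, j - Suc t)" by auto
      obtain i' j' where "i = Suc i'" "j = Suc j'" using t by (cases i; cases j) auto
      with ins have "(i - 1, j - 1) \<in> B" by simp
      then have "b \<in> B" unfolding t(3) by (rule down_closed_le[OF B(1)]) auto
      then show "b \<in> ?D" using t by auto
    qed
  qed
  moreover have "inj_on (\<lambda>t. (i - Suc t, j - Suc t)) {..<min i j}" by (auto simp: inj_on_def)
  ultimately have "card ?D = min i j" by (simp add: card_image)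
  moreover have "count (image_mset (\<lambda>b. int (snd b) - int (fst b)) (mset_set B)) (int j - int i) = card ?D"
  proof -
    have "?D = (\<lambda>b. int (snd b) - int (fst b)) -` {int j - int i} \<inter> B" by auto
    then show ?thesis using B(2) by (simp add: count_image_mset)
  qed
  ultimately show ?thesis unfolding prof_def by simp
qed

text \<open>The first outside boxes on the diagonal of \<open>(i, j)\<close> and the two adjacent
  diagonals are \<open>(i, j)\<close>, \<open>(i, Suc j)\<close> and \<open>(Suc i, j)\<close>, so
  the profile is \<open>i + j\<close> in the middle and one higher on both sides.\<close>

lemma addable_diagram:
  assumes B: "down_closed B" "finite B" and B': "down_closed (insert (i, j) B)" and out: "(i, j) \<notin> B"
  shows "addable (image_mset (\<lambda>b. int (snd b) - int (fst b)) (mset_set B)) (int j - int i)"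
proof -
  let ?p = "prof (image_mset (\<lambda>b. int (snd b) - int (fst b)) (mset_set B))"
  have mem: "(i', j') \<in> B" if "i' \<le> i" "j' \<le> j" "(i', j') \<noteq> (i, j)" for i' j'
    using down_closed_le[OF B', of i j i' j'] that by auto
  have nout: "(i', j') \<notin> B" if "i \<le> i'" "j \<le> j'" for i' j'
    using down_closed_le[OF B(1), of i' j' i j] that out by auto
  have "?p (int j - int i) = int i + int j"
    by (rule prof_diagram[OF B out]) (rule mem, auto)
  moreover have "?p (int (Suc j) - int i) = int i + int (Suc j)"
    by (rule prof_diagram[OF B]) (simp add: nout, rule mem, auto)
  moreover have "?p (int j - int (Suc i)) = int (Suc i) + int j"
    by (rule prof_diagram[OF B]) (simp add: nout, rule mem, auto)
  moreover have "int (Suc j) - int i = int j - int i + 1" "int j - int (Suc i) = int j - int i - 1" by auto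
  ultimately show ?thesis unfolding addable_def by (simp only:) simp
qed

text \<open>The boxes with entries at most \<open>k\<close> form a diagram because entries grow
  along rows and columns; the box of \<open>k + 1\<close> is addable to it.\<close>

lemma content_word_V:
  assumes lam: "is_partition r lam" and T: "is_syt lam T"
  shows "content_word lam T \<in> cwords r"
proof -
  have r: "sum_list lam = r" using lam by (simp add: is_partition_def)
  have bij: "bij_betw T (boxes lam) {1..r}"
    and row: "\<And>i j. (i, Suc j) \<in> boxes lam \<Longrightarrow> T (i, j) < T (i, Suc j)"
    and col: "\<And>i j. (Suc i, j) \<in> boxes lam \<Longrightarrow> T (i, j) < T (Suc i, j)"
    using T r by (auto simp: is_syt_def)
  have dc: "down_closed (boxes lam)"
  proof -
    have "lam ! Suc i \<le> lam ! i" if "Suc i < length lam" for i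
      using lam that unfolding is_partition_def sorted_wrt_iff_nth_less by auto
    then show ?thesis unfolding down_closed_def boxes_def by fastforce
  qed
  have dck: "down_closed {b \<in> boxes lam. T b \<le> k}" for k
    unfolding down_closed_def
  proof (intro conjI allI impI)
    fix i j assume "(Suc i, j) \<in> {b \<in> boxes lam. T b \<le> k}"
    then show "(i, j) \<in> {b \<in> boxes lam. T b \<le> k}"
      using down_closedD(1)[OF dc, of i j] col[of i j] by simp
  next
    fix i j assume "(i, Suc j) \<in> {b \<in> boxes lam. T b \<le> k}"
    then show "(i, j) \<in> {b \<in> boxes lam. T b \<le> k}"
      using down_closedD(2)[OF dc, of i j] row[of i j] by simp
  qed
  have "map (content lam T) [1..<k + 1] \<in> cwords k" if "k \<le> r" for k
    using that
  proof (induction k)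
    case 0
    show ?case by (simp add: cwords_zero)
  next
    case (Suc k)
    have "Suc k \<in> T ` boxes lam" using bij Suc.prems unfolding bij_betw_def by auto
    then obtain b where b: "b \<in> boxes lam" "T b = Suc k" by auto
    obtain i j where ij: "b = (i, j)" by (cases b)
    let ?B = "\<lambda>k. {b \<in> boxes lam. T b \<le> k}"
    have ins: "insert (i, j) (?B k) = ?B (Suc k)"
    proof (rule set_eqI)
      fix x
      have "x = (i, j)" if "x \<in> boxes lam" "T x = Suc k"
        using that b inj_onD[of T "boxes lam" x b] bij unfolding bij_betw_def ij by auto
      then show "x \<in> insert (i, j) (?B k) \<longleftrightarrow> x \<in> ?B (Suc k)"
        using b unfolding ij by (auto simp: le_Suc_eq)
    qed
    have "addable (image_mset (\<lambda>b. int (snd b) - int (fst b)) (mset_set (?B k))) (int j - int i)"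
    proof (rule addable_diagram[OF dck])
      show "down_closed (insert (i, j) (?B k))" unfolding ins by (rule dck)
    qed (use finite_boxes b ij in auto)
    then have "addable (mset (map (content lam T) [1..<k + 1])) (content lam T (Suc k))"
      using mset_content_upto[OF T, of k] content_box[OF T b(1)] b ij Suc.prems r by simp
    moreover have "map (content lam T) [1..<Suc k + 1] = map (content lam T) [1..<k + 1] @ [content lam T (Suc k)]"
      by simp
    ultimately show ?case using Suc by (simp only: cwords_snoc)
  qed
  then show ?thesis unfolding content_word_def r by blast
qed

text \<open>This resolves the THE: the preimage of the diagonal matrix unit satisfies the defining
  predicate, and nothing else does.\<close>

lemma seminormal_mat_unit:
  assumes lam: "is_partition r lam" and T: "is_syt lam T"
  shows "mat_unit r (seminormal lam T) (content_word lam T) (content_word lam T)"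
proof -
  let ?c = "content_word lam T"
  have r: "sum_list lam = r" using lam by (simp add: is_partition_def)
  have c: "?c \<in> cwords r" by (rule content_word_V[OF assms])
  have nth: "?c ! (k - 1) = content lam T k" if "k \<in> {1..r}" for k
    using that by (cases k) (simp_all add: content_word_def r del: upt_Suc)
  have P: "seminormal_idem r ?c e \<longleftrightarrow> e \<in> galg r \<and> e \<noteq> (\<lambda>_. 0) \<and> gmul r e e = e \<and>
       (\<forall>k\<in>{1..r}. gmul r (jm k) e = gscale (of_int (content lam T k)) e \<and>
                    gmul r e (jm k) = gscale (of_int (content lam T k)) e)" for e
    unfolding seminormal_idem_def using nth by simp
  obtain e where e: "mat_unit r e ?c ?c" using ex_unit_diagonal[OF c] by blast
  have "seminormal lam T = (THE e. seminormal_idem r ?c e)"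
    unfolding seminormal_def r Let_def P ..
  also have "\<dots> = e"
  proof (rule the_equality)
    show "seminormal_idem r ?c e" by (rule mat_unit_idem[OF c e])
    fix f assume "seminormal_idem r ?c f"
    then show "f = e" using idem_mat_unit[OF c] mat_unit_unique e by blast
  qed
  finally show ?thesis using e by simp
qed

lemma (in projection) ex_basis:
  assumes "\<And>k. (\<lambda>y. \<Sum>z\<in>Z. P y z * k z) \<in> U"
  shows "\<exists>bs. is_basis U bs"
proof -
  obtain zs where zs: "set zs = Z" "distinct zs" using finite_distinct_list[OF fin] by blast
  let ?bs = "map (\<lambda>z y. P y z) zs"
  have re: "lcomb ?bs (\<lambda>l. k (zs ! l)) = (\<lambda>y. \<Sum>z\<in>Z. P y z * k z)" for k
  proof
    fix y
    have "(\<Sum>z\<in>Z. P y z * k z) = (\<Sum>l<length zs. P y (zs ! l) * k (zs ! l))"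
      by (rule sum.reindex_bij_betw[symmetric]) (use zs bij_betw_nth in fastforce)
    then show "lcomb ?bs (\<lambda>l. k (zs ! l)) y = (\<Sum>z\<in>Z. P y z * k z)"
      by (simp add: lcomb_def mult.commute)
  qed
  show ?thesis
  proof (rule ex_basis_of_span[of ?bs])
    fix c :: "nat \<Rightarrow> complex"
    \<comment> \<open>The list \<open>zs\<close> is distinct, so coefficients indexed by positions
      can be read as a function on \<open>Z\<close>.\<close>
    define k where "k z = c (THE l. l < length zs \<and> zs ! l = z)" for z
    have "k (zs ! l) = c l" if "l < length zs" for l
    proof -
      have "(THE l'. l' < length zs \<and> zs ! l' = zs ! l) = l"
        using that zs(2) by (intro the_equality) (auto simp: nth_eq_iff_index_eq)
      then show ?thesis by (simp add: k_def)
    qed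
    then have "lcomb ?bs c = lcomb ?bs (\<lambda>l. k (zs ! l))" by (simp add: lcomb_def)
    then show "lcomb ?bs c \<in> U" unfolding re using assms by simp
  next
    fix u assume "u \<in> U"
    then have "u = lcomb ?bs (\<lambda>l. u (zs ! l))" unfolding re by (intro ext fixes_U)
    then show "\<exists>c. u = lcomb ?bs c" by (rule exI[of _ "\<lambda>l. u (zs ! l)"])
  qed
qed

text \<open>Right multiplication by \<open>e\<close> projects the group algebra onto the left ideal,
  so the trace is that of x \<mapsto> \<sigma> x e. Its diagonal entry at \<open>z\<close> is the
  coefficient of \<open>e\<close> at z^-1 \<sigma>^-1 z; the inverse of \<sigma> is the reason for
  \<open>gstar\<close>.\<close>

lemma trace_left_ideal:
  assumes e: "e \<in> galg r" "gmul r e e = e" and \<sigma>: "\<sigma> \<in> perms r"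
  shows "trace_on {gmul r x e | x. x \<in> galg r} (\<lambda>x. gmul r (gbasis \<sigma>) x) = gconj r (gstar r e) \<sigma>"
proof -
  let ?U = "{gmul r x e | x. x \<in> galg r}"
  let ?P = "\<lambda>y z. gmul r (gbasis z) e y"
  have comb: "gmul r (\<lambda>\<pi>. \<Sum>z\<in>perms r. k z * gbasis z \<pi>) e y = (\<Sum>z\<in>perms r. ?P y z * k z)" for k y
    unfolding gmul_sum_left by (simp add: mult.commute)
  interpret projection "perms r" ?U ?P
  proof
    fix u y assume "u \<in> ?U"
    then obtain x where "u = gmul r x e" by blast
    then have u: "u \<in> galg r" "gmul r u e = u" using e by (simp_all add: gmul_assoc)
    have "u y = gmul r (\<lambda>\<pi>. \<Sum>z\<in>perms r. u z * gbasis z \<pi>) e y"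
      using galg_expand[OF u(1)] u(2) by simp
    then show "u y = (\<Sum>z\<in>perms r. ?P y z * u z)" unfolding comb .
  qed (auto)
  have ex: "\<exists>bs. is_basis ?U bs"
  proof (rule ex_basis)
    fix k
    have "(\<lambda>\<pi>. \<Sum>z\<in>perms r. k z * gbasis z \<pi>) \<in> galg r" by (rule galg_sum) simp
    then show "(\<lambda>y. \<Sum>z\<in>perms r. ?P y z * k z) \<in> ?U" unfolding comb[symmetric] by blast
  qed
  have mul: "gmul r (gbasis \<sigma>) v z = (if z \<in> perms r then v (inv \<sigma> \<circ> z) else 0)" for v z
    unfolding gmul_eq_gext reg.gext_gbasis[OF \<sigma>] by (simp add: reg_def)
  let ?D = "\<lambda>z y. if z \<in> perms r \<and> y = inv \<sigma> \<circ> z then 1 else (0 :: complex)"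
  have f: "gmul r (gbasis \<sigma>) v z = (\<Sum>y\<in>perms r. ?D z y * v y)" for v z
  proof (cases "z \<in> perms r")
    case True
    then have "inv \<sigma> \<circ> z \<in> perms r" using \<sigma> by simp
    then show ?thesis using True unfolding mul by (subst sum_delta2[of _ "inv \<sigma> \<circ> z"]) auto
  qed (simp add: mul)
  have "trace_on ?U (\<lambda>x. gmul r (gbasis \<sigma>) x) = (\<Sum>z\<in>perms r. \<Sum>y\<in>perms r. ?D z y * ?P y z)"
  proof (rule trace_on_eq[OF ex f])
    fix u assume "u \<in> ?U"
    then obtain x where "u = gmul r x e" by blast
    then have "gmul r (gbasis \<sigma>) u = gmul r (gmul r (gbasis \<sigma>) x) e" by (simp add: gmul_assoc)
    then show "gmul r (gbasis \<sigma>) u \<in> ?U" using gmul_galg by blast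
  qed
  also have "\<dots> = (\<Sum>z\<in>perms r. gstar r e (inv z \<circ> \<sigma> \<circ> z))"
  proof (rule sum.cong[OF refl])
    fix z assume z: "z \<in> perms r"
    then have "inv \<sigma> \<circ> z \<in> perms r" using \<sigma> by simp
    then have "(\<Sum>y\<in>perms r. ?D z y * ?P y z) = ?P (inv \<sigma> \<circ> z) z"
      using z by (subst sum_delta2[of _ "inv \<sigma> \<circ> z"]) auto
    also have "\<dots> = e (inv z \<circ> (inv \<sigma> \<circ> z))"
      unfolding gmul_eq_gext reg.gext_gbasis[OF z] using z \<sigma> by (simp add: reg_def)
    also have "\<dots> = gstar r e (inv z \<circ> \<sigma> \<circ> z)"
      using z \<sigma> by (simp add: gstar_def perms_group_simps[where r = r] comp_assoc)
    finally show "(\<Sum>y\<in>perms r. ?D z y * ?P y z) = gstar r e (inv z \<circ> \<sigma> \<circ> z)" .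
  qed
  finally show ?thesis using \<sigma> by (simp add: gconj_def)
qed

text \<open>\<open>irr_char\<close> chooses its own tableau. Passing from it to \<open>T\<close>
  uses that the two content words have the same multiset.\<close>

theorem irr_char_eq_gconj:
  assumes lam: "is_partition r lam" and T: "is_syt lam T"
  shows "irr_char lam = gconj r (seminormal lam T)"
proof -
  have r: "sum_list lam = r" using lam by (simp add: is_partition_def)
  define T' where "T' = (SOME T. is_syt lam T)"
  have T': "is_syt lam T'" unfolding T'_def by (rule someI[where P = "is_syt lam", OF T])
  note c = content_word_V[OF lam T] and c' = content_word_V[OF lam T']
  note u = seminormal_mat_unit[OF lam T] and u' = seminormal_mat_unit[OF lam T']
  have e: "seminormal lam T' \<in> galg r" "gmul r (seminormal lam T') (seminormal lam T') = seminormal lam T'"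
    using mat_unit_idem[OF c' u'] by (simp_all add: seminormal_idem_def)
  have "irr_char lam = gconj r (gstar r (seminormal lam T'))"
    unfolding irr_char_def r Let_def T'_def[symmetric]
    using trace_left_ideal[OF e] by (auto simp: fun_eq_iff gconj_def)
  also have "\<dots> = gconj r (seminormal lam T')" unfolding gstar_mat_unit[OF c' u'] ..
  also have "\<dots> = gconj r (seminormal lam T)"
    by (rule gconj_mat_unit[OF c' c mset_content_word[OF T' T] u' u])
  finally show ?thesis .
qed

subsection \<open>The free supercommutative algebra\<close>

lemma sg_add: "sg (a + b) = sg a * sg b"
  by (simp add: sg_def power_add)

lemma sg_Suc: "sg (Suc a) = - sg a"
  by (simp add: sg_def)

lemma sg_sq: "sg a * sg a = 1"
  by (simp add: sg_def flip: power_mult_distrib)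

lemma sg_even: "even a \<Longrightarrow> sg a = 1"
  by (simp add: sg_def)

lemma sg_cong: "even (a + b) \<Longrightarrow> sg a = sg b"
  by (cases "even a") (auto simp: sg_def)

lemma sg_0: "sg 0 = 1" and sg_1: "sg (Suc 0) = -1"
  by (simp_all add: sg_def)

lemma ipar_cases: "ipar m i = 0 \<or> ipar m i = 1"
  by (simp add: ipar_def)

lemma gpar_cases: "gpar m g = 0 \<or> gpar m g = 1"
  by (auto simp: gpar_def)

lemma finite_submsets: "finite {N. N \<subseteq># (M :: 'a multiset)}"
proof (induction M)
  case (add x M)
  have "{N. N \<subseteq># add_mset x M} \<subseteq> {N. N \<subseteq># M} \<union> add_mset x ` {N. N \<subseteq># M}"
  proof
    fix N assume N: "N \<in> {N. N \<subseteq># add_mset x M}"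
    show "N \<in> {N. N \<subseteq># M} \<union> add_mset x ` {N. N \<subseteq># M}"
    proof (cases "x \<in># N")
      case True
      then obtain N' where "N = add_mset x N'" by (metis insert_DiffM)
      then show ?thesis using N by auto
    next
      case False
      have "count N a \<le> count M a" for a
      proof (cases "a = x")
        case True
        then show ?thesis using False by (simp add: not_in_iff)
      next
        case False
        then show ?thesis using N mset_subset_eq_count[of N "add_mset x M" a] by simp
      qed
      then have "N \<subseteq># M" by (rule mset_subset_eqI)
      then show ?thesis by simp
    qed
  qed
  then show ?case using add finite_subset by blast
qed simp

lemma smul_single:
  assumes "\<And>N. N \<noteq> N0 \<Longrightarrow> f N = 0"
  shows "smul m f g M = (if valid_mono m M \<and> N0 \<subseteq># M
    then reorder_sign m N0 (M - N0) * f N0 * g (M - N0) else 0)"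
proof (cases "N0 \<subseteq># M")
  case True
  have "(\<Sum>N\<in>{N. N \<subseteq># M}. reorder_sign m N (M - N) * f N * g (M - N)) =
      (\<Sum>N\<in>{N. N \<subseteq># M}. if N = N0 then reorder_sign m N0 (M - N0) * f N0 * g (M - N0) else 0)"
    by (intro sum.cong refl) (auto simp: assms)
  then show ?thesis using True finite_submsets[of M] by (simp add: smul_def)
next
  case False
  have "(\<Sum>N\<in>{N. N \<subseteq># M}. reorder_sign m N (M - N) * f N * g (M - N)) = 0"
    by (rule sum.neutral) (use False assms in auto)
  then show ?thesis using False by (simp add: smul_def)
qed

text \<open>The sign for sorting the generator \<open>g\<close>, standing on the left, into the
  ordered odd part of \<open>R\<close>.\<close>

definition gsign :: "nat \<Rightarrow> gen \<Rightarrow> mono \<Rightarrow> complex" where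
  "gsign m g R = sg (if gpar m g = 1 then card {b \<in> set_mset R. gpar m b = 1 \<and> b < g} else 0)"

lemma reorder_sign_single: "reorder_sign m {#g#} R = gsign m g R"
proof -
  have "{(a, b). (a, b) \<in> set_mset {#g#} \<times> set_mset R \<and> gpar m a = 1 \<and> gpar m b = 1 \<and> b < a} =
      (if gpar m g = 1 then Pair g ` {b \<in> set_mset R. gpar m b = 1 \<and> b < g} else {})"
    by auto
  then show ?thesis
    unfolding reorder_sign_def gsign_def by (simp add: card_image inj_on_def)
qed

lemma smul_sgen:
  "smul m (sgen i j) f M = (if valid_mono m M \<and> (i, j) \<in># M
    then gsign m (i, j) (M - {#(i, j)#}) * f (M - {#(i, j)#}) else 0)"
  by (subst smul_single[of "{#(i, j)#}"]) (auto simp: sgen_def reorder_sign_single)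

lemma smul_const: "smul m (sscale z sone) f M = (if valid_mono m M then z * f M else 0)"
proof -
  have "reorder_sign m {#} R = 1" for R by (simp add: reorder_sign_def sg_0)
  then show ?thesis by (subst smul_single[of "{#}"]) (auto simp: sscale_def sone_def)
qed

lemma smul_scale_right: "smul m f (sscale c g) = sscale c (smul m f g)"
  by (auto simp: fun_eq_iff smul_def sscale_def sum_distrib_left mult_ac)

lemma valid_mono_diff: "valid_mono m M \<Longrightarrow> valid_mono m (M - N)"
  unfolding valid_mono_def by (metis count_diff diff_le_self le_trans)

lemma gsign_add:
  assumes "gpar m h = 1 \<Longrightarrow> h \<notin># R"
  shows "gsign m g (add_mset h R) = sg (if gpar m g = 1 \<and> gpar m h = 1 \<and> h < g then 1 else 0) * gsign m g R"
proof (cases "gpar m g = 1 \<and> gpar m h = 1 \<and> h < g")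
  case True
  then have "{b \<in> set_mset (add_mset h R). gpar m b = 1 \<and> b < g} =
      insert h {b \<in> set_mset R. gpar m b = 1 \<and> b < g}" by auto
  moreover have "h \<notin> {b \<in> set_mset R. gpar m b = 1 \<and> b < g}" using assms True by auto
  ultimately have "card {b \<in> set_mset (add_mset h R). gpar m b = 1 \<and> b < g} =
      1 + card {b \<in> set_mset R. gpar m b = 1 \<and> b < g}" by simp
  then show ?thesis using True unfolding gsign_def by (simp add: sg_Suc sg_0)
next
  case False
  then have "gpar m g = 1 \<Longrightarrow> {b \<in> set_mset (add_mset h R). gpar m b = 1 \<and> b < g} =
      {b \<in> set_mset R. gpar m b = 1 \<and> b < g}" by auto
  then show ?thesis using False unfolding gsign_def by (auto simp: sg_0)
qed

lemma sg_flip: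
  fixes g h :: "'a :: linorder"
  assumes "g \<noteq> h" and a: "a = 0 \<or> a = 1" and b: "b = 0 \<or> b = 1"
  shows "sg (if a = 1 \<and> b = 1 \<and> h < g then 1 else 0) =
    sg (a * b) * sg (if b = 1 \<and> a = 1 \<and> g < h then 1 else 0)"
proof (cases "g < h")
  case True
  then have "\<not> h < g" by simp
  then show ?thesis using True a b by (auto simp: sg_0 sg_1)
next
  case False
  then have "h < g" using assms(1) by simp
  then show ?thesis using False a b by (auto simp: sg_0 sg_1)
qed

lemma smul_sgen2:
  "smul m (sgen i j) (smul m (sgen k l) f) M =
    (if valid_mono m M \<and> {#(i, j), (k, l)#} \<subseteq># M
     then gsign m (i, j) (M - {#(i, j)#}) *
       (gsign m (k, l) (M - {#(i, j)#} - {#(k, l)#}) * f (M - {#(i, j)#} - {#(k, l)#})) else 0)"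
proof -
  have "{#(i, j), (k, l)#} \<subseteq># M \<longleftrightarrow> (i, j) \<in># M \<and> (k, l) \<in># M - {#(i, j)#}"
    by (simp only: insert_subset_eq_iff empty_le simp_thms)
  then show ?thesis
    using valid_mono_diff[of m M "{#(i, j)#}"] unfolding smul_sgen by simp
qed

text \<open>Supercommutativity in the only form used later, for two generators multiplied from the
  left. The signs for inserting \<open>g\<close> and \<open>h\<close> in either order differ only by
  which of the two has to pass the other.\<close>

lemma smul_swap:
  "smul m (sgen i j) (smul m (sgen k l) f) =
    sscale (sg (gpar m (i, j) * gpar m (k, l))) (smul m (sgen k l) (smul m (sgen i j) f))"
proof
  fix M
  let ?g = "(i, j)" and ?h = "(k, l)"
  show "smul m (sgen i j) (smul m (sgen k l) f) M =
    sscale (sg (gpar m ?g * gpar m ?h)) (smul m (sgen k l) (smul m (sgen i j) f)) M"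
  proof (cases "valid_mono m M \<and> {#?g, ?h#} \<subseteq># M")
    case True
    then obtain R where "M = {#?g, ?h#} + R" by (meson mset_subset_eq_exists_conv)
    then have M: "M = add_mset ?g (add_mset ?h R)" by simp
    have v: "valid_mono m M" using True by blast
    show ?thesis
    proof (cases "?g = ?h")
      case True
      \<comment> \<open>The square of an odd generator occurs in no valid monomial, so equal
        generators are even here and the exchange sign is 1.\<close>
      have "gpar m ?g = 0"
      proof (rule ccontr)
        assume "gpar m ?g \<noteq> 0"
        then have "gpar m ?g = 1" using gpar_cases[of m ?g] by simp
        then have "count M ?g \<le> 1" using v unfolding valid_mono_def by blast
        then show False unfolding M using True by simp
      qed
      then show ?thesis using True by (simp add: sscale_def sg_0)
    next
      case False
      have odd: "x \<notin># R" if "x = ?g \<or> x = ?h" "gpar m x = 1" for x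
      proof -
        have "count M x \<le> 1" using v that(2) unfolding valid_mono_def by blast
        then have "count R x = 0" using that(1) False unfolding M by (auto split: if_splits)
        then show ?thesis by (simp add: count_eq_zero_iff)
      qed
      have 1: "M - {#?g#} = add_mset ?h R" "M - {#?h#} = add_mset ?g R"
        unfolding M using False by auto
      have True': "valid_mono m M \<and> {#?h, ?g#} \<subseteq># M"
        unfolding add_mset_commute[of ?h ?g "{#}"] by (rule True)
      have "smul m (sgen i j) (smul m (sgen k l) f) M =
          gsign m ?g (add_mset ?h R) * (gsign m ?h R * f R)"
        unfolding smul_sgen2 if_P[OF True] 1 by simp
      moreover have "smul m (sgen k l) (smul m (sgen i j) f) M =
          gsign m ?h (add_mset ?g R) * (gsign m ?g R * f R)"
        unfolding smul_sgen2 if_P[OF True'] 1 by simp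
      moreover have "gsign m ?g (add_mset ?h R) =
          sg (if gpar m ?g = 1 \<and> gpar m ?h = 1 \<and> ?h < ?g then 1 else 0) * gsign m ?g R"
        using odd by (intro gsign_add) blast
      moreover have "gsign m ?h (add_mset ?g R) =
          sg (if gpar m ?h = 1 \<and> gpar m ?g = 1 \<and> ?g < ?h then 1 else 0) * gsign m ?h R"
        using odd by (intro gsign_add) blast
      moreover have "sg (if gpar m ?g = 1 \<and> gpar m ?h = 1 \<and> ?h < ?g then 1 else 0) =
          sg (gpar m ?g * gpar m ?h) * sg (if gpar m ?h = 1 \<and> gpar m ?g = 1 \<and> ?g < ?h then 1 else 0)"
        by (rule sg_flip[OF False gpar_cases gpar_cases])
      ultimately show ?thesis unfolding sscale_def by (simp only: mult_ac)
    qed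
  next
    case False
    have *: "\<not> (valid_mono m M \<and> {#?h, ?g#} \<subseteq># M)"
      unfolding add_mset_commute[of ?h ?g "{#}"] by (rule False)
    have "smul m (sgen i j) (smul m (sgen k l) f) M = 0"
      unfolding smul_sgen2 by (rule if_not_P[OF False])
    moreover have "smul m (sgen k l) (smul m (sgen i j) f) M = 0"
      unfolding smul_sgen2 by (rule if_not_P[OF *])
    ultimately show ?thesis by (simp add: sscale_def)
  qed
qed

definition gprod :: "nat \<Rightarrow> gen list \<Rightarrow> salg" where
  "gprod m gs = sprod m (map (\<lambda>g. sgen (fst g) (snd g)) gs)"

lemma gprod_simps:
  "gprod m [] = sone" "gprod m (g # gs) = smul m (sgen (fst g) (snd g)) (gprod m gs)"
  by (simp_all add: gprod_def sprod_def)

lemma gprod_swap: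
  "gprod m (us @ g # h # ws) = sscale (sg (gpar m g * gpar m h)) (gprod m (us @ h # g # ws))"
proof (induction us)
  case Nil
  show ?case using smul_swap[of m "fst g" "snd g" "fst h" "snd h"] by (simp add: gprod_simps)
next
  case (Cons u us)
  then show ?case by (simp add: gprod_simps smul_scale_right)
qed

lemma gprod_support: "gprod m gs M \<noteq> 0 \<Longrightarrow> M = mset gs"
proof (induction gs arbitrary: M)
  case Nil
  then show ?case by (auto simp: gprod_simps sone_def split: if_splits)
next
  case (Cons g gs)
  then have "g \<in># M" "gprod m gs (M - {#g#}) \<noteq> 0"
    by (auto simp: gprod_simps smul_sgen split: if_splits)
  then show ?case using Cons.IH[of "M - {#g#}"] insert_DiffM[of g M] by simp
qed

lemma gprod_invalid: "\<not> valid_mono m M \<Longrightarrow> gprod m gs M = 0"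
  by (cases gs) (auto simp: gprod_simps smul_def sone_def valid_mono_def)

lemma spart_gprod: "spart m p (gprod m gs) = (if p = mpar m (mset gs) then gprod m gs else (\<lambda>_. 0))"
  using gprod_support[of m gs] by (auto simp: fun_eq_iff spart_def)

lemma spart_scale: "spart m p (sscale c f) = sscale c (spart m p f)"
  by (auto simp: spart_def sscale_def)

text \<open>The coefficient of the monomial \<open>M\<close> in the matrix entry of the coaction
  from e_J to e_I.\<close>

definition coact_mat :: "nat \<Rightarrow> nat \<Rightarrow> mono \<Rightarrow> nat list \<Rightarrow> nat list \<Rightarrow> complex" where
  "coact_mat m r M I J = sg (dsign m r I J) * gprod m (zip I J) M"

lemma sprod_zip:
  assumes "length I = r" "length J = r"
  shows "sprod m (map (\<lambda>a. sgen (I ! a) (J ! a)) [k..<r]) = gprod m (drop k (zip I J))"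
proof -
  have "map (\<lambda>a. sgen (I ! a) (J ! a)) [k..<r] = map (\<lambda>g. sgen (fst g) (snd g)) (drop k (zip I J))"
    by (rule nth_equalityI) (use assms in auto)
  then show ?thesis by (simp add: gprod_def)
qed

subsection \<open>The signed place permutation action\<close>

lemma idx_length: "I \<in> idx N r \<Longrightarrow> length I = r"
  by (simp add: idx_def)

lemma finite_idx [simp]: "finite (idx N r)"
proof -
  have "idx N r = {J. set J \<subseteq> {1..N} \<and> length J = r}" by (auto simp: idx_def)
  then show ?thesis using finite_lists_length_eq[of "{1..N}" r] by simp
qed

text \<open>The right action on index lists: the entry at place \<open>l\<close> is taken from place
  \<open>\<sigma> l\<close>. Composition therefore reverses in \<open>lperm_comp\<close>.\<close>

definition lperm :: "nat \<Rightarrow> (nat \<Rightarrow> nat) \<Rightarrow> 'a list \<Rightarrow> 'a list" where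
  "lperm r \<sigma> I = map (\<lambda>l. I ! (\<sigma> l - 1)) [1..<r + 1]"

lemma length_lperm [simp]: "length (lperm r \<sigma> I) = r"
  by (simp add: lperm_def)

lemma lperm_nth: "1 \<le> l \<Longrightarrow> l \<le> r \<Longrightarrow> lperm r \<sigma> I ! (l - 1) = I ! (\<sigma> l - 1)"
  by (cases l) (simp_all add: lperm_def del: upt_Suc)

lemma perms_range: "\<sigma> \<in> perms r \<Longrightarrow> 1 \<le> l \<Longrightarrow> l \<le> r \<Longrightarrow> 1 \<le> \<sigma> l \<and> \<sigma> l \<le> r"
  using permutes_in_image[of \<sigma> "{1..r}" l] by (simp add: perms_def)

lemma list_eq_nth1:
  assumes "length I = r" "length J = r" "\<And>l. 1 \<le> l \<Longrightarrow> l \<le> r \<Longrightarrow> I ! (l - 1) = J ! (l - 1)"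
  shows "I = J"
proof (rule nth_equalityI)
  fix i assume "i < length I"
  then show "I ! i = J ! i" using assms(1) assms(3)[of "Suc i"] by simp
qed (simp add: assms)

lemma lperm_comp:
  assumes "\<sigma> \<in> perms r" "\<tau> \<in> perms r"
  shows "lperm r (\<sigma> \<circ> \<tau>) I = lperm r \<tau> (lperm r \<sigma> I)"
proof (rule list_eq_nth1[of _ r])
  fix l assume l: "1 \<le> l" "l \<le> r"
  have t: "1 \<le> \<tau> l" "\<tau> l \<le> r" using perms_range[OF assms(2) l] by auto
  show "lperm r (\<sigma> \<circ> \<tau>) I ! (l - 1) = lperm r \<tau> (lperm r \<sigma> I) ! (l - 1)"
    unfolding lperm_nth[OF l] lperm_nth[OF t] by simp
qed simp_all

lemma lperm_id: "length I = r \<Longrightarrow> lperm r id I = I"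
  by (rule list_eq_nth1[of _ r]) (simp_all add: lperm_nth del: One_nat_def)

lemma mset_lperm:
  assumes "\<sigma> \<in> perms r" "length I = r"
  shows "mset (lperm r \<sigma> I) = mset I"
proof -
  have p: "\<sigma> permutes {1..r}" using assms(1) by (simp add: perms_def)
  have "mset (lperm r \<sigma> I) = image_mset (\<lambda>k. I ! (k - 1)) (image_mset \<sigma> (mset_set {1..r}))"
    unfolding lperm_def mset_map by (simp add: multiset.map_comp comp_def atLeastLessThanSuc_atLeastAtMost del: upt_Suc)
  also have "image_mset \<sigma> (mset_set {1..r}) = mset_set {1..r}"
    using image_mset_mset_set[of \<sigma> "{1..r}"] permutes_inj_on[OF p] permutes_image[OF p] by simp
  also have "image_mset (\<lambda>k. I ! (k - 1)) (mset_set {1..r}) = mset (map (\<lambda>k. I ! (k - 1)) [1..<r + 1])"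
    by (simp add: atLeastLessThanSuc_atLeastAtMost del: upt_Suc)
  also have "map (\<lambda>k. I ! (k - 1)) [1..<r + 1] = I"
    using lperm_id[OF assms(2)] by (simp add: lperm_def)
  finally show ?thesis .
qed

lemma lperm_idx:
  assumes "\<sigma> \<in> perms r" "I \<in> idx N r"
  shows "lperm r \<sigma> I \<in> idx N r"
proof -
  have "mset (lperm r \<sigma> I) = mset I" using mset_lperm[OF assms(1)] assms(2) idx_length by blast
  then have "set (lperm r \<sigma> I) = set I" by (rule mset_eq_setD)
  then show ?thesis using assms(2) by (simp add: idx_def)
qed

lemma pact_eq:
  "pact m n r \<sigma> v K = (if K \<in> idx (m + n) r then peps m r \<sigma> (lperm r \<sigma> K) * v (lperm r \<sigma> K) else 0)"
  by (simp add: pact_def lperm_def Let_def)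

text \<open>The contribution of one pair to the sign of \<sigma>, written so as to be symmetric in
  \<open>k\<close> and \<open>l\<close>; pairs may then be relabelled regardless of their
  order.\<close>

definition inv_sign :: "(nat \<Rightarrow> nat) \<Rightarrow> nat \<Rightarrow> nat \<Rightarrow> complex" where
  "inv_sign \<sigma> k l = (if (k < l) = (\<sigma> k < \<sigma> l) then 1 else -1)"

definition opairs :: "nat set \<Rightarrow> (nat \<times> nat) set" where
  "opairs S = {(k, l). k \<in> S \<and> l \<in> S \<and> k < l}"

definition odd_pos :: "nat \<Rightarrow> nat \<Rightarrow> nat list \<Rightarrow> nat set" where
  "odd_pos m r J = {l \<in> {1..r}. ipar m (J ! (l - 1)) = 1}"

lemma finite_odd_pos [simp]: "finite (odd_pos m r J)"
  by (simp add: odd_pos_def)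

lemma finite_opairs [simp]: "finite S \<Longrightarrow> finite (opairs S)"
  by (rule finite_subset[of _ "S \<times> S"]) (auto simp: opairs_def)

lemma peps_prod:
  assumes "\<sigma> \<in> perms r"
  shows "peps m r \<sigma> J = (\<Prod>(k, l)\<in>opairs (odd_pos m r J). inv_sign \<sigma> k l)"
proof -
  let ?O = "opairs (odd_pos m r J)"
  have inj: "\<sigma> k \<noteq> \<sigma> l" if "k < l" for k l
    using permutes_inj[of \<sigma> "{1..r}"] assms that by (auto simp: perms_def inj_def)
  have "(\<Prod>(k, l)\<in>?O. inv_sign \<sigma> k l) = (\<Prod>p\<in>?O. if \<sigma> (snd p) < \<sigma> (fst p) then -1 else 1)"
  proof (rule prod.cong[OF refl])
    fix p assume p: "p \<in> ?O"
    obtain k l where kl: "p = (k, l)" by (cases p)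
    have "k < l" using p unfolding kl opairs_def by simp
    then show "(case p of (k, l) \<Rightarrow> inv_sign \<sigma> k l) = (if \<sigma> (snd p) < \<sigma> (fst p) then -1 else 1)"
      using inj[of k l] unfolding kl inv_sign_def by auto
  qed
  also have "\<dots> = (-1) ^ card {p \<in> ?O. \<sigma> (snd p) < \<sigma> (fst p)}"
    by (simp add: prod.If_cases Int_def)
  also have "{p \<in> ?O. \<sigma> (snd p) < \<sigma> (fst p)} = {(k, l). k \<in> {1..r} \<and> l \<in> {1..r} \<and> k < l \<and> \<sigma> l < \<sigma> k \<and>
      ipar m (J ! (k - 1)) = 1 \<and> ipar m (J ! (l - 1)) = 1}"
    by (auto simp: opairs_def odd_pos_def)
  finally show ?thesis unfolding peps_def sg_def by simp
qed

lemma inv_sign_sym: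
  assumes "k \<noteq> l" "\<sigma> k \<noteq> \<sigma> l"
  shows "inv_sign \<sigma> k l = inv_sign \<sigma> l k"
proof -
  have "(l < k) = (\<not> k < l)" "(\<sigma> l < \<sigma> k) = (\<not> \<sigma> k < \<sigma> l)" using assms by auto
  then show ?thesis unfolding inv_sign_def by simp
qed

text \<open>Applying \<tau> to an increasing pair may reverse it. It is then sorted again, which
  leaves the symmetric factor unchanged.\<close>

lemma prod_opairs_image:
  assumes inj: "inj (\<tau> :: nat \<Rightarrow> nat)" and inj\<sigma>: "inj (\<sigma> :: nat \<Rightarrow> nat)"
  shows "(\<Prod>(k, l)\<in>opairs (\<tau> ` S). inv_sign \<sigma> k l) = (\<Prod>(k, l)\<in>opairs S. inv_sign \<sigma> (\<tau> k) (\<tau> l))"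
proof (rule prod.reindex_bij_witness[where
      i = "\<lambda>(k, l). if \<tau> k < \<tau> l then (\<tau> k, \<tau> l) else (\<tau> l, \<tau> k)" and
      j = "\<lambda>(a, b). if inv \<tau> a < inv \<tau> b then (inv \<tau> a, inv \<tau> b) else (inv \<tau> b, inv \<tau> a)"])
  have inv: "inv \<tau> (\<tau> k) = k" for k using inj by (rule inv_f_f)
  fix p
  {
    assume "p \<in> opairs (\<tau> ` S)"
    then obtain k l where p: "p = (\<tau> k, \<tau> l)" "k \<in> S" "l \<in> S" "\<tau> k < \<tau> l" by (auto simp: opairs_def)
    then have kl: "k \<noteq> l" by auto
    let ?j = "case p of (a, b) \<Rightarrow> if inv \<tau> a < inv \<tau> b then (inv \<tau> a, inv \<tau> b) else (inv \<tau> b, inv \<tau> a)"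
    have j: "?j = (if k < l then (k, l) else (l, k))" unfolding p(1) by (simp add: inv)
    show "(case ?j of (k, l) \<Rightarrow> if \<tau> k < \<tau> l then (\<tau> k, \<tau> l) else (\<tau> l, \<tau> k)) = p"
      unfolding j using p kl by auto
    show "?j \<in> opairs S" unfolding j opairs_def using p kl by auto
    have "inv_sign \<sigma> (\<tau> k) (\<tau> l) = inv_sign \<sigma> (\<tau> l) (\<tau> k)"
      by (rule inv_sign_sym) (use kl injD[OF inj] injD[OF inj\<sigma>] in blast)+
    then show "(case ?j of (k, l) \<Rightarrow> inv_sign \<sigma> (\<tau> k) (\<tau> l)) = (case p of (k, l) \<Rightarrow> inv_sign \<sigma> k l)"
      unfolding p(1) by (simp add: inv)
  next
    assume "p \<in> opairs S"
    then obtain k l where p: "p = (k, l)" "k \<in> S" "l \<in> S" "k < l" by (auto simp: opairs_def)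
    have kl: "\<tau> k \<noteq> \<tau> l" using p(4) injD[OF inj, of k l] by auto
    let ?i = "case p of (k, l) \<Rightarrow> if \<tau> k < \<tau> l then (\<tau> k, \<tau> l) else (\<tau> l, \<tau> k)"
    have i: "?i = (if \<tau> k < \<tau> l then (\<tau> k, \<tau> l) else (\<tau> l, \<tau> k))" unfolding p(1) by simp
    show "(case ?i of (a, b) \<Rightarrow> if inv \<tau> a < inv \<tau> b then (inv \<tau> a, inv \<tau> b) else (inv \<tau> b, inv \<tau> a)) = p"
      unfolding i using p(4) by (auto simp: inv p(1))
    show "?i \<in> opairs (\<tau> ` S)" unfolding i opairs_def using p(2,3) kl by auto
  }
qed

lemma perms_inj: "\<sigma> \<in> perms r \<Longrightarrow> inj \<sigma>"
  using permutes_inj by (auto simp: perms_def)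

text \<open>The cocycle law of the Koszul signs. The sign of each pair is multiplicative under
  composition, and \<tau> carries the odd places of the permuted list to the odd places of
  \<open>J\<close>.\<close>

lemma peps_comp:
  assumes \<sigma>: "\<sigma> \<in> perms r" and \<tau>: "\<tau> \<in> perms r"
  shows "peps m r (\<sigma> \<circ> \<tau>) (lperm r \<tau> J) = peps m r \<sigma> J * peps m r \<tau> (lperm r \<tau> J)"
proof -
  let ?S = "odd_pos m r (lperm r \<tau> J)"
  have "odd_pos m r J = \<tau> ` ?S"
  proof
    show "\<tau> ` ?S \<subseteq> odd_pos m r J"
    proof
      fix k assume "k \<in> \<tau> ` ?S"
      then obtain l where l: "k = \<tau> l" "1 \<le> l" "l \<le> r" "ipar m (lperm r \<tau> J ! (l - 1)) = 1"
        by (auto simp: odd_pos_def)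
      then show "k \<in> odd_pos m r J"
        using perms_range[OF \<tau> l(2,3)] lperm_nth[OF l(2,3), of \<tau> J] by (simp add: odd_pos_def)
    qed
    show "odd_pos m r J \<subseteq> \<tau> ` ?S"
    proof
      fix k assume k: "k \<in> odd_pos m r J"
      let ?l = "inv \<tau> k"
      have kk: "1 \<le> k" "k \<le> r" using k by (auto simp: odd_pos_def)
      have l: "1 \<le> ?l" "?l \<le> r" using perms_range[OF inv_perms[OF \<tau>] kk] by auto
      have "\<tau> ?l = k" using permutes_inverses(1)[of \<tau> "{1..r}" k] \<tau> by (simp add: perms_def)
      then have "?l \<in> ?S" using k l lperm_nth[OF l, of \<tau> J] by (simp add: odd_pos_def)
      then show "k \<in> \<tau> ` ?S" using \<open>\<tau> ?l = k\<close> by (metis imageI)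
    qed
  qed
  then have "peps m r \<sigma> J = (\<Prod>(k, l)\<in>opairs ?S. inv_sign \<sigma> (\<tau> k) (\<tau> l))"
    unfolding peps_prod[OF \<sigma>] by (simp add: prod_opairs_image perms_inj[OF \<sigma>] perms_inj[OF \<tau>])
  moreover have "inv_sign (\<sigma> \<circ> \<tau>) k l = inv_sign \<sigma> (\<tau> k) (\<tau> l) * inv_sign \<tau> k l" for k l
    by (auto simp: inv_sign_def)
  ultimately show ?thesis
    unfolding peps_prod[OF \<tau>] peps_prod[OF comp_perms[OF \<sigma> \<tau>]]
    by (simp add: case_prod_unfold prod.distrib)
qed

interpretation pact: perm_rep r "pact m n r" for m n r
proof
  fix \<sigma> \<tau> :: "nat \<Rightarrow> nat" and v :: tvec
  assume \<sigma>: "\<sigma> \<in> perms r" and \<tau>: "\<tau> \<in> perms r"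
  show "pact m n r (\<sigma> \<circ> \<tau>) v = pact m n r \<sigma> (pact m n r \<tau> v)"
  proof
    fix K
    show "pact m n r (\<sigma> \<circ> \<tau>) v K = pact m n r \<sigma> (pact m n r \<tau> v) K"
      using lperm_idx[OF \<sigma>, of K "m + n"] peps_comp[OF \<sigma> \<tau>, of m "lperm r \<sigma> K"]
      unfolding pact_eq lperm_comp[OF \<sigma> \<tau>] by simp
  qed
qed (auto simp: pact_eq fun_eq_iff distrib_left)

lemma lperm_adj:
  assumes "1 \<le> i" "i < r" "length K = r"
  shows "lperm r (adj i) K = swap_at i K"
proof (rule list_eq_nth1[of _ r])
  fix l assume l: "1 \<le> l" "l \<le> r"
  consider "l = i" | "l = Suc i" | "l \<noteq> i" "l \<noteq> Suc i" by blast
  then show "lperm r (adj i) K ! (l - 1) = swap_at i K ! (l - 1)"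
    unfolding lperm_nth[OF l] using assms l
    by cases (auto simp: adj_def swap_at_def transpose_def nth_list_update)
qed (simp_all add: assms)

lemma peps_adj:
  assumes "1 \<le> i" "i < r"
  shows "peps m r (adj i) J = sg (ipar m (J ! (i - 1)) * ipar m (J ! i))"
proof -
  have iff: "k < l \<and> adj i l < adj i k \<longleftrightarrow> k = i \<and> l = Suc i" for k l
    by (auto simp: adj_def transpose_def)
  let ?b = "ipar m (J ! (i - 1)) = 1 \<and> ipar m (J ! i) = 1"
  have "{(k, l). k \<in> {1..r} \<and> l \<in> {1..r} \<and> k < l \<and> adj i l < adj i k \<and>
      ipar m (J ! (k - 1)) = 1 \<and> ipar m (J ! (l - 1)) = 1} = (if ?b then {(i, Suc i)} else {})"
  proof (rule set_eqI)
    fix p :: "nat \<times> nat"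
    obtain k l where p: "p = (k, l)" by (cases p)
    show "p \<in> {(k, l). k \<in> {1..r} \<and> l \<in> {1..r} \<and> k < l \<and> adj i l < adj i k \<and>
      ipar m (J ! (k - 1)) = 1 \<and> ipar m (J ! (l - 1)) = 1} \<longleftrightarrow> p \<in> (if ?b then {(i, Suc i)} else {})"
      unfolding p using iff[of k l] assms by (cases "k = i \<and> l = Suc i") auto
  qed
  then have "peps m r (adj i) J = sg (card (if ?b then {(i, Suc i)} else {}))"
    unfolding peps_def by simp
  also have "\<dots> = sg (ipar m (J ! (i - 1)) * ipar m (J ! i))"
    using ipar_cases[of m "J ! (i - 1)"] ipar_cases[of m "J ! i"] by (elim disjE) simp_all
  finally show ?thesis .
qed

section \<open>Commutation of the coaction with signed place permutations\<close>

lemma zip_swap_at: "length I = length J \<Longrightarrow> 1 \<le> i \<Longrightarrow> i < length I \<Longrightarrow> zip (swap_at i I) (swap_at i J) = swap_at i (zip I J)"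
  by (rule nth_equalityI) (auto simp: swap_at_def nth_list_update)

lemma swap_at_swap_at: "1 \<le> i \<Longrightarrow> i < length I \<Longrightarrow> swap_at i (swap_at i I) = I"
  by (rule nth_equalityI) (auto simp: swap_at_def nth_list_update)

lemma gprod_swap_at:
  assumes "1 \<le> i" "i < length gs"
  shows "gprod m (swap_at i gs) = sscale (sg (gpar m (gs ! (i - 1)) * gpar m (gs ! i))) (gprod m gs)"
proof -
  have i: "i - 1 < length gs" "Suc (i - 1) = i" using assms by auto
  have gs: "gs = take (i - 1) gs @ gs ! (i - 1) # gs ! i # drop (Suc i) gs"
    using id_take_nth_drop[OF i(1)] Cons_nth_drop_Suc[OF assms(2)] i(2) by simp
  have "swap_at i gs = take (i - 1) gs @ gs ! i # gs ! (i - 1) # drop (Suc i) gs"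
    by (subst gs, rule swap_at_append2) (use assms in auto)
  then have "gprod m (swap_at i gs) = gprod m (take (i - 1) gs @ gs ! i # gs ! (i - 1) # drop (Suc i) gs)"
    by simp
  also have "\<dots> = sscale (sg (gpar m (gs ! i) * gpar m (gs ! (i - 1)))) (gprod m gs)"
    unfolding gprod_swap[of m "take (i - 1) gs" "gs ! i"] gs[symmetric] ..
  finally show ?thesis by (simp add: mult.commute)
qed

text \<open>Only the pair of list indices \<open>i - 1\<close> and \<open>i\<close> changes its
  relative order; its old and new contributions are added crosswise, to avoid subtraction of natural
  numbers.\<close>

lemma dsign_swap_at:
  assumes i: "1 \<le> i" "i < r" and len: "length I = r" "length J = r"
  shows "dsign m r (swap_at i I) (swap_at i J) + ipar m (I ! (i - 1)) * (ipar m (I ! i) + ipar m (J ! i)) =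
    dsign m r I J + ipar m (I ! i) * (ipar m (I ! (i - 1)) + ipar m (J ! (i - 1)))"
proof -
  define t where "t = transpose (i - 1) i"
  define g where "g a b = ipar m (I ! a) * (ipar m (I ! b) + ipar m (J ! b))" for a b
  have p: "t permutes {..<r}" unfolding t_def using i by (intro permutes_swap_id) auto
  have nth: "swap_at i I ! a = I ! t a" "swap_at i J ! a = J ! t a" if "a < r" for a
    using that i len by (auto simp: swap_at_def t_def transpose_def nth_list_update)
  have tt: "t (t a) = a" for a by (simp add: t_def)
  have "dsign m r (swap_at i I) (swap_at i J) = (\<Sum>a<r. \<Sum>b<r. if a < b then g (t a) (t b) else 0)"
    unfolding dsign_def g_def by (intro sum.cong refl) (simp add: nth)
  also have "\<dots> = (\<Sum>a<r. \<Sum>b<r. if t a < t b then g a b else 0)"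
  proof -
    have "(\<Sum>b<r. if a < b then g (t a) (t b) else 0) = (\<Sum>b<r. if a < t b then g (t a) b else 0)" for a
      by (subst sum.permute[OF p]) (simp add: comp_def tt)
    moreover have "(\<Sum>a<r. \<Sum>b<r. if a < t b then g (t a) b else 0) = (\<Sum>a<r. \<Sum>b<r. if t a < t b then g a b else 0)"
      by (subst sum.permute[OF p]) (simp add: comp_def tt)
    ultimately show ?thesis by simp
  qed
  also have "\<dots> + g (i - 1) i = (\<Sum>a<r. \<Sum>b<r. if a < b then g a b else 0) + g i (i - 1)"
  proof -
    have "(\<Sum>a<r. \<Sum>b<r. if a = x \<and> b = y then g x y else 0) = g x y" if "x < r" "y < r" for x y
    proof -
      have "(\<Sum>a<r. \<Sum>b<r. if a = x \<and> b = y then g x y else 0) = (\<Sum>a<r. if a = x then g x y else 0)"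
        using that by (intro sum.cong refl) auto
      then show ?thesis using that by simp
    qed
    note d = this[of "i - 1" i] this[of i "i - 1"]
    have pt: "(if t a < t b then g a b else 0) + (if a = i - 1 \<and> b = i then g (i - 1) i else 0) =
      (if a < b then g a b else 0) + (if a = i \<and> b = i - 1 then g i (i - 1) else 0)" for a b
    proof -
      have "t a < t b \<longleftrightarrow> a < b" if "\<not> (a = i - 1 \<and> b = i)" "\<not> (a = i \<and> b = i - 1)"
        using that i unfolding t_def transpose_def by auto
      moreover have "t (i - 1) = i" "t i = i - 1" "i - 1 < i" using i by (auto simp: t_def)
      ultimately show ?thesis by (cases "a = i - 1 \<and> b = i"; cases "a = i \<and> b = i - 1") auto
    qed
    have "(\<Sum>a<r. \<Sum>b<r. if t a < t b then g a b else 0) + (\<Sum>a<r. \<Sum>b<r. if a = i - 1 \<and> b = i then g (i - 1) i else 0) =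
      (\<Sum>a<r. \<Sum>b<r. if a < b then g a b else 0) + (\<Sum>a<r. \<Sum>b<r. if a = i \<and> b = i - 1 then g i (i - 1) else 0)"
      unfolding sum.distrib[symmetric] pt ..
    then show ?thesis using d i by simp
  qed
  finally show ?thesis unfolding dsign_def g_def .
qed

text \<open>Equivariance entry by entry: the change of \<open>dsign\<close>, the exchange of two
  generators and the two Koszul signs of the place permutation cancel.\<close>

lemma coact_mat_swap_at:
  assumes i: "1 \<le> i" "i < r" and len: "length I = r" "length J = r"
  shows "sg (ipar m (I ! (i - 1)) * ipar m (I ! i)) * coact_mat m r M (swap_at i I) (swap_at i J) =
    sg (ipar m (J ! (i - 1)) * ipar m (J ! i)) * coact_mat m r M I J"
proof -
  let ?ip = "ipar m (I ! (i - 1))" and ?iq = "ipar m (I ! i)"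
  let ?jp = "ipar m (J ! (i - 1))" and ?jq = "ipar m (J ! i)"
  let ?z = "gpar m (zip I J ! (i - 1)) * gpar m (zip I J ! i)"
  have g: "gpar m (zip I J ! (i - 1)) = (?ip + ?jp) mod 2" "gpar m (zip I J ! i) = (?iq + ?jq) mod 2"
    using i len by (simp_all add: gpar_def)
  have "gprod m (zip (swap_at i I) (swap_at i J)) = sscale (sg ?z) (gprod m (zip I J))"
    using zip_swap_at[of I J i] gprod_swap_at[of i "zip I J" m] i len by simp
  then have "coact_mat m r M (swap_at i I) (swap_at i J) = sg (dsign m r (swap_at i I) (swap_at i J)) * sg ?z * gprod m (zip I J) M"
    by (simp add: coact_mat_def sscale_def)
  then have "sg (?ip * ?iq) * coact_mat m r M (swap_at i I) (swap_at i J) =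
      sg (?ip * ?iq + dsign m r (swap_at i I) (swap_at i J) + ?z) * gprod m (zip I J) M"
    by (simp add: sg_add)
  also have "sg (?ip * ?iq + dsign m r (swap_at i I) (swap_at i J) + ?z) = sg (?jp * ?jq + dsign m r I J)"
  proof (rule sg_cong)
    \<comment> \<open>A case check over the parities of the two row and two column indices
      involved.\<close>
    have c: "even (?ip * ?iq + ?z + ?jp * ?jq + ?ip * (?iq + ?jq) + ?iq * (?ip + ?jp))"
      using ipar_cases[of m "I ! (i - 1)"] ipar_cases[of m "I ! i"] ipar_cases[of m "J ! (i - 1)"]
        ipar_cases[of m "J ! i"] unfolding g by (elim disjE) simp_all
    have d: "even (dsign m r (swap_at i I) (swap_at i J) + ?ip * (?iq + ?jq) + (dsign m r I J + ?iq * (?ip + ?jp)))"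
      unfolding dsign_swap_at[OF assms] by simp
    have "even (x + e + z + (w + d))" if "even (x + z + w + f + h)" "even (e + f + (d + h))" for x e z w d f h :: nat
      using that by presburger
    from this[OF c d] show "even (?ip * ?iq + dsign m r (swap_at i I) (swap_at i J) + ?z + (?jp * ?jq + dsign m r I J))" .
  qed
  finally show ?thesis by (simp add: coact_mat_def sg_add)
qed

definition coact :: "nat \<Rightarrow> nat \<Rightarrow> nat \<Rightarrow> mono \<Rightarrow> tvec \<Rightarrow> tvec" where
  "coact m n r M v = (\<lambda>I. if I \<in> idx (m + n) r then \<Sum>J\<in>idx (m + n) r. coact_mat m r M I J * v J else 0)"

lemma coact_pact_adj:
  assumes i: "1 \<le> i" "i < r"
  shows "pact m n r (adj i) (coact m n r M v) = coact m n r M (pact m n r (adj i) v)"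
proof
  fix K
  show "pact m n r (adj i) (coact m n r M v) K = coact m n r M (pact m n r (adj i) v) K"
  proof (cases "K \<in> idx (m + n) r")
    case True
    let ?X = "idx (m + n) r"
    have swap_at: "swap_at i L \<in> ?X" if "L \<in> ?X" for L
      using lperm_idx[OF adj_perms[OF i] that] lperm_adj[OF i idx_length[OF that]] by simp
    have pa: "pact m n r (adj i) w L = sg (ipar m (L ! (i - 1)) * ipar m (L ! i)) * w (swap_at i L)"
      if "L \<in> ?X" for w L
    proof -
      have "swap_at i L ! (i - 1) = L ! i" "swap_at i L ! i = L ! (i - 1)"
        using i idx_length[OF that] by (auto simp: swap_at_def nth_list_update)
      then show ?thesis
        unfolding pact_eq if_P[OF that] lperm_adj[OF i idx_length[OF that]] peps_adj[OF i]
        by (simp add: mult.commute)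
    qed
    let ?s = "\<lambda>L. sg (ipar m (L ! (i - 1)) * ipar m (L ! i))"
    have "pact m n r (adj i) (coact m n r M v) K = (\<Sum>L\<in>?X. ?s K * coact_mat m r M (swap_at i K) L * v L)"
      unfolding pa[OF True] coact_def if_P[OF swap_at[OF True]] by (simp add: sum_distrib_left mult.assoc)
    also have "\<dots> = (\<Sum>L\<in>?X. ?s K * coact_mat m r M (swap_at i K) (swap_at i L) * v (swap_at i L))"
    proof (rule sum.reindex_bij_witness[of _ "swap_at i" "swap_at i"])
      fix L assume L: "L \<in> ?X"
      show ss: "swap_at i (swap_at i L) = L" using i idx_length[OF L] by (intro swap_at_swap_at) auto
      then show "swap_at i (swap_at i L) = L" .
      show "swap_at i L \<in> ?X" using swap_at[OF L] .
      then show "swap_at i L \<in> ?X" .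
      show "?s K * coact_mat m r M (swap_at i K) (swap_at i (swap_at i L)) * v (swap_at i (swap_at i L)) =
          ?s K * coact_mat m r M (swap_at i K) L * v L" unfolding ss ..
    qed
    also have "\<dots> = (\<Sum>L\<in>?X. ?s L * coact_mat m r M K L * v (swap_at i L))"
      using coact_mat_swap_at[OF i idx_length[OF True]] idx_length by (intro sum.cong refl) simp
    also have "\<dots> = coact m n r M (pact m n r (adj i) v) K"
      unfolding coact_def if_P[OF True] by (intro sum.cong refl) (simp add: pa mult_ac)
    finally show ?thesis .
  qed (simp add: pact_eq coact_def)
qed

lemma pact_id: "pact m n r id v = (\<lambda>K. if K \<in> idx (m + n) r then v K else 0)"
proof
  fix K
  have "peps m r id J = 1" for J unfolding peps_prod[OF id_perms] inv_sign_def by simp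
  then show "pact m n r id v K = (if K \<in> idx (m + n) r then v K else 0)"
    unfolding pact_eq by (simp add: lperm_id idx_length)
qed

lemma coact_pact:
  assumes "\<sigma> \<in> perms r"
  shows "pact m n r \<sigma> (coact m n r M v) = coact m n r M (pact m n r \<sigma> v)"
  using assms
proof (induction arbitrary: v rule: perms_induct_adj)
  case id
  show ?case unfolding pact_id coact_def by (rule ext) (auto intro!: sum.cong)
next
  case (adj \<sigma> i)
  have a: "adj i \<in> perms r" using adj.hyps by (intro adj_perms)
  show ?case
    unfolding pact.act_comp[OF adj.hyps(1) a] coact_pact_adj[OF adj.hyps(2,3)] adj.IH ..
qed

lemma coact_gact: "gact m n r x (coact m n r M v) = coact m n r M (gact m n r x v)"
proof
  fix I
  have "gact m n r x (coact m n r M v) I = (\<Sum>\<sigma>\<in>perms r. x \<sigma> * coact m n r M (pact m n r \<sigma> v) I)"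
    unfolding gact_def by (intro sum.cong refl) (simp add: coact_pact)
  also have "\<dots> = coact m n r M (gact m n r x v) I"
    unfolding coact_def gact_def
    by (simp add: sum_distrib_left sum.swap[of _ "perms r"] mult.left_commute)
  finally show "gact m n r x (coact m n r M v) I = coact m n r M (gact m n r x v) I" .
qed

subsection \<open>The super-immanant as a supertrace\<close>

lemma smul_zero_left: "smul m (\<lambda>_. 0) f = (\<lambda>_. 0)"
  by (auto simp: fun_eq_iff smul_def)

lemma smul_zero_right: "smul m f (\<lambda>_. 0) = (\<lambda>_. 0)"
  by (auto simp: fun_eq_iff smul_def)

lemma spart_zero: "spart m p (\<lambda>_. 0) = (\<lambda>_. 0)"
  by (auto simp: spart_def)

lemma sscale_zero: "sscale c (\<lambda>_. 0) = (\<lambda>_. 0)"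
  by (simp add: sscale_def)

lemma mpar_01: "mpar m M \<in> {0, 1}"
  by (auto simp: mpar_def)

definition tpar :: "nat \<Rightarrow> nat list \<Rightarrow> nat list \<Rightarrow> nat \<Rightarrow> nat" where
  "tpar m I J a = ipar m (I ! a) + ipar m (J ! a)"

text \<open>The exponent collected when the factors X_{k+1}, ..., X_r are multiplied: each matrix
  unit has to pass the generators of all later factors.\<close>

definition xsum :: "nat \<Rightarrow> nat \<Rightarrow> nat list \<Rightarrow> nat list \<Rightarrow> nat \<Rightarrow> nat" where
  "xsum m r I J k = (\<Sum>a\<in>{k..<r}. \<Sum>b\<in>{Suc a..<r}. tpar m I J a * tpar m I J b)"

lemma xsum_rec: "k < r \<Longrightarrow> xsum m r I J k = tpar m I J k * (\<Sum>b\<in>{Suc k..<r}. tpar m I J b) + xsum m r I J (Suc k)"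
  unfolding xsum_def by (subst sum.atLeast_Suc_lessThan) (simp_all add: sum_distrib_left)

lemma mpar_drop:
  assumes "length I = r" "length J = r" "k \<le> r"
  shows "even (mpar m (mset (drop k (zip I J))) + (\<Sum>b\<in>{k..<r}. tpar m I J b))"
proof -
  let ?gs = "drop k (zip I J)"
  have "(\<Sum>g\<in>#mset ?gs. gpar m g) = sum_list (map (gpar m) ?gs)"
    by (simp only: mset_map[symmetric] sum_mset_sum_list)
  also have "\<dots> = (\<Sum>i<r - k. gpar m (?gs ! i))"
    using assms by (simp add: sum_list_sum_nth atLeast0LessThan)
  also have "\<dots> = (\<Sum>i<r - k. tpar m I J (k + i) mod 2)"
    using assms by (intro sum.cong refl) (simp add: gpar_def tpar_def)
  also have "\<dots> = (\<Sum>b\<in>{k..<r}. tpar m I J b mod 2)"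
    by (rule sum.reindex_bij_witness[of _ "\<lambda>b. b - k" "\<lambda>i. k + i"]) (use assms in auto)
  finally have "mpar m (mset ?gs) = (\<Sum>b\<in>{k..<r}. tpar m I J b) mod 2"
    unfolding mpar_def by (simp add: mod_sum_eq)
  then show ?thesis by (simp add: even_iff_mod_2_eq_zero mod_simps)
qed

text \<open>The factors from place \<open>Suc k\<close> on act as the identity on the first
  \<open>k\<close> places. Descending on \<open>k\<close> follows \<open>foldr\<close>, where a new
  factor joins on the left.\<close>

lemma Xtail:
  assumes J: "J \<in> idx (m + n) r" and I: "I \<in> idx (m + n) r" and k: "k \<le> r"
  shows "foldr (tmul m n r) (map (Xop m n r) [Suc k..<r + 1]) (tone m n r) J I =
    (if \<forall>b<k. J ! b = I ! b then sscale (sg (xsum m r J I k)) (gprod m (drop k (zip J I))) else (\<lambda>_. 0))"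
  using k J
proof (induction k arbitrary: J rule: inc_induct)
  case base
  have len: "length J = r" "length I = r" using base I idx_length by blast+
  have "J = I \<longleftrightarrow> (\<forall>b<r. J ! b = I ! b)" using len by (simp add: list_eq_iff_nth_eq)
  then show ?case using base len by (auto simp: tone_def gprod_simps xsum_def sg_0 sscale_def)
next
  case (step k)
  have len: "length J = r" "length I = r" using step.prems I idx_length by blast+
  let ?T = "\<lambda>K. foldr (tmul m n r) (map (Xop m n r) [Suc (Suc k)..<r + 1]) (tone m n r) K I"
  have IH: "?T K = (if \<forall>b<Suc k. K ! b = I ! b then sscale (sg (xsum m r K I (Suc k))) (gprod m (drop (Suc k) (zip K I))) else (\<lambda>_. 0))"
    if "K \<in> idx (m + n) r" for K using step.IH[OF that] .
  have upt: "[Suc k..<r + 1] = Suc k # [Suc (Suc k)..<r + 1]"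
    using step.hyps by (subst upt_conv_Cons) auto
  \<comment> \<open>The only intermediate index list that can contribute: the new factor leaves
    \<open>J\<close> unchanged except at list index \<open>k\<close>, and the tail requires
    agreement with \<open>I\<close> up to there.\<close>
  let ?K = "J[k := I ! k]"
  let ?term = "\<lambda>M K. \<Sum>p\<in>{0, 1::nat}. sg (p * epar m r J K + esign m r J K I) *
      smul m (Xop m n r (Suc k) J K) (spart m p (?T K)) M"
  have lhs: "foldr (tmul m n r) (map (Xop m n r) [Suc k..<r + 1]) (tone m n r) J I M =
      (\<Sum>K\<in>idx (m + n) r. ?term M K)" for M
    unfolding upt by (simp add: tmul_def del: upt_Suc)
  have zero: "?term M K = 0" if K: "K \<in> idx (m + n) r" and ne: "\<not> ((\<forall>b<k. J ! b = I ! b) \<and> K = ?K)" for M K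
  proof -
    consider (x) "\<not> (\<forall>b<r. b \<noteq> k \<longrightarrow> J ! b = K ! b)" | (t) "\<not> (\<forall>b<Suc k. K ! b = I ! b)"
    proof -
      have False if a: "\<forall>b<r. b \<noteq> k \<longrightarrow> J ! b = K ! b" and b: "\<forall>b<Suc k. K ! b = I ! b"
      proof -
        have "K = ?K"
        proof (rule nth_equalityI)
          fix i assume "i < length K"
          then have "i < r" using idx_length[OF K] by simp
          then show "K ! i = ?K ! i" using a b len by (cases "i = k") (auto simp: nth_list_update)
        qed (use idx_length[OF K] len in simp)
        moreover have "J ! b' = I ! b'" if "b' < k" for b'
          using a b that step.hyps by simp
        ultimately show False using ne by blast
      qed
      then show thesis using that by blast
    qed
    then show ?thesis
    proof cases
      case x
      then have "Xop m n r (Suc k) J K = (\<lambda>_. 0)" unfolding Xop_def by auto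
      then show ?thesis by (simp add: smul_zero_left)
    next
      case t
      show ?thesis unfolding IH[OF K] if_not_P[OF t] spart_zero smul_zero_right by simp
    qed
  qed
  show ?case
  proof (cases "\<forall>b<k. J ! b = I ! b")
    case False
    have "(\<Sum>K\<in>idx (m + n) r. ?term M K) = 0" for M
      by (rule sum.neutral, rule ballI, rule zero) (use False in blast)+
    then show ?thesis unfolding if_not_P[OF False] by (intro ext) (simp only: lhs)
  next
    case True
    have K: "?K \<in> idx (m + n) r"
    proof -
      have "I ! k \<in> set I" using step.hyps len by simp
      then have "I ! k \<in> {1..m + n}" using I by (auto simp: idx_def)
      then show ?thesis using step.prems set_update_subset_insert[of J k "I ! k"] by (auto simp: idx_def)
    qed
    let ?gs = "drop (Suc k) (zip J I)"
    let ?q = "mpar m (mset ?gs)"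
    have X: "Xop m n r (Suc k) J ?K = sgen (J ! k) (I ! k)"
      using step.prems K len step.hyps by (simp add: Xop_def)
    have gs: "drop (Suc k) (zip ?K I) = ?gs"
      using len by (simp add: drop_zip)
    have xs: "xsum m r ?K I (Suc k) = xsum m r J I (Suc k)"
      unfolding xsum_def tpar_def by (intro sum.cong refl) simp
    have T: "?T ?K = sscale (sg (xsum m r J I (Suc k))) (gprod m ?gs)"
      using True len step.hyps unfolding IH[OF K] gs xs
      by (simp add: less_Suc_eq nth_list_update)
    have gk: "smul m (sgen (J ! k) (I ! k)) (gprod m ?gs) = gprod m (drop k (zip J I))"
    proof -
      have "drop k (zip J I) = (J ! k, I ! k) # ?gs"
        using Cons_nth_drop_Suc[of k "zip J I"] len step.hyps by simp
      then show ?thesis by (simp only: gprod_simps(2) fst_conv snd_conv)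
    qed
    have sp: "smul m (sgen (J ! k) (I ! k)) (spart m p (?T ?K)) =
        (if p = ?q then sscale (sg (xsum m r J I (Suc k))) (gprod m (drop k (zip J I))) else (\<lambda>_. 0))" for p
      unfolding T spart_scale spart_gprod
      by (cases "p = ?q") (simp_all only: if_True if_False simp_thms smul_scale_right gk sscale_zero smul_zero_right)
    \<comment> \<open>Away from \<open>k\<close> the lists \<open>J\<close> and \<open>?K\<close>
      agree and contribute even terms.\<close>
    have e1: "even (epar m r J ?K + tpar m J I k)"
    proof -
      have "epar m r J ?K = tpar m J I k + (\<Sum>a\<in>{..<r} - {k}. ipar m (J ! a) + ipar m (?K ! a))"
        unfolding epar_def using step.hyps len by (subst sum.remove[of _ k]) (auto simp: tpar_def)
      moreover have "even (\<Sum>a\<in>{..<r} - {k}. ipar m (J ! a) + ipar m (?K ! a))"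
        by (rule dvd_sum) simp
      ultimately show ?thesis by simp
    qed
    \<comment> \<open>The first factor can be odd only for \<open>b = k\<close>; then
      \<open>a < k\<close>, where \<open>?K\<close> and \<open>I\<close> agree, so the second factor
      is even.\<close>
    have e2: "even (esign m r J ?K I)"
      unfolding esign_def
    proof (intro dvd_sum)
      fix a b assume ab: "a \<in> {..<r}" "b \<in> {..<r}"
      show "even (if a < b then (ipar m (J ! b) + ipar m (?K ! b)) * (ipar m (?K ! a) + ipar m (I ! a)) else 0)"
      proof (cases "b = k \<and> a < b")
        case b: True
        then have "?K ! a = I ! a" using True by simp
        then show ?thesis using b by simp
      next
        case False
        then show ?thesis by (cases "b = k") auto
      qed
    qed
    \<comment> \<open>What remains is the parity of the new matrix unit times that of the remaining
      generators, the summand by which \<open>xsum\<close> grows.\<close>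
    have sign: "sg (?q * epar m r J ?K + esign m r J ?K I) * sg (xsum m r J I (Suc k)) = sg (xsum m r J I k)"
    proof -
      have "even (?q + (\<Sum>b\<in>{Suc k..<r}. tpar m J I b))"
        using mpar_drop[of J r I "Suc k" m] len step.hyps by simp
      then have "even (?q * epar m r J ?K + esign m r J ?K I + tpar m J I k * (\<Sum>b\<in>{Suc k..<r}. tpar m J I b))"
        using e1 e2 by (simp add: even_add even_mult_iff) blast
      then have "sg (?q * epar m r J ?K + esign m r J ?K I) = sg (tpar m J I k * (\<Sum>b\<in>{Suc k..<r}. tpar m J I b))"
        by (rule sg_cong)
      then show ?thesis using step.hyps by (simp add: xsum_rec sg_add)
    qed
    have "foldr (tmul m n r) (map (Xop m n r) [Suc k..<r + 1]) (tone m n r) J I M =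
        sscale (sg (xsum m r J I k)) (gprod m (drop k (zip J I))) M" for M
    proof -
      have "(\<Sum>K\<in>idx (m + n) r. ?term M K) = ?term M ?K"
        by (rule sum_delta2[OF finite_idx K]) (rule zero, auto)
      also have "\<dots> = (\<Sum>p\<in>{0, 1::nat}. if p = ?q then sg (?q * epar m r J ?K + esign m r J ?K I) *
          sscale (sg (xsum m r J I (Suc k))) (gprod m (drop k (zip J I))) M else 0)"
        unfolding X sp by (intro sum.cong refl) auto
      also have "\<dots> = sg (?q * epar m r J ?K + esign m r J ?K I) *
          sscale (sg (xsum m r J I (Suc k))) (gprod m (drop k (zip J I))) M"
        using mpar_01[of m "mset ?gs"] by (subst sum.delta) auto
      also have "\<dots> = sscale (sg (xsum m r J I k)) (gprod m (drop k (zip J I))) M"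
        unfolding sscale_def sign[symmetric] by simp
      finally show ?thesis unfolding lhs .
    qed
    then show ?thesis unfolding if_P[OF True] by (rule ext)
  qed
qed

lemma Xprod_eq:
  assumes "J \<in> idx (m + n) r" "I \<in> idx (m + n) r"
  shows "Xprod m n r J I = sscale (sg (xsum m r J I 0)) (gprod m (zip J I))"
  using Xtail[OF assms, of 0] by (simp add: Xprod_def del: upt_Suc)

lemma sum_less_if: "(\<Sum>b<r. if a < b then f b else 0) = (\<Sum>b\<in>{Suc a..<r}. f b :: nat)"
  by (rule sum.mono_neutral_cong_right) auto

text \<open>For diagonal coefficients the sign from multiplying the permutation operator into the
  product equals the one already inside \<open>Xprod\<close>, so the two cancel in
  \<open>imm_eq\<close>.\<close>

lemma esign_xsum: "esign m r I J I = xsum m r J I 0"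
  unfolding esign_def xsum_def tpar_def sum_less_if atLeast0LessThan
  by (intro sum.cong refl) (simp add: algebra_simps)

text \<open>The sign that identifies operators with tensors is the comodule sign with exchanged
  indices, so the coaction matrix emerges with its own sign.\<close>

lemma sgam_dsign: "sgam m r I J = dsign m r J I"
  unfolding sgam_def dsign_def by (subst sum.swap) (intro sum.cong refl, simp add: algebra_simps)

lemma even_gammaIJ: "even (gammaIJ m r I I)"
  unfolding gammaIJ_def by (intro dvd_add dvd_sum) auto

lemma gact_tbasis_mset:
  assumes "gact m n r x (tbasis J) I \<noteq> 0"
  shows "I \<in> idx (m + n) r" "mset J = mset I"
proof -
  obtain \<sigma> where \<sigma>: "\<sigma> \<in> perms r" "pact m n r \<sigma> (tbasis J) I \<noteq> 0"
  proof -
    have "\<exists>\<sigma>\<in>perms r. x \<sigma> * pact m n r \<sigma> (tbasis J) I \<noteq> 0"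
    proof (rule ccontr)
      assume "\<not> ?thesis"
      then have "gact m n r x (tbasis J) I = 0" unfolding gact_def by (intro sum.neutral) blast
      then show False using assms by simp
    qed
    then show thesis using that by auto
  qed
  then show I: "I \<in> idx (m + n) r" unfolding pact_eq by (simp split: if_splits)
  have "lperm r \<sigma> I = J" using \<sigma>(2) unfolding pact_eq tbasis_def by (simp split: if_splits)
  then show "mset J = mset I" using mset_lperm[OF \<sigma>(1) idx_length[OF I]] by simp
qed

lemma even_epar:
  assumes "mset I = mset J" "length I = r"
  shows "even (epar m r I J)"
proof -
  have len: "length J = r" using assms(2) mset_eq_length[OF assms(1)] by simp
  have "(\<Sum>a<r. ipar m (K ! a)) = sum_mset (image_mset (ipar m) (mset K))" if "length K = r" for K
    using that by (simp add: sum_mset_sum_list flip: mset_map) (simp add: sum_list_sum_nth atLeast0LessThan)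
  from this[OF assms(2)] this[OF len] have "(\<Sum>a<r. ipar m (I ! a)) = (\<Sum>a<r. ipar m (J ! a))"
    using assms(1) by simp
  then show ?thesis by (simp add: epar_def sum.distrib)
qed

text \<open>A permutation links only rearrangements, so \<open>epar\<close> is even and drops out;
  after the cancellation of \<open>esign\<close> against \<open>xsum\<close>, the sign
  \<open>sgam\<close> completes the entries of the coaction. The sum is the diagonal entry at
  \<open>I\<close> of the operator of \<open>x\<close> composed with the coaction.\<close>

lemma imm_eq:
  assumes I: "I \<in> idx (m + n) r"
  shows "imm m n r x I M = sg (Ibar m I) * (\<Sum>J\<in>idx (m + n) r. coact_mat m r M J I * gact m n r x (tbasis J) I)"
proof -
  have "tmul m n r (gal_tens m n r x) (Xprod m n r) I I M =
      (\<Sum>J\<in>idx (m + n) r. coact_mat m r M J I * gact m n r x (tbasis J) I)"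
    unfolding tmul_def
  proof (rule sum.cong[OF refl])
    fix J assume J: "J \<in> idx (m + n) r"
    let ?g = "gact m n r x (tbasis J) I" and ?q = "mpar m (mset (zip J I))"
    let ?z = "sg (sgam m r I J) * ?g"
    have gt: "gal_tens m n r x I J = sscale ?z sone" using I J by (simp add: gal_tens_def)
    have sp: "smul m (gal_tens m n r x I J) (spart m p (Xprod m n r J I)) M =
        (if p = ?q then ?z * sg (xsum m r J I 0) * gprod m (zip J I) M else 0)" for p
      unfolding gt smul_const Xprod_eq[OF J I] spart_scale spart_gprod
      using gprod_invalid[of m M] by (auto simp: sscale_def)
    show "(\<Sum>p\<in>{0, 1}. sg (p * epar m r I J + esign m r I J I) *
        smul m (gal_tens m n r x I J) (spart m p (Xprod m n r J I)) M) = coact_mat m r M J I * ?g"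
    proof (cases "?g = 0")
      case True
      then show ?thesis unfolding sp by simp
    next
      case False
      have ev: "even (epar m r I J)"
        using gact_tbasis_mset(2)[OF False] idx_length[OF I] by (intro even_epar) auto
      have "sg (p * epar m r I J + esign m r I J I) = sg (xsum m r J I 0)" for p
        unfolding esign_xsum by (rule sg_cong) (use ev in simp)
      then have "(\<Sum>p\<in>{0, 1}. sg (p * epar m r I J + esign m r I J I) *
          smul m (gal_tens m n r x I J) (spart m p (Xprod m n r J I)) M) =
          (\<Sum>p\<in>{0, 1}. if p = ?q then sg (xsum m r J I 0) * (?z * sg (xsum m r J I 0) * gprod m (zip J I) M) else 0)"
        unfolding sp by (intro sum.cong refl) simp
      also have "\<dots> = sg (xsum m r J I 0) * (?z * sg (xsum m r J I 0) * gprod m (zip J I) M)"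
        using mpar_01[of m "mset (zip J I)"] by (subst sum.delta) auto
      also have "\<dots> = (sg (xsum m r J I 0) * sg (xsum m r J I 0)) * (?z * gprod m (zip J I) M)"
        by (simp only: mult_ac)
      also have "\<dots> = coact_mat m r M J I * ?g"
        unfolding sg_sq coact_mat_def sgam_dsign by (simp only: mult_ac mult_1)
      finally show ?thesis .
    qed
  qed
  then show ?thesis by (simp add: imm_def bracket_def sscale_def sg_even[OF even_gammaIJ])
qed

lemma (in perm_rep) gext_gconj:
  "gext r act (gconj r x) v z = (\<Sum>h\<in>perms r. act h (gext r act x (act (inv h) v)) z)"
proof -
  have "gext r act (gconj r x) v z = (\<Sum>\<pi>\<in>perms r. \<Sum>h\<in>perms r. x (inv h \<circ> \<pi> \<circ> h) * act \<pi> v z)"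
    unfolding gext_def gconj_def by (simp add: sum_distrib_right)
  also have "\<dots> = (\<Sum>h\<in>perms r. \<Sum>\<pi>\<in>perms r. x (inv h \<circ> \<pi> \<circ> h) * act \<pi> v z)"
    by (rule sum.swap)
  also have "\<dots> = (\<Sum>h\<in>perms r. \<Sum>\<tau>\<in>perms r. x \<tau> * act h (act \<tau> (act (inv h) v)) z)"
  proof (rule sum.cong[OF refl])
    fix h assume h: "h \<in> perms r"
    show "(\<Sum>\<pi>\<in>perms r. x (inv h \<circ> \<pi> \<circ> h) * act \<pi> v z) =
        (\<Sum>\<tau>\<in>perms r. x \<tau> * act h (act \<tau> (act (inv h) v)) z)"
    proof (rule sum.reindex_bij_witness[of _ "\<lambda>\<tau>. h \<circ> (\<tau> \<circ> inv h)" "\<lambda>\<pi>. inv h \<circ> \<pi> \<circ> h"])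
      fix \<pi> assume \<pi>: "\<pi> \<in> perms r"
      show 1: "h \<circ> (inv h \<circ> \<pi> \<circ> h \<circ> inv h) = \<pi>"
        using h by (simp add: perms_group_simps[where r = r] comp_assoc)
      show mem: "inv h \<circ> \<pi> \<circ> h \<in> perms r" using h \<pi> by simp
      have "act h (act (inv h \<circ> \<pi> \<circ> h) (act (inv h) v)) = act (h \<circ> (inv h \<circ> \<pi> \<circ> h \<circ> inv h)) v"
        using h mem by (simp only: act_comp comp_perms inv_perms)
      then show "x (inv h \<circ> \<pi> \<circ> h) * act h (act (inv h \<circ> \<pi> \<circ> h) (act (inv h) v)) z =
          x (inv h \<circ> \<pi> \<circ> h) * act \<pi> v z" unfolding 1 by simp
    next
      fix \<tau> assume \<tau>: "\<tau> \<in> perms r"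
      show "inv h \<circ> (h \<circ> (\<tau> \<circ> inv h)) \<circ> h = \<tau>"
        using h by (simp add: perms_group_simps[where r = r] comp_assoc)
      show "h \<circ> (\<tau> \<circ> inv h) \<in> perms r" using h \<tau> by simp
    qed
  qed
  also have "\<dots> = (\<Sum>h\<in>perms r. act h (gext r act x (act (inv h) v)) z)"
    unfolding gext_def by (intro sum.cong refl) (simp only: act_sum)
  finally show ?thesis .
qed

text \<open>The second property comes from applying \<open>h\<close> to the first equation, as
  \<open>h\<close> composed with its inverse fixes \<open>tbasis I\<close>; no count of inversions
  is required. It makes the signs cancel in diagonal entries.\<close>

lemma pact_tbasis:
  assumes h: "h \<in> perms r" and I: "I \<in> idx (m + n) r"
  obtains c where "pact m n r (inv h) (tbasis I) = (\<lambda>K. c * tbasis (lperm r h I) K)"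
    "c * peps m r h (lperm r h I) = 1"
proof
  let ?c = "peps m r (inv h) I"
  have h': "inv h \<in> perms r" using h by simp
  have cancel: "lperm r h (lperm r (inv h) K) = K" "lperm r (inv h) (lperm r h K) = K" if "length K = r" for K
    using lperm_comp[OF h' h, of K] lperm_comp[OF h h', of K] perms_inv_o[OF h] lperm_id[OF that] by simp_all
  show eq: "pact m n r (inv h) (tbasis I) = (\<lambda>K. ?c * tbasis (lperm r h I) K)"
  proof
    fix K
    have "lperm r (inv h) K = I \<longleftrightarrow> K = lperm r h I" if "K \<in> idx (m + n) r"
    proof
      assume "lperm r (inv h) K = I"
      then show "K = lperm r h I" using cancel(1)[OF idx_length[OF that]] by simp
    next
      assume "K = lperm r h I"
      then show "lperm r (inv h) K = I" using cancel(2)[OF idx_length[OF I]] by simp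
    qed
    then show "pact m n r (inv h) (tbasis I) K = ?c * tbasis (lperm r h I) K"
      using lperm_idx[OF h I] unfolding pact_eq tbasis_def by auto
  qed
  have "pact m n r (h \<circ> inv h) (tbasis I) I = pact m n r h (pact m n r (inv h) (tbasis I)) I"
    unfolding pact.act_comp[OF h h'] ..
  then have "1 = pact m n r h (\<lambda>K. ?c * tbasis (lperm r h I) K) I"
    unfolding perms_inv_o[OF h] pact_id eq using I by (simp add: tbasis_def)
  then show "?c * peps m r h (lperm r h I) = 1"
    unfolding pact_eq using I by (simp add: tbasis_def mult.commute)
qed

lemma tvec_expand:
  assumes "\<And>K. K \<notin> idx N r \<Longrightarrow> v K = 0"
  shows "v = (\<lambda>K. \<Sum>J\<in>idx N r. v J * tbasis J K)"
proof
  fix K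
  have "(\<Sum>J\<in>idx N r. v J * tbasis J K) = (\<Sum>J\<in>idx N r. if J = K then v K else 0)"
    by (intro sum.cong refl) (auto simp: tbasis_def)
  then show "v K = (\<Sum>J\<in>idx N r. v J * tbasis J K)" using assms[of K] by simp
qed

lemma gact_scale: "gact m n r x (\<lambda>z. c * v z) = (\<lambda>z. c * gact m n r x v z)"
  unfolding gact_eq_gext by (rule pact.gext_scale)

lemma gact_expand:
  assumes "\<And>K. K \<notin> idx (m + n) r \<Longrightarrow> v K = 0"
  shows "gact m n r x v K = (\<Sum>J\<in>idx (m + n) r. v J * gact m n r x (tbasis J) K)"
  by (subst tvec_expand[OF assms], assumption) (simp add: gact_eq_gext pact.gext_sum)

lemma coact_tbasis: "I \<in> idx (m + n) r \<Longrightarrow>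
  coact m n r M (tbasis I) = (\<lambda>J. if J \<in> idx (m + n) r then coact_mat m r M J I else 0)"
  by (auto simp: coact_def tbasis_def fun_eq_iff if_distrib[of "\<lambda>c. _ * c"] cong: if_cong)

lemma sum_gconj:
  assumes I: "I \<in> idx (m + n) r"
  shows "(\<Sum>J\<in>idx (m + n) r. coact_mat m r M J I * gact m n r (gconj r e) (tbasis J) I) =
    (\<Sum>h\<in>perms r. gact m n r e (coact m n r M (tbasis (lperm r h I))) (lperm r h I))"
proof -
  have "(\<Sum>J\<in>idx (m + n) r. coact_mat m r M J I * gact m n r (gconj r e) (tbasis J) I) =
      gact m n r (gconj r e) (coact m n r M (tbasis I)) I"
    by (subst gact_expand) (simp_all add: coact_tbasis[OF I])
  also have "\<dots> = (\<Sum>h\<in>perms r. pact m n r h (gact m n r e (pact m n r (inv h) (coact m n r M (tbasis I)))) I)"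
    unfolding gact_eq_gext by (rule pact.gext_gconj)
  also have "\<dots> = (\<Sum>h\<in>perms r. gact m n r e (coact m n r M (tbasis (lperm r h I))) (lperm r h I))"
  proof (rule sum.cong[OF refl])
    fix h assume h: "h \<in> perms r"
    obtain c where c: "pact m n r (inv h) (tbasis I) = (\<lambda>K. c * tbasis (lperm r h I) K)"
      "c * peps m r h (lperm r h I) = 1" by (rule pact_tbasis[OF h I])
    have Ds: "coact m n r M (\<lambda>K. c * w K) = (\<lambda>K. c * coact m n r M w K)" for w
      by (auto simp: coact_def fun_eq_iff sum_distrib_left mult.left_commute)
    let ?R = "gact m n r e (coact m n r M (tbasis (lperm r h I))) (lperm r h I)"
    have "pact m n r h (gact m n r e (pact m n r (inv h) (coact m n r M (tbasis I)))) I =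
        peps m r h (lperm r h I) * (c * ?R)"
      unfolding coact_pact[OF inv_perms[OF h]] c(1) Ds gact_scale unfolding pact_eq if_P[OF I] ..
    also have "\<dots> = (c * peps m r h (lperm r h I)) * ?R" by (simp only: mult_ac)
    finally show "pact m n r h (gact m n r e (pact m n r (inv h) (coact m n r M (tbasis I)))) I = ?R"
      unfolding c(2) by simp
  qed
  finally show ?thesis .
qed

lemma ex_lperm:
  assumes "mset J = mset I" "length I = r"
  obtains g where "g \<in> perms r" "lperm r g I = J"
proof -
  obtain p where p: "p permutes {..<r}" "permute_list p I = J"
    using mset_eq_permutation[OF assms(1)] assms(2) by blast
  \<comment> \<open>The permutation \<open>p\<close> of list indices is shifted to places counted
    from 1 and is the identity elsewhere.\<close>
  define g where "g l = (if l \<in> {1..r} then Suc (p (l - 1)) else l)" for l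
  have "bij_betw (Suc \<circ> p \<circ> (\<lambda>l. l - 1)) {1..r} {1..r}"
  proof (intro bij_betw_trans)
    show "bij_betw (\<lambda>l. l - 1) {1..r} {..<r}"
      by (rule bij_betw_byWitness[where f' = Suc]) auto
    show "bij_betw p {..<r} {..<r}" by (rule permutes_imp_bij[OF p(1)])
    show "bij_betw Suc {..<r} {1..r}"
      by (rule bij_betw_byWitness[where f' = "\<lambda>l. l - 1"]) auto
  qed
  then have "bij_betw g {1..r} {1..r}"
    by (rule bij_betw_cong[THEN iffD1, rotated]) (simp add: g_def)
  then have "g permutes {1..r}" by (rule bij_imp_permutes) (auto simp: g_def)
  then have "g \<in> perms r" by (simp add: perms_def)
  moreover have "lperm r g I = J"
  proof (rule list_eq_nth1[of _ r])
    have len: "length J = r" using assms(2) mset_eq_length[OF assms(1)] by simp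
    then show "length J = r" .
    fix l assume l: "1 \<le> l" "l \<le> r"
    then have "J ! (l - 1) = I ! (p (l - 1))"
      unfolding p(2)[symmetric] using permute_list_nth[of p I "l - 1"] p(1) assms(2) by simp
    then show "lperm r g I ! (l - 1) = J ! (l - 1)"
      unfolding lperm_nth[OF l] using l by (simp add: g_def)
  qed simp
  ultimately show thesis by (rule that)
qed

text \<open>Composition with \<open>g\<close> maps the stabiliser of \<open>I\<close> bijectively
  onto the fibre over \<open>J\<close>, so all fibres have one size; \<open>r!\<close> divided by
  the number of rearrangements is that size.\<close>

lemma card_fibre:
  assumes "length I = r" "mset J = mset I"
  shows "card {h \<in> perms r. lperm r h I = J} = (\<Prod>x\<in>set_mset (mset I). fact (count (mset I) x))"
proof -
  let ?W = "permutations_of_multiset (mset I)"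
  let ?fib = "\<lambda>J. {h \<in> perms r. lperm r h I = J}"
  have const: "card (?fib J) = card (?fib I)" if J: "mset J = mset I" for J
  proof -
    obtain g where g: "g \<in> perms r" "lperm r g I = J" by (rule ex_lperm[OF J assms(1)])
    have g': "inv g \<in> perms r" using g by simp
    have "lperm r (inv g) J = lperm r (g \<circ> inv g) I" unfolding lperm_comp[OF g(1) g'] g(2) ..
    then have gi: "lperm r (inv g) J = I" unfolding perms_inv_o(2)[OF g(1)] lperm_id[OF assms(1)] .
    have "bij_betw (\<lambda>h. h \<circ> g) (?fib I) (?fib J)"
    proof (rule bij_betw_byWitness[where f' = "\<lambda>h. h \<circ> inv g"])
      show "(\<lambda>h. h \<circ> g) ` ?fib I \<subseteq> ?fib J"
      proof
        fix k assume "k \<in> (\<lambda>h. h \<circ> g) ` ?fib I"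
        then obtain h where h: "h \<in> perms r" "lperm r h I = I" "k = h \<circ> g" by blast
        have "lperm r k I = J" unfolding h(3) lperm_comp[OF h(1) g(1)] h(2) by (rule g(2))
        moreover have "k \<in> perms r" unfolding h(3) by (rule comp_perms[OF h(1) g(1)])
        ultimately show "k \<in> ?fib J" by simp
      qed
      show "(\<lambda>h. h \<circ> inv g) ` ?fib J \<subseteq> ?fib I"
      proof
        fix k assume "k \<in> (\<lambda>h. h \<circ> inv g) ` ?fib J"
        then obtain h where h: "h \<in> perms r" "lperm r h I = J" "k = h \<circ> inv g" by blast
        have "lperm r k I = I" unfolding h(3) lperm_comp[OF h(1) g'] h(2) by (rule gi)
        moreover have "k \<in> perms r" unfolding h(3) by (rule comp_perms[OF h(1) g'])
        ultimately show "k \<in> ?fib I" by simp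
      qed
      show "\<forall>h\<in>?fib I. h \<circ> g \<circ> inv g = h" "\<forall>h\<in>?fib J. h \<circ> inv g \<circ> g = h"
        by (intro ballI perms_inv_cancel(3,4)[OF g(1)])+
    qed
    then show ?thesis by (simp add: bij_betw_same_card)
  qed
  have "fact r = card (\<Union>J\<in>?W. ?fib J)"
  proof -
    have "perms r = (\<Union>J\<in>?W. ?fib J)"
      by (auto simp: permutations_of_multiset_def mset_lperm assms(1))
    then show ?thesis using card_perms[of r] by simp
  qed
  also have "\<dots> = (\<Sum>J\<in>?W. card (?fib J))"
    by (rule card_UN_disjoint) auto
  also have "\<dots> = (\<Sum>J\<in>?W. card (?fib I))"
    by (rule sum.cong[OF refl], rule const) (simp add: permutations_of_multiset_def)
  also have "\<dots> = card ?W * card (?fib I)" by simp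
  finally have "card ?W * card (?fib I) = card ?W * (\<Prod>x\<in>set_mset (mset I). fact (count (mset I) x))"
    using card_permutations_of_multiset_aux[of "mset I"] assms(1) by simp
  moreover have "card ?W \<noteq> 0"
  proof
    assume "card ?W = 0"
    then show False using card_permutations_of_multiset_aux[of "mset I"] by simp
  qed
  ultimately show ?thesis unfolding const[OF assms(2)] by simp
qed

lemma sum_over_orbit:
  assumes I: "I \<in> idx N r"
  shows "(\<Sum>h\<in>perms r. R (lperm r h I)) =
    of_nat (\<Prod>x\<in>set_mset (mset I). fact (count (mset I) x)) * (\<Sum>J | J \<in> idx N r \<and> mset J = mset I. R J :: complex)"
proof -
  let ?W = "{J. J \<in> idx N r \<and> mset J = mset I}"
  have fin: "finite ?W" by (rule finite_subset[of _ "idx N r"]) auto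
  have im: "lperm r h I \<in> ?W" if "h \<in> perms r" for h
    using lperm_idx[OF that I] mset_lperm[OF that idx_length[OF I]] by simp
  have "(\<Sum>h\<in>perms r. R (lperm r h I)) = (\<Sum>J\<in>?W. \<Sum>h | h \<in> perms r \<and> lperm r h I = J. R (lperm r h I))"
    by (rule sum.group[symmetric]) (use fin im in auto)
  also have "\<dots> = (\<Sum>J\<in>?W. of_nat (\<Prod>x\<in>set_mset (mset I). fact (count (mset I) x)) * R J)"
  proof (rule sum.cong[OF refl])
    fix J assume J: "J \<in> ?W"
    have "(\<Sum>h | h \<in> perms r \<and> lperm r h I = J. R (lperm r h I)) = (\<Sum>h | h \<in> perms r \<and> lperm r h I = J. R J)"
      by (intro sum.cong refl) simp
    also have "\<dots> = of_nat (card {h \<in> perms r. lperm r h I = J}) * R J" by simp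
    also have "card {h \<in> perms r. lperm r h I = J} = (\<Prod>x\<in>set_mset (mset I). fact (count (mset I) x))"
      by (rule card_fibre) (use J idx_length[OF I] in auto)
    finally show "(\<Sum>h | h \<in> perms r \<and> lperm r h I = J. R (lperm r h I)) =
        of_nat (\<Prod>x\<in>set_mset (mset I). fact (count (mset I) x)) * R J" .
  qed
  finally show ?thesis by (simp add: sum_distrib_left)
qed

lemma Imu_snoc: "Imu (mu @ [k]) = Imu mu @ replicate k (Suc (length mu))"
proof -
  have "map (\<lambda>i. replicate ((mu @ [k]) ! (i - 1)) i) [1..<length mu + 1] =
      map (\<lambda>i. replicate (mu ! (i - 1)) i) [1..<length mu + 1]"
    by (rule map_cong) (auto simp: nth_append)
  moreover have "[1..<length (mu @ [k]) + 1] = [1..<length mu + 1] @ [Suc (length mu)]" by simp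
  ultimately show ?thesis unfolding Imu_def by (simp only: map_append concat_append) simp
qed

lemma Imu_facts:
  "length (Imu mu) = sum_list mu \<and> set (Imu mu) \<subseteq> {1..length mu} \<and>
    (\<Prod>x\<in>{1..length mu}. fact (count (mset (Imu mu)) x)) = alpha mu"
proof (induction mu rule: rev_induct)
  case Nil
  show ?case by (simp add: Imu_def alpha_def)
next
  case (snoc k mu)
  let ?l = "length mu"
  have c: "count (mset (Imu (mu @ [k]))) x = count (mset (Imu mu)) x" if "x \<le> ?l" for x
    unfolding Imu_snoc using that by simp
  have "Suc ?l \<notin> set (Imu mu)" using snoc by auto
  then have c': "count (mset (Imu (mu @ [k]))) (Suc ?l) = k"
    unfolding Imu_snoc by (simp add: count_eq_zero_iff flip: set_mset_mset)
  have "(\<Prod>x\<in>{1..length (mu @ [k])}. fact (count (mset (Imu (mu @ [k]))) x)) =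
      (\<Prod>x\<in>{1..?l}. fact (count (mset (Imu (mu @ [k]))) x)) * fact k"
    by (simp add: c')
  also have "(\<Prod>x\<in>{1..?l}. fact (count (mset (Imu (mu @ [k]))) x)) = (alpha mu :: nat)"
    using snoc c by simp
  finally have "(\<Prod>x\<in>{1..length (mu @ [k])}. fact (count (mset (Imu (mu @ [k]))) x)) = alpha (mu @ [k])"
    by (simp add: alpha_def)
  then show ?case using snoc unfolding Imu_snoc by (auto split: if_splits)
qed

lemma alpha_eq: "(\<Prod>x\<in>set_mset (mset (Imu mu)). fact (count (mset (Imu mu)) x)) = alpha mu"
proof -
  have "(\<Prod>x\<in>set_mset (mset (Imu mu)). fact (count (mset (Imu mu)) x)) =
      (\<Prod>x\<in>{1..length mu}. fact (count (mset (Imu mu)) x) :: nat)"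
  proof (rule prod.mono_neutral_left)
    show "set_mset (mset (Imu mu)) \<subseteq> {1..length mu}" using Imu_facts[of mu] by simp
    show "\<forall>x\<in>{1..length mu} - set_mset (mset (Imu mu)). fact (count (mset (Imu mu)) x) = (1::nat)"
    proof
      fix x assume "x \<in> {1..length mu} - set_mset (mset (Imu mu))"
      then have "count (mset (Imu mu)) x = 0" by (simp add: count_eq_zero_iff)
      then show "fact (count (mset (Imu mu)) x) = (1::nat)" by (simp only: fact_0)
    qed
  qed simp
  then show ?thesis using Imu_facts[of mu] by simp
qed

lemma alpha_nonzero: "alpha mu \<noteq> 0"
  by (induction mu) (simp_all add: alpha_def)

definition wrestrict :: "nat \<Rightarrow> nat \<Rightarrow> nat \<Rightarrow> nat list \<Rightarrow> tvec \<Rightarrow> tvec" where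
  "wrestrict m n r mu v = (\<lambda>K. if K \<in> idx (m + n) r \<and> mset K = mset (Imu mu) then v K else 0)"

lemma gact_wrestrict: "gact m n r x (wrestrict m n r mu v) = wrestrict m n r mu (gact m n r x v)"
proof
  fix K
  show "gact m n r x (wrestrict m n r mu v) K = wrestrict m n r mu (gact m n r x v) K"
  proof (cases "K \<in> idx (m + n) r")
    case True
    have "pact m n r \<sigma> (wrestrict m n r mu v) K = (if mset K = mset (Imu mu) then pact m n r \<sigma> v K else 0)"
      if "\<sigma> \<in> perms r" for \<sigma>
      using lperm_idx[OF that True] mset_lperm[OF that idx_length[OF True]] True
      unfolding pact_eq wrestrict_def by simp
    then show ?thesis using True unfolding gact_def wrestrict_def by (simp cong: sum.cong)
  next
    case False
    then show ?thesis unfolding gact_def wrestrict_def by (simp add: pact_eq)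
  qed
qed

lemma wrestrict_Wmu: "v \<in> Wmu m n r mu \<longleftrightarrow> wrestrict m n r mu v = v"
  unfolding Wmu_def wrestrict_def fun_eq_iff by auto

lemma deltaP_eq: "deltaP m n r mu v I M = wrestrict m n r mu (coact m n r M v) I"
proof (cases "I \<in> idx (m + n) r \<and> mset I = mset (Imu mu)")
  case True
  have "sg (dsign m r I J) * sprod m (map (\<lambda>a. sgen (I ! a) (J ! a)) [0..<r]) M = coact_mat m r M I J"
    if "J \<in> idx (m + n) r" for J
    using sprod_zip[of I r J m 0] True idx_length[OF that] idx_length[of I "m + n" r] by (simp add: coact_mat_def)
  then show ?thesis
    using True unfolding deltaP_def wrestrict_def coact_def by (simp add: mult.commute)
qed (auto simp: deltaP_def wrestrict_def)

text \<open>The idempotent commutes with the projection to the weight space, so their product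
  projects onto the intersection of the two images.\<close>

lemma Lmod_Wmu_projection:
  assumes r: "sum_list lam = r" and e: "e = seminormal lam T" and ee: "gmul r e e = e"
  shows "projection (idx (m + n) r) (Lmod m n lam T \<inter> Wmu m n r mu)
    (\<lambda>y z. gact m n r e (wrestrict m n r mu (tbasis z)) y)"
proof
  have L: "Lmod m n lam T = {gact m n r e v | v. v \<in> tspace m n r}"
    unfolding Lmod_def r e Let_def ..
  show "finite (idx (m + n) r)" by simp
  {
    fix z
    have "wrestrict m n r mu (tbasis z) \<in> tspace m n r" by (simp add: tspace_def wrestrict_def)
    moreover have "gact m n r e (wrestrict m n r mu (tbasis z)) \<in> Wmu m n r mu"
      unfolding wrestrict_Wmu gact_wrestrict[symmetric] by (simp add: wrestrict_def cong: if_cong)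
    ultimately show "(\<lambda>y. gact m n r e (wrestrict m n r mu (tbasis z)) y) \<in> Lmod m n lam T \<inter> Wmu m n r mu"
      unfolding L by blast
  }
  fix u y assume u: "u \<in> Lmod m n lam T \<inter> Wmu m n r mu"
  then obtain v where "u = gact m n r e v" unfolding L by blast
  then have eu: "gact m n r e u = u"
    using pact.gext_gmul[of r m n e e v] ee by (simp add: gact_eq_gext)
  have uw: "wrestrict m n r mu u = u" using u wrestrict_Wmu by blast
  have "u y = gact m n r e (wrestrict m n r mu u) y" unfolding uw eu ..
  also have "\<dots> = wrestrict m n r mu (gact m n r e u) y" unfolding gact_wrestrict ..
  also have "\<dots> = (\<Sum>z\<in>idx (m + n) r. u z * wrestrict m n r mu (gact m n r e (tbasis z)) y)"
  proof -
    have *: "gact m n r e u K = (\<Sum>z\<in>idx (m + n) r. u z * gact m n r e (tbasis z) K)" for K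
      by (rule gact_expand) (use uw in \<open>auto simp: wrestrict_def fun_eq_iff split: if_splits\<close>)
    show ?thesis
    proof (cases "y \<in> idx (m + n) r \<and> mset y = mset (Imu mu)")
      case True
      show ?thesis unfolding wrestrict_def if_P[OF True] by (rule *)
    next
      case False
      show ?thesis unfolding wrestrict_def if_not_P[OF False] by simp
    qed
  qed
  also have "\<dots> = (\<Sum>z\<in>idx (m + n) r. gact m n r e (wrestrict m n r mu (tbasis z)) y * u z)"
    unfolding gact_wrestrict by (simp add: mult.commute)
  finally show "u y = (\<Sum>z\<in>idx (m + n) r. gact m n r e (wrestrict m n r mu (tbasis z)) y * u z)" .
qed

theorem theorem2p3:
  fixes m n r :: nat and lam mu :: "nat list" and T :: "nat \<times> nat \<Rightarrow> nat"
  assumes "1 \<le> r"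
    and "lam \<in> hook_set m n r"
    and "length mu = m + n" and "sum_list mu = r"
    and "is_syt lam T"
  shows "\<forall>bs. is_basis (Lmod m n lam T \<inter> Wmu m n r mu) bs \<longrightarrow>
           (\<exists>a. represents m n r mu bs a \<and>
                sscale (1 / of_nat (alpha mu)) (imm m n r (irr_char lam) (Imu mu)) =
                sscale (sg (Ibar m (Imu mu))) (\<lambda>M. \<Sum>k<length bs. a k k M))"
proof (intro allI impI)
  fix bs assume bs: "is_basis (Lmod m n lam T \<inter> Wmu m n r mu) bs"
  let ?X = "idx (m + n) r" and ?I = "Imu mu" and ?U = "Lmod m n lam T \<inter> Wmu m n r mu"
  define e where "e = seminormal lam T"
  have lam: "is_partition r lam" using assms(2) by (simp add: hook_set_def)
  have r: "sum_list lam = r" using lam by (simp add: is_partition_def)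
  have "seminormal_idem r (content_word lam T) e"
    unfolding e_def by (rule mat_unit_idem[OF content_word_V seminormal_mat_unit]) (rule lam assms(5))+
  then have ee: "gmul r e e = e" by (simp add: seminormal_idem_def)
  have I: "?I \<in> ?X" using Imu_facts[of mu] assms(3,4) by (simp add: idx_def)
  interpret projection ?X ?U "\<lambda>y z. gact m n r e (wrestrict m n r mu (tbasis z)) y"
    by (rule Lmod_Wmu_projection[OF r e_def ee])
  define f where "f M v = wrestrict m n r mu (coact m n r M v)" for M v
  define D where "D M z y = (if z \<in> ?X \<and> mset z = mset ?I then coact_mat m r M z y else 0)" for M z y
  have f_D: "f M v z = (\<Sum>y\<in>?X. D M z y * v y)" for M v z
    by (cases "z \<in> ?X \<and> mset z = mset ?I")
      (simp_all only: f_def D_def wrestrict_def coact_def if_True if_False simp_thms mult_zero_left sum.neutral_const)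
  have f_U: "f M u \<in> ?U" if u: "u \<in> ?U" for M u
  proof -
    obtain v where v: "u = gact m n r e v" "v \<in> tspace m n r"
      using u unfolding Lmod_def r Let_def e_def[symmetric] by blast
    have "f M u = gact m n r e (wrestrict m n r mu (coact m n r M v))"
      unfolding f_def v(1) coact_gact[symmetric] gact_wrestrict ..
    moreover have "wrestrict m n r mu w \<in> tspace m n r" for w by (simp add: wrestrict_def tspace_def)
    ultimately have "f M u \<in> Lmod m n lam T" unfolding Lmod_def r Let_def e_def[symmetric] by blast
    moreover have "f M u \<in> Wmu m n r mu" unfolding wrestrict_Wmu f_def by (auto simp: wrestrict_def)
    ultimately show ?thesis by blast
  qed
  \<comment> \<open>For every monomial the coaction is a complex endomorphism of \<open>?U\<close>;
    its matrix entries are the coefficients of the entries in the algebra.\<close>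
  define a where "a l k M = mat_coeff bs (f M) l k" for l k M
  have "represents m n r mu bs a"
    unfolding represents_def
  proof (intro allI impI ext)
    fix k I M assume k: "k < length bs"
    have "f M (bs ! k) = lcomb bs (\<lambda>l. a l k M)"
      unfolding a_def by (rule mat_coeff[OF bs k]) (rule f_U[OF is_basis_nth[OF bs k]])
    then show "deltaP m n r mu (bs ! k) I M = (\<Sum>l<length bs. (bs ! l) I * a l k M)"
      unfolding deltaP_eq f_def[symmetric] by (simp add: lcomb_def mult.commute)
  qed
  moreover have "1 / of_nat (alpha mu) * imm m n r (irr_char lam) ?I M =
      sg (Ibar m ?I) * (\<Sum>k<length bs. a k k M)" for M
  proof -
    \<comment> \<open>The diagonal entry at \<open>J\<close> of the idempotent composed with the
      coaction.\<close>
    define R where "R J = gact m n r e (coact m n r M (tbasis J)) J" for J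
    have R: "R J = (\<Sum>y\<in>?X. coact_mat m r M J y * gact m n r e (tbasis J) y)" if "J \<in> ?X" for J
      unfolding R_def coact_gact unfolding coact_def if_P[OF that] ..
    have "imm m n r (irr_char lam) ?I M =
        sg (Ibar m ?I) * (\<Sum>J\<in>?X. coact_mat m r M J ?I * gact m n r (gconj r e) (tbasis J) ?I)"
      unfolding imm_eq[OF I] irr_char_eq_gconj[OF lam assms(5)] e_def ..
    also have "\<dots> = sg (Ibar m ?I) * (\<Sum>h\<in>perms r. R (lperm r h ?I))"
      unfolding sum_gconj[OF I] R_def ..
    also have "\<dots> = sg (Ibar m ?I) * (of_nat (alpha mu) * (\<Sum>J | J \<in> ?X \<and> mset J = mset ?I. R J))"
      unfolding sum_over_orbit[OF I] alpha_eq ..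
    finally have imm: "imm m n r (irr_char lam) ?I M =
        sg (Ibar m ?I) * (of_nat (alpha mu) * (\<Sum>J | J \<in> ?X \<and> mset J = mset ?I. R J))" .
    have "(\<Sum>k<length bs. a k k M) =
        (\<Sum>z\<in>?X. \<Sum>y\<in>?X. D M z y * gact m n r e (wrestrict m n r mu (tbasis z)) y)"
      unfolding a_def by (rule trace_mat_coeff[OF bs]) (rule f_D)
    also have "\<dots> = (\<Sum>z\<in>?X. if mset z = mset ?I then R z else 0)"
    proof (rule sum.cong[OF refl])
      fix z assume z: "z \<in> ?X"
      show "(\<Sum>y\<in>?X. D M z y * gact m n r e (wrestrict m n r mu (tbasis z)) y) = (if mset z = mset ?I then R z else 0)"
      proof (cases "mset z = mset ?I")
        case True
        \<comment> \<open>The rows of \<open>D\<close> vanish outside the weight \<open>mu\<close>,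
          so the weight projection meets only basis tensors that it fixes.\<close>
        then have "wrestrict m n r mu (tbasis z) = tbasis z" using z by (auto simp: wrestrict_def tbasis_def fun_eq_iff)
        then show ?thesis using True z by (simp add: D_def R)
      qed (simp add: D_def)
    qed
    also have "\<dots> = (\<Sum>J | J \<in> ?X \<and> mset J = mset ?I. R J)"
      by (simp add: sum.inter_filter)
    finally have "(\<Sum>k<length bs. a k k M) = (\<Sum>J | J \<in> ?X \<and> mset J = mset ?I. R J)" .
    then show ?thesis unfolding imm using alpha_nonzero[of mu] by simp
  qed
  ultimately show "\<exists>a. represents m n r mu bs a \<and>
      sscale (1 / of_nat (alpha mu)) (imm m n r (irr_char lam) (Imu mu)) =
      sscale (sg (Ibar m (Imu mu))) (\<lambda>M. \<Sum>k<length bs. a k k M)"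
    unfolding sscale_def by blast
qed

end
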